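(* Let $\mathcal C$ be a small $\mathbb C$-linear category, let $p\in[1,\infty)$, and let $(\mathscr H,\mathcal F)$ be a $p$-summable even Fredholm module over $\mathcal C$. Let $m\ge0$ be an integer with $2m\geq p-1$, and let $\phi^{2m}$ and $\phi^{2m+2}$ be the $2m$- and $(2m+2)$-dimensional characters of $(\mathscr H,\mathcal F)$. Then $$S(\phi^{2m})=-(m+1)\,\phi^{2m+2}\qquad\text{in } H^{2m+2}_\lambda(\mathcal C),$$ where $S$ is the periodicity operator.
   Context: **Even Fredholm modules and characters.** $\mathcal B^q$ denotes the $q$-th Schatten class and $Tr$ the usual trace on trace class operators. A $p$-summable even Fredholm module over $\mathcal C$ is a pair $(\mathscr H,\mathcal F)$, where $\mathscr H$ is a $\mathbb C$-linear functor from $\mathcal C$ to $\mathbb Z_2$-graded separable Hilbert spaces and bounded linear maps with every $\mathscr H(f)$ of degree $0$, and $\mathcal F=\{\mathcal F_X:\mathscr H(X)\to\mathscr H(X)\}_{X\in Ob(\mathcal C)}$ is a family of bounded operators of degree $1$ with $\mathcal F_X^2=id$, such that $[\mathcal F,f]:=\mathcal F_Y\mathscr H(f)-\mathscr H(f)\mathcal F_X\in\mathcal B^p(\mathscr H(X),\mathscr H(Y))$ for all $f\in Hom_{\mathcal C}(X,Y)$. Let $\epsilon$ be the grading operator. For homogeneous $T\in\mathcal B(\mathscr H(X),\mathscr H(X))$ with $[\mathcal F,T]:=\mathcal F_XT-(-1)^{|T|}T\mathcal F_X$ trace class, $Tr_s(T):=\frac12Tr(\epsilon\mathcal F_X[\mathcal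 F,T])$. For $2k\ge p-1$ the $2k$-dimensional character is $$\phi^{2k}(f^0\otimes\cdots\otimes f^{2k}):=Tr_s\left(\mathscr H(f^0)[\mathcal F,f^1]\cdots[\mathcal F,f^{2k}]\right),$$ which is a cyclic cocycle. **Cyclic cohomology.** $CN_n(\mathcal C)=\bigoplus_{(X_0,\dots,X_n)}Hom_{\mathcal C}(X_1,X_0)\otimes Hom_{\mathcal C}(X_2,X_1)\otimes\cdots\otimes Hom_{\mathcal C}(X_0,X_n)$, $CN^n(\mathcal C)$ is its linear dual, $(b\phi)(f^0\otimes\cdots\otimes f^{n+1})=\sum_{i=0}^n(-1)^i\phi(\cdots\otimes f^if^{i+1}\otimes\cdots)+(-1)^{n+1}\phi(f^{n+1}f^0\otimes f^1\otimes\cdots\otimes f^n)$, $(\lambda\phi)(f^0\otimes\cdots\otimes f^n)=(-1)^n\phi(f^n\otimes f^0\otimes\cdots\otimes f^{n-1})$. $C^n_\lambda(\mathcal C)=Ker(1-\lambda)$, $Z^n_\lambda(\mathcal C)=\{\phi\in C^n_\lambda(\mathcal C):b\phi=0\}$, $B^n_\lambda(\mathcal C)=b(C^{n-1}_\lambda(\mathcal C))$, $H^n_\lambda(\mathcal C)=Z^n_\lambda(\mathcal C)/B^n_\lambda(\mathcal C)$. **Cycles.** A DG-semicategory $(\mathcal S,\hat\partial)$ is a $\mathbb C$-linear category without required identities, whose morphism spaces are cochain complexes $(Hom^n_{\mathcal S}(X,Y),\hat\partial)_{n\ge0}$, with composition adding degrees and $\hat\partial(gf)=\hat\partial(g)f+(-1)^{|g|}g\hat\partial(f)$.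 A closed graded trace of dimension $n$ is a family of linear maps $\hat T_X:Hom^n_{\mathcal S}(X,X)\to\mathbb C$ vanishing on $\hat\partial(Hom^{n-1}_{\mathcal S}(X,X))$ with $\hat T_X(gg')=(-1)^{ij}\hat T_Y(g'g)$ for $g\in Hom^i_{\mathcal S}(Y,X)$, $g'\in Hom^j_{\mathcal S}(X,Y)$, $i+j=n$. An $n$-dimensional cycle over $\mathcal C$ is $(\mathcal S,\hat\partial,\hat T,\rho)$ with $\mathcal S^0$ (degree $0$ morphisms) an ordinary category, $\hat T$ a closed graded trace of dimension $n$ and $\rho:\mathcal C\to\mathcal S^0$ a $\mathbb C$-linear semifunctor (preserving composition). Its character is $\phi(f^0\otimes\cdots\otimes f^n)=\hat T_{X_0}(\rho(f^0)\hat\partial\rho(f^1)\cdots\hat\partial\rho(f^n))$. The elements of $Z^n_\lambda(\mathcal C)$ are exactly the characters of $n$-dimensional cycles over $\mathcal C$. **Periodicity operator** $S:Z^r_\lambda(\mathcal C)\to Z^{r+2}_\lambda(\mathcal C)$. Let $\Omega\mathbb C$ be the DG algebra with basis $e(de)^n,(de)^n$ in degree $n\ge0$, relations $e^2=e$, $de=(de)e+e(de)$, and $d(e(de)^n)=(de)^{n+1}$, $d((de)^n)=0$; let $T'$ be the $2$-dimensional closed graded trace with $T'(e(de)^2)=1$, $T'((de)^2)=0$ (this represents the cyclic $2$-cocycle $\psi_0$ on $\mathbb C$ with $\psi_0(1,1,1)=1$). If $\phi\in Z^r_\lambda(\mathcal C)$ is the character of $(\mathcal S,\hat\partial,\hat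 T,\rho)$, then $S(\phi)=\phi\#\psi_0$ is $$S(\phi)(f^0\otimes\cdots\otimes f^{r+2})=(\hat T\#T')\big((\rho(f^0)\otimes e)\,D(\rho(f^1)\otimes e)\cdots D(\rho(f^{r+2})\otimes e)\big),$$ computed in the graded tensor product $\mathcal S\otimes\Omega\mathbb C$ with $(a\otimes a')(c\otimes c')=(-1)^{|a'||c|}ac\otimes a'c'$, $D(a\otimes a')=\hat\partial a\otimes a'+(-1)^{|a|}a\otimes da'$, and $\hat T\#T'$ equal to $\hat T\otimes T'$ on the component of bidegree $(r,2)$ and zero on other bidegrees. This is independent of the chosen cycle and descends to $H^r_\lambda(\mathcal C)\to H^{r+2}_\lambda(\mathcal C)$. *)

theory Defs
  imports "HOL-Analysis.Analysis" "HOL-Library.Function_Algebras" "HOL-Library.Z2"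
begin

section \<open>Complex vector spaces and Hilbert spaces\<close>

class complex_vector = ab_group_add +
  fixes scaleC :: "complex \<Rightarrow> 'a \<Rightarrow> 'a"  (infixr "*\<^sub>C" 75)
  assumes scaleC_add_right: "a *\<^sub>C (x + y) = a *\<^sub>C x + a *\<^sub>C y"
    and scaleC_add_left: "(a + b) *\<^sub>C x = a *\<^sub>C x + b *\<^sub>C x"
    and scaleC_scaleC: "a *\<^sub>C b *\<^sub>C x = (a * b) *\<^sub>C x"
    and scaleC_one: "1 *\<^sub>C x = x"

interpretation cvs: vector_space "scaleC :: complex \<Rightarrow> 'a \<Rightarrow> 'a::complex_vector"
  by unfold_locales (simp_all add: scaleC_add_right scaleC_add_left scaleC_scaleC scaleC_one)

class complex_hilbert_space = complex_vector + banach +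
  fixes cinner :: "'a \<Rightarrow> 'a \<Rightarrow> complex"
  assumes scaleR_scaleC: "scaleR r x = complex_of_real r *\<^sub>C x"
    and cinner_commute: "cinner x y = cnj (cinner y x)"
    and cinner_add_right: "cinner x (y + z) = cinner x y + cinner x z"
    and cinner_scaleC_right: "cinner x (a *\<^sub>C y) = a * cinner x y"
    and norm_eq_sqrt_cinner: "norm x = sqrt (Re (cinner x x))"

instantiation complex :: complex_hilbert_space
begin
definition scaleC_complex :: "complex \<Rightarrow> complex \<Rightarrow> complex"
  where "scaleC_complex a x = a * x"
definition cinner_complex :: "complex \<Rightarrow> complex \<Rightarrow> complex"
  where "cinner_complex x y = cnj x * y"
instance
  by standard
    (simp_all add: scaleC_complex_def cinner_complex_def algebra_simps scaleR_conv_of_real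
      cmod_def power2_eq_square)
end

instantiation "fun" :: (type, complex_vector) complex_vector
begin
definition scaleC_fun :: "complex \<Rightarrow> ('a \<Rightarrow> 'b) \<Rightarrow> 'a \<Rightarrow> 'b"
  where "scaleC_fun a f = (\<lambda>x. a *\<^sub>C f x)"
instance
  by standard
    (simp_all add: scaleC_fun_def fun_eq_iff scaleC_add_right scaleC_add_left scaleC_scaleC
      scaleC_one)
end

definition clinear_on ::
    "'a::complex_vector set \<Rightarrow> 'b::complex_vector set \<Rightarrow> ('a \<Rightarrow> 'b) \<Rightarrow> bool"
  where "clinear_on U V T \<longleftrightarrow>
    (\<forall>x\<in>U. T x \<in> V) \<and>
    (\<forall>x\<in>U. \<forall>y\<in>U. T (x + y) = T x + T y) \<and>
    (\<forall>a. \<forall>x\<in>U. T (a *\<^sub>C x) = a *\<^sub>C T x)"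

definition bounded_clinear_on ::
    "'h::complex_hilbert_space set \<Rightarrow> 'k::complex_hilbert_space set \<Rightarrow> ('h \<Rightarrow> 'k) \<Rightarrow> bool"
  where "bounded_clinear_on U V T \<longleftrightarrow>
    clinear_on U V T \<and> (\<exists>K. \<forall>x\<in>U. norm (T x) \<le> K * norm x)"

definition orthonormal_on :: "'i set \<Rightarrow> ('i \<Rightarrow> 'h::complex_hilbert_space) \<Rightarrow> bool"
  where "orthonormal_on I e \<longleftrightarrow> (\<forall>i\<in>I. \<forall>j\<in>I. cinner (e i) (e j) = (if i = j then 1 else 0))"

text \<open>The Schatten class of exponent \<open>q\<close> consists of the bounded operators with a singular
  value decomposition \<open>T = (\<Sum>n\<in>I. s n *\<^sub>C \<langle>e n, _\<rangle> *\<^sub>C f n)\<close> whose singular values \<open>s n\<close>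
  are \<open>q\<close>-summable.\<close>

definition schatten ::
    "real \<Rightarrow> 'h::complex_hilbert_space set \<Rightarrow> 'k::complex_hilbert_space set \<Rightarrow> ('h \<Rightarrow> 'k) \<Rightarrow> bool"
  where "schatten q U V T \<longleftrightarrow>
    bounded_clinear_on U V T \<and>
    (\<exists>(I::nat set) s e f.
        (\<forall>n\<in>I. 0 < s n \<and> e n \<in> U \<and> f n \<in> V) \<and>
        orthonormal_on I e \<and> orthonormal_on I f \<and>
        (\<lambda>n. s n powr q) summable_on I \<and>
        (\<forall>x\<in>U. ((\<lambda>n. (complex_of_real (s n) * cinner (e n) x) *\<^sub>C f n) has_sum T x) I))"

definition is_orthonormal_basis :: "'h::complex_hilbert_space set \<Rightarrow> 'h set \<Rightarrow> bool"
  where "is_orthonormal_basis U B \<longleftrightarrow>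
    B \<subseteq> U \<and> orthonormal_on B (\<lambda>e. e) \<and> U \<subseteq> closure (cvs.span B)"

text \<open>On trace class operators the value does not depend on the basis.\<close>

definition op_trace :: "'h::complex_hilbert_space set \<Rightarrow> ('h \<Rightarrow> 'h) \<Rightarrow> complex"
  where "op_trace U A =
    (let B = (SOME B. is_orthonormal_basis U B) in \<Sum>\<^sub>\<infinity>e\<in>B. cinner e (A e))"


section \<open>Linear categories\<close>

text \<open>The morphism spaces are subspaces of one complex vector space. This is no restriction, as
  any family of vector spaces embeds in its direct sum; since different morphism spaces may
  overlap, every operation on morphisms also takes the objects as arguments.
  In \<open>Comp C X Y Z g f\<close> the morphisms are \<open>f\<close> from \<open>X\<close> to \<open>Y\<close> and
  \<open>g\<close> from \<open>Y\<close> to \<open>Z\<close>.\<close>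

record ('o, 'm) lin_cat =
  Obj :: "'o set"
  Hom :: "'o \<Rightarrow> 'o \<Rightarrow> 'm set"
  Comp :: "'o \<Rightarrow> 'o \<Rightarrow> 'o \<Rightarrow> 'm \<Rightarrow> 'm \<Rightarrow> 'm"
  Ident :: "'o \<Rightarrow> 'm"

locale linear_category =
  fixes C :: "('o, 'm::complex_vector) lin_cat"
  assumes Hom_subspace: "\<lbrakk>X \<in> Obj C; Y \<in> Obj C\<rbrakk> \<Longrightarrow> cvs.subspace (Hom C X Y)"
    and Comp_linear_left: "\<lbrakk>X \<in> Obj C; Y \<in> Obj C; Z \<in> Obj C; f \<in> Hom C X Y\<rbrakk>
      \<Longrightarrow> clinear_on (Hom C Y Z) (Hom C X Z) (\<lambda>g. Comp C X Y Z g f)"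
    and Comp_linear_right: "\<lbrakk>X \<in> Obj C; Y \<in> Obj C; Z \<in> Obj C; g \<in> Hom C Y Z\<rbrakk>
      \<Longrightarrow> clinear_on (Hom C X Y) (Hom C X Z) (\<lambda>f. Comp C X Y Z g f)"
    and Comp_assoc: "\<lbrakk>W \<in> Obj C; X \<in> Obj C; Y \<in> Obj C; Z \<in> Obj C;
        f \<in> Hom C W X; g \<in> Hom C X Y; h \<in> Hom C Y Z\<rbrakk>
      \<Longrightarrow> Comp C W Y Z h (Comp C W X Y g f) = Comp C W X Z (Comp C X Y Z h g) f"
    and Ident_in_Hom: "X \<in> Obj C \<Longrightarrow> Ident C X \<in> Hom C X X"
    and Ident_left: "\<lbrakk>X \<in> Obj C; Y \<in> Obj C; f \<in> Hom C X Y\<rbrakk> \<Longrightarrow> Comp C X Y Y (Ident C Y) f = f"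
    and Ident_right: "\<lbrakk>X \<in> Obj C; Y \<in> Obj C; f \<in> Hom C X Y\<rbrakk> \<Longrightarrow> Comp C X X Y f (Ident C X) = f"


section \<open>Cyclic cohomology\<close>

text \<open>A generator \<open>f_0 \<otimes> ... \<otimes> f_n\<close> of \<open>CN_n\<close>, with \<open>f_i\<close> a morphism from
  \<open>X_{i+1}\<close> to \<open>X_i\<close> and \<open>X_{n+1} = X_0\<close>, is the list of the pairs
  \<open>(X_i, f_i)\<close>; the indices in \<open>ob\<close> and \<open>mor\<close> are read cyclically. An element of
  the linear dual of \<open>CN_n\<close> is a multilinear function of such lists, set to 0 elsewhere.\<close>

type_synonym ('o, 'm) cochain = "('o \<times> 'm) list \<Rightarrow> complex"

definition ob :: "('o \<times> 'm) list \<Rightarrow> nat \<Rightarrow> 'o"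
  where "ob c i = fst (c ! (i mod length c))"

definition mor :: "('o \<times> 'm) list \<Rightarrow> nat \<Rightarrow> 'm"
  where "mor c i = snd (c ! (i mod length c))"

definition chain :: "('o, 'm) lin_cat \<Rightarrow> nat \<Rightarrow> ('o \<times> 'm) list \<Rightarrow> bool"
  where "chain C n c \<longleftrightarrow> length c = Suc n \<and>
    (\<forall>i\<le>n. ob c i \<in> Obj C \<and> mor c i \<in> Hom C (ob c (Suc i)) (ob c i))"

definition CN :: "('o, 'm::complex_vector) lin_cat \<Rightarrow> nat \<Rightarrow> ('o, 'm) cochain set"
  where "CN C n = {\<phi>.
    (\<forall>c. \<not> chain C n c \<longrightarrow> \<phi> c = 0) \<and>
    (\<forall>c i g a. chain C n c \<and> i \<le> n \<and> g \<in> Hom C (ob c (Suc i)) (ob c i) \<longrightarrow>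
       \<phi> (c[i := (ob c i, a *\<^sub>C mor c i + g)]) = a * \<phi> c + \<phi> (c[i := (ob c i, g)]))}"

text \<open>\<open>face C i c\<close> composes the morphisms \<open>i\<close> and \<open>i + 1\<close> of a chain with
  \<open>n + 2\<close> morphisms, for \<open>i \<le> n\<close>.\<close>

definition face :: "('o, 'm) lin_cat \<Rightarrow> nat \<Rightarrow> ('o \<times> 'm) list \<Rightarrow> ('o \<times> 'm) list"
  where "face C i c =
    take i c @
    (ob c i, Comp C (ob c (i + 2)) (ob c (i + 1)) (ob c i) (mor c i) (mor c (i + 1))) #
    drop (i + 2) c"

definition last_face :: "('o, 'm) lin_cat \<Rightarrow> nat \<Rightarrow> ('o \<times> 'm) list \<Rightarrow> ('o \<times> 'm) list"
  where "last_face C n c =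
    (ob c (n + 1), Comp C (ob c 1) (ob c 0) (ob c (n + 1)) (mor c (n + 1)) (mor c 0)) #
    butlast (tl c)"

definition hochschild_b ::
    "('o, 'm) lin_cat \<Rightarrow> nat \<Rightarrow> ('o, 'm) cochain \<Rightarrow> ('o, 'm) cochain"
  where "hochschild_b C n \<phi> = (\<lambda>c.
    if chain C (Suc n) c
    then (\<Sum>i\<le>n. (-1) ^ i * \<phi> (face C i c)) + (-1) ^ (n + 1) * \<phi> (last_face C n c)
    else 0)"

definition cyclic_op :: "nat \<Rightarrow> ('o, 'm) cochain \<Rightarrow> ('o, 'm) cochain"
  where "cyclic_op n \<phi> = (\<lambda>c. (-1) ^ n * \<phi> (last c # butlast c))"

definition C_lambda :: "('o, 'm::complex_vector) lin_cat \<Rightarrow> nat \<Rightarrow> ('o, 'm) cochain set"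
  where "C_lambda C n = {\<phi> \<in> CN C n. \<forall>c. chain C n c \<longrightarrow> cyclic_op n \<phi> c = \<phi> c}"

definition Z_lambda :: "('o, 'm::complex_vector) lin_cat \<Rightarrow> nat \<Rightarrow> ('o, 'm) cochain set"
  where "Z_lambda C n = {\<phi> \<in> C_lambda C n. hochschild_b C n \<phi> = 0}"

definition B_lambda :: "('o, 'm::complex_vector) lin_cat \<Rightarrow> nat \<Rightarrow> ('o, 'm) cochain set"
  where "B_lambda C n =
    (case n of 0 \<Rightarrow> {0} | Suc k \<Rightarrow> hochschild_b C k ` C_lambda C k)"

definition cohomologous ::
    "('o, 'm::complex_vector) lin_cat \<Rightarrow> nat \<Rightarrow> (('o, 'm) cochain \<times> ('o, 'm) cochain) set"
  where "cohomologous C n =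
    {(\<phi>, \<psi>). \<phi> \<in> Z_lambda C n \<and> \<psi> \<in> Z_lambda C n \<and> \<phi> - \<psi> \<in> B_lambda C n}"

definition H_lambda ::
    "('o, 'm::complex_vector) lin_cat \<Rightarrow> nat \<Rightarrow> ('o, 'm) cochain set set"
  where "H_lambda C n = Z_lambda C n // cohomologous C n"

text \<open>This is empty, hence not in \<open>H_lambda\<close>, unless \<open>\<phi>\<close> is a cyclic cocycle.\<close>

definition cohomology_class ::
    "('o, 'm::complex_vector) lin_cat \<Rightarrow> nat \<Rightarrow> ('o, 'm) cochain \<Rightarrow> ('o, 'm) cochain set"
  where "cohomology_class C n \<phi> = cohomologous C n `` {\<phi>}"


section \<open>Cycles\<close>

text \<open>\<open>DHom S n X Y\<close> is the space of morphisms of degree \<open>n\<close>; as for linear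
  categories, all these spaces lie in one complex vector space.\<close>

record ('d, 's) dg_semicat =
  DObj :: "'d set"
  DHom :: "nat \<Rightarrow> 'd \<Rightarrow> 'd \<Rightarrow> 's set"
  DComp :: "'d \<Rightarrow> 'd \<Rightarrow> 'd \<Rightarrow> 's \<Rightarrow> 's \<Rightarrow> 's"
  DDiff :: "'d \<Rightarrow> 'd \<Rightarrow> 's \<Rightarrow> 's"

locale dg_semicategory =
  fixes S :: "('d, 's::complex_vector) dg_semicat"
  assumes DHom_subspace: "\<lbrakk>X \<in> DObj S; Y \<in> DObj S\<rbrakk> \<Longrightarrow> cvs.subspace (DHom S n X Y)"
    and DComp_linear_left: "\<lbrakk>X \<in> DObj S; Y \<in> DObj S; Z \<in> DObj S; f \<in> DHom S i X Y\<rbrakk>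
      \<Longrightarrow> clinear_on (DHom S j Y Z) (DHom S (j + i) X Z) (\<lambda>g. DComp S X Y Z g f)"
    and DComp_linear_right: "\<lbrakk>X \<in> DObj S; Y \<in> DObj S; Z \<in> DObj S; g \<in> DHom S j Y Z\<rbrakk>
      \<Longrightarrow> clinear_on (DHom S i X Y) (DHom S (j + i) X Z) (\<lambda>f. DComp S X Y Z g f)"
    and DComp_assoc: "\<lbrakk>W \<in> DObj S; X \<in> DObj S; Y \<in> DObj S; Z \<in> DObj S;
        f \<in> DHom S i W X; g \<in> DHom S j X Y; h \<in> DHom S k Y Z\<rbrakk>
      \<Longrightarrow> DComp S W Y Z h (DComp S W X Y g f) = DComp S W X Z (DComp S X Y Z h g) f"
    and DDiff_linear: "\<lbrakk>X \<in> DObj S; Y \<in> DObj S\<rbrakk>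
      \<Longrightarrow> clinear_on (DHom S n X Y) (DHom S (Suc n) X Y) (DDiff S X Y)"
    and DDiff_DDiff: "\<lbrakk>X \<in> DObj S; Y \<in> DObj S; f \<in> DHom S n X Y\<rbrakk>
      \<Longrightarrow> DDiff S X Y (DDiff S X Y f) = 0"
    and DDiff_Leibniz: "\<lbrakk>X \<in> DObj S; Y \<in> DObj S; Z \<in> DObj S;
        f \<in> DHom S i X Y; g \<in> DHom S j Y Z\<rbrakk>
      \<Longrightarrow> DDiff S X Z (DComp S X Y Z g f) =
           DComp S X Y Z (DDiff S Y Z g) f + (-1) ^ j *\<^sub>C DComp S X Y Z g (DDiff S X Y f)"

definition closed_graded_trace ::
    "('d, 's::complex_vector) dg_semicat \<Rightarrow> nat \<Rightarrow> ('d \<Rightarrow> 's \<Rightarrow> complex) \<Rightarrow> bool"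
  where "closed_graded_trace S n T \<longleftrightarrow>
    (\<forall>X\<in>DObj S. clinear_on (DHom S n X X) UNIV (T X)) \<and>
    (\<forall>X\<in>DObj S. \<forall>k. Suc k = n \<longrightarrow> (\<forall>g\<in>DHom S k X X. T X (DDiff S X X g) = 0)) \<and>
    (\<forall>X\<in>DObj S. \<forall>Y\<in>DObj S. \<forall>i j. i + j = n \<longrightarrow>
       (\<forall>g\<in>DHom S i Y X. \<forall>g'\<in>DHom S j X Y.
          T X (DComp S X Y X g g') = (-1) ^ (i * j) * T Y (DComp S Y X Y g' g)))"

locale cycle_over = linear_category C + dg_semicategory S
  for C :: "('o, 'm::complex_vector) lin_cat"
    and n :: nat
    and S :: "('d, 's::complex_vector) dg_semicat"
    and T :: "'d \<Rightarrow> 's \<Rightarrow> complex"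
    and rho_ob :: "'o \<Rightarrow> 'd"
    and rho :: "'o \<Rightarrow> 'o \<Rightarrow> 'm \<Rightarrow> 's" +
  assumes degree_0_category: "U \<in> DObj S \<Longrightarrow> \<exists>e\<in>DHom S 0 U U. \<forall>V\<in>DObj S.
        (\<forall>h\<in>DHom S 0 V U. DComp S V U U e h = h) \<and> (\<forall>h\<in>DHom S 0 U V. DComp S U U V h e = h)"
    and closed_graded_trace: "closed_graded_trace S n T"
    and rho_ob_Obj: "X \<in> Obj C \<Longrightarrow> rho_ob X \<in> DObj S"
    and rho_linear: "\<lbrakk>X \<in> Obj C; Y \<in> Obj C\<rbrakk>
      \<Longrightarrow> clinear_on (Hom C X Y) (DHom S 0 (rho_ob X) (rho_ob Y)) (rho X Y)"
    and rho_Comp: "\<lbrakk>X \<in> Obj C; Y \<in> Obj C; Z \<in> Obj C; f \<in> Hom C X Y; g \<in> Hom C Y Z\<rbrakk>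
      \<Longrightarrow> rho X Z (Comp C X Y Z g f) =
           DComp S (rho_ob X) (rho_ob Y) (rho_ob Z) (rho Y Z g) (rho X Y f)"

text \<open>\<open>path_comp cmp X [(X_0, a_0), ..., (X_n, a_n)]\<close> is the composite \<open>a_0 ... a_n\<close>, where
  \<open>a_i\<close> goes from \<open>X_{i+1}\<close> to \<open>X_i\<close> and \<open>X_{n+1} = X\<close>.\<close>

fun path_comp :: "('d \<Rightarrow> 'd \<Rightarrow> 'd \<Rightarrow> 'a \<Rightarrow> 'a \<Rightarrow> 'a) \<Rightarrow> 'd \<Rightarrow> ('d \<times> 'a) list \<Rightarrow> 'a"
  where
    "path_comp cmp X [] = undefined"
  | "path_comp cmp X [(Y, a)] = a"
  | "path_comp cmp X ((Z, a) # (Y, b) # r) = cmp X Y Z a (path_comp cmp X ((Y, b) # r))"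

definition cycle_character ::
    "('o, 'm::complex_vector) lin_cat \<Rightarrow> nat \<Rightarrow> ('d, 's::complex_vector) dg_semicat \<Rightarrow>
     ('d \<Rightarrow> 's \<Rightarrow> complex) \<Rightarrow> ('o \<Rightarrow> 'd) \<Rightarrow> ('o \<Rightarrow> 'o \<Rightarrow> 'm \<Rightarrow> 's) \<Rightarrow> ('o, 'm) cochain"
  where "cycle_character C n S T rho_ob rho = (\<lambda>c.
    if chain C n c then
      let R = (\<lambda>i. rho (ob c (Suc i)) (ob c i) (mor c i)); Y = (\<lambda>i. rho_ob (ob c i)) in
      T (Y 0) (path_comp (DComp S) (Y 0)
        ((Y 0, R 0) # map (\<lambda>i. (Y i, DDiff S (Y (Suc i)) (Y i) (R i))) [1..<Suc n]))
    else 0)"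


section \<open>The periodicity operator\<close>

text \<open>Basis of the universal differential graded algebra of the complex numbers:
  \<open>EDe n\<close> is \<open>e (de)^n\<close> and \<open>De n\<close> is \<open>(de)^n\<close>. The third argument
  of \<open>omega_mult\<close> (the second of \<open>omega_diff\<close>) is the basis element whose coefficient
  in the product (the differential) is taken. The relations \<open>e^2 = e\<close> and
  \<open>(de) e = (1 - e) de\<close> give \<open>(de)^a e = e (de)^a\<close> for even \<open>a\<close> and
  \<open>(de)^a e = (1 - e) (de)^a\<close> for odd \<open>a\<close>.\<close>

datatype omega = EDe nat | De nat

primrec omega_degree :: "omega \<Rightarrow> nat"
  where
    "omega_degree (EDe n) = n"
  | "omega_degree (De n) = n"

fun omega_mult :: "omega \<Rightarrow> omega \<Rightarrow> omega \<Rightarrow> complex"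
  where
    "omega_mult (De a) (De b) x = of_bool (x = De (a + b))"
  | "omega_mult (EDe a) (De b) x = of_bool (x = EDe (a + b))"
  | "omega_mult (De a) (EDe b) x =
       (if even a then of_bool (x = EDe (a + b))
        else of_bool (x = De (a + b)) - of_bool (x = EDe (a + b)))"
  | "omega_mult (EDe a) (EDe b) x = (if even a then of_bool (x = EDe (a + b)) else 0)"

fun omega_diff :: "omega \<Rightarrow> omega \<Rightarrow> complex"
  where
    "omega_diff (EDe n) x = of_bool (x = De (n + 1))"
  | "omega_diff (De n) x = 0"

primrec omega_trace :: "omega \<Rightarrow> complex"
  where
    "omega_trace (EDe n) = of_bool (n = 2)"
  | "omega_trace (De n) = 0"

definition omega_upto :: "nat \<Rightarrow> omega set"
  where "omega_upto k = EDe ` {..k} \<union> De ` {..k}"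

text \<open>A morphism of the graded tensor product of \<open>S\<close> with this algebra is written uniquely
  as a finite sum of terms \<open>u i b \<otimes> b\<close> with \<open>b\<close> in the basis and \<open>u i b\<close>
  of degree \<open>i\<close>; it is represented by the function \<open>u\<close>.\<close>

type_synonym 's omega_tensor = "nat \<Rightarrow> omega \<Rightarrow> 's"

definition pure_tensor :: "nat \<Rightarrow> 's::complex_vector \<Rightarrow> omega \<Rightarrow> 's omega_tensor"
  where "pure_tensor i a b = (\<lambda>k x. if k = i \<and> x = b then a else 0)"

definition tensor_comp ::
    "('d, 's::complex_vector) dg_semicat \<Rightarrow> 'd \<Rightarrow> 'd \<Rightarrow> 'd \<Rightarrow>
     's omega_tensor \<Rightarrow> 's omega_tensor \<Rightarrow> 's omega_tensor"
  where "tensor_comp S X Y Z u v = (\<lambda>k x.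
    \<Sum>i\<le>k. \<Sum>b\<in>omega_upto (omega_degree x). \<Sum>b'\<in>omega_upto (omega_degree x).
      ((-1) ^ (omega_degree b * (k - i)) * omega_mult b b' x) *\<^sub>C
        DComp S X Y Z (u i b) (v (k - i) b'))"

definition tensor_diff ::
    "('d, 's::complex_vector) dg_semicat \<Rightarrow> 'd \<Rightarrow> 'd \<Rightarrow> 's omega_tensor \<Rightarrow> 's omega_tensor"
  where "tensor_diff S X Y u = (\<lambda>k x.
    (case k of 0 \<Rightarrow> 0 | Suc i \<Rightarrow> DDiff S X Y (u i x)) +
    (-1) ^ k *\<^sub>C (\<Sum>b\<in>omega_upto (omega_degree x). omega_diff b x *\<^sub>C u k b))"

definition tensor_trace ::
    "nat \<Rightarrow> ('d \<Rightarrow> 's \<Rightarrow> complex) \<Rightarrow> 'd \<Rightarrow> 's::complex_vector omega_tensor \<Rightarrow> complex"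
  where "tensor_trace r T X u = (\<Sum>b | omega_degree b = 2. T X (u r b) * omega_trace b)"

definition cup_psi0 ::
    "('o, 'm::complex_vector) lin_cat \<Rightarrow> nat \<Rightarrow> ('d, 's::complex_vector) dg_semicat \<Rightarrow>
     ('d \<Rightarrow> 's \<Rightarrow> complex) \<Rightarrow> ('o \<Rightarrow> 'd) \<Rightarrow> ('o \<Rightarrow> 'o \<Rightarrow> 'm \<Rightarrow> 's) \<Rightarrow> ('o, 'm) cochain"
  where "cup_psi0 C r S T rho_ob rho = (\<lambda>c.
    if chain C (r + 2) c then
      let R = (\<lambda>i. pure_tensor 0 (rho (ob c (Suc i)) (ob c i) (mor c i)) (EDe 0));
          Y = (\<lambda>i. rho_ob (ob c i)) in
      tensor_trace r T (Y 0) (path_comp (tensor_comp S) (Y 0)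
        ((Y 0, R 0) # map (\<lambda>i. (Y i, tensor_diff S (Y (Suc i)) (Y i) (R i))) [1..<r + 3]))
    else 0)"

text \<open>The class of \<open>cup_psi0 C r S T rho_ob rho\<close> depends only on the character of the cycle,
  so any cycle with character \<open>\<phi>\<close> may be chosen. A definition cannot quantify over types, so
  the types of objects and of morphisms of the cycle are fixed. They are large enough for the
  universal cycle: there an element of \<open>DHom S n X Y\<close> is a combination of terms
  \<open>f_0 df_1 ... df_n\<close>, with \<open>f_0\<close> a morphism or a formal unit (\<open>None\<close>), hence
  defines a functional on functions of such lists.\<close>

type_synonym ('o, 'm) universal = "(('o \<times> 'm option) list \<Rightarrow> complex) \<Rightarrow> complex"

definition periodicity_op ::
    "('o, 'm::complex_vector) lin_cat \<Rightarrow> nat \<Rightarrow> ('o, 'm) cochain \<Rightarrow> ('o, 'm) cochain"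
  where "periodicity_op C r \<phi> =
    (SOME \<psi>. \<exists>(S :: ('o, ('o, 'm) universal) dg_semicat) T rho_ob rho.
       cycle_over C r S T rho_ob rho \<and>
       cycle_character C r S T rho_ob rho = \<phi> \<and>
       \<psi> = cup_psi0 C r S T rho_ob rho)"


section \<open>Even Fredholm modules\<close>

text \<open>The Hilbert spaces are closed subspaces of one Hilbert space, which is no restriction, as any
  family of Hilbert spaces embeds isometrically in its Hilbert sum. \<open>Hgr M X i\<close> is the part
  of degree \<open>i\<close> of the space attached to \<open>X\<close>. Operators matter only on these
  subspaces.\<close>

record ('o, 'm, 'h) fredholm_module =
  Hgr :: "'o \<Rightarrow> bit \<Rightarrow> 'h set"
  Hmap :: "'o \<Rightarrow> 'o \<Rightarrow> 'm \<Rightarrow> 'h \<Rightarrow> 'h"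
  Fop :: "'o \<Rightarrow> 'h \<Rightarrow> 'h"

definition Hsp :: "('o, 'm, 'h::complex_hilbert_space) fredholm_module \<Rightarrow> 'o \<Rightarrow> 'h set"
  where "Hsp M X = {u + v | u v. u \<in> Hgr M X 0 \<and> v \<in> Hgr M X 1}"

definition grading_op :: "('o, 'm, 'h::complex_hilbert_space) fredholm_module \<Rightarrow> 'o \<Rightarrow> 'h \<Rightarrow> 'h"
  where "grading_op M X x =
    (THE y. \<exists>u\<in>Hgr M X 0. \<exists>v\<in>Hgr M X 1. x = u + v \<and> y = u - v)"

definition has_degree ::
    "('o, 'm, 'h) fredholm_module \<Rightarrow> 'o \<Rightarrow> 'o \<Rightarrow> bit \<Rightarrow> ('h \<Rightarrow> 'h) \<Rightarrow> bool"
  where "has_degree M X Y d T \<longleftrightarrow> (\<forall>i. \<forall>x\<in>Hgr M X i. T x \<in> Hgr M Y (i + d))"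

definition F_comm ::
    "('o, 'm, 'h::complex_hilbert_space) fredholm_module \<Rightarrow> 'o \<Rightarrow> 'o \<Rightarrow> 'm \<Rightarrow> 'h \<Rightarrow> 'h"
  where "F_comm M X Y f = (\<lambda>x. Fop M Y (Hmap M X Y f x) - Hmap M X Y f (Fop M X x))"

locale even_fredholm_module = linear_category C
  for C :: "('o, 'm::complex_vector) lin_cat"
    and p :: real
    and M :: "('o, 'm, 'h::complex_hilbert_space) fredholm_module" +
  assumes Hgr_subspace: "X \<in> Obj C \<Longrightarrow> cvs.subspace (Hgr M X i)"
    and Hgr_closed: "X \<in> Obj C \<Longrightarrow> closed (Hgr M X i)"
    and Hgr_orthogonal: "\<lbrakk>X \<in> Obj C; u \<in> Hgr M X 0; v \<in> Hgr M X 1\<rbrakk> \<Longrightarrow> cinner u v = 0"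
    and Hsp_separable: "X \<in> Obj C \<Longrightarrow> separable_space (top_of_set (Hsp M X))"
    and Hmap_bounded: "\<lbrakk>X \<in> Obj C; Y \<in> Obj C; f \<in> Hom C X Y\<rbrakk>
      \<Longrightarrow> bounded_clinear_on (Hsp M X) (Hsp M Y) (Hmap M X Y f)"
    and Hmap_degree: "\<lbrakk>X \<in> Obj C; Y \<in> Obj C; f \<in> Hom C X Y\<rbrakk>
      \<Longrightarrow> has_degree M X Y 0 (Hmap M X Y f)"
    and Hmap_linear: "\<lbrakk>X \<in> Obj C; Y \<in> Obj C; x \<in> Hsp M X\<rbrakk>
      \<Longrightarrow> clinear_on (Hom C X Y) (Hsp M Y) (\<lambda>f. Hmap M X Y f x)"
    and Hmap_Ident: "\<lbrakk>X \<in> Obj C; x \<in> Hsp M X\<rbrakk> \<Longrightarrow> Hmap M X X (Ident C X) x = x"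
    and Hmap_Comp: "\<lbrakk>X \<in> Obj C; Y \<in> Obj C; Z \<in> Obj C; f \<in> Hom C X Y; g \<in> Hom C Y Z;
        x \<in> Hsp M X\<rbrakk>
      \<Longrightarrow> Hmap M X Z (Comp C X Y Z g f) x = Hmap M Y Z g (Hmap M X Y f x)"
    and Fop_bounded: "X \<in> Obj C \<Longrightarrow> bounded_clinear_on (Hsp M X) (Hsp M X) (Fop M X)"
    and Fop_degree: "X \<in> Obj C \<Longrightarrow> has_degree M X X 1 (Fop M X)"
    and Fop_Fop: "\<lbrakk>X \<in> Obj C; x \<in> Hsp M X\<rbrakk> \<Longrightarrow> Fop M X (Fop M X x) = x"
    and F_comm_schatten: "\<lbrakk>X \<in> Obj C; Y \<in> Obj C; f \<in> Hom C X Y\<rbrakk>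
      \<Longrightarrow> schatten p (Hsp M X) (Hsp M Y) (F_comm M X Y f)"

text \<open>The graded commutator of a homogeneous endomorphism with \<open>F\<close>. An operator that is
  homogeneous of both degrees vanishes, so the sign is unambiguous.\<close>

definition F_graded_comm ::
    "('o, 'm, 'h::complex_hilbert_space) fredholm_module \<Rightarrow> 'o \<Rightarrow> ('h \<Rightarrow> 'h) \<Rightarrow> 'h \<Rightarrow> 'h"
  where "F_graded_comm M X A = (\<lambda>x.
    Fop M X (A x) - (if has_degree M X X 0 A then 1 else -1) *\<^sub>C A (Fop M X x))"

definition supertrace ::
    "('o, 'm, 'h::complex_hilbert_space) fredholm_module \<Rightarrow> 'o \<Rightarrow> ('h \<Rightarrow> 'h) \<Rightarrow> complex"
  where "supertrace M X A =
    1/2 * op_trace (Hsp M X) (grading_op M X \<circ> Fop M X \<circ> F_graded_comm M X A)"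

text \<open>Only even \<open>n\<close> are used.\<close>

definition fredholm_character ::
    "('o, 'm) lin_cat \<Rightarrow> ('o, 'm, 'h::complex_hilbert_space) fredholm_module \<Rightarrow> nat \<Rightarrow>
     ('o, 'm) cochain"
  where "fredholm_character C M n = (\<lambda>c.
    if chain C n c then
      supertrace M (ob c 0)
        (Hmap M (ob c 1) (ob c 0) (mor c 0) \<circ>
          foldr (\<circ>) (map (\<lambda>i. F_comm M (ob c (Suc i)) (ob c i) (mor c i)) [1..<Suc n]) id)
    else 0)"

end

(*
  Write d = [F, _] and, for an odd number of differentials, let
  theta0(f_0, ..., f_{2m+1}) = Tr (eps F f_0 df_1 ... df_{2m+1}).  Since eps F commutes with the df_i,
  every face satisfies phi^{2m}(face) = 1/2 (theta0 + a rotation of theta0); this gives both the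
  cocycle property of the characters and, after summing over the faces with suitable weights, a
  cochain eta with S phi^{2m} = b eta.  Here S phi is an explicit alternating sum of phi over double
  faces, whatever the cycle with character phi.  Up to the multiple (m + 1) theta0, eta is the cyclic
  antisymmetrization of theta0, and b theta0 = - phi^{2m+2}; hence S phi^{2m} + (m + 1) phi^{2m+2} is
  the coboundary of a cyclic cochain.  The traces exist and are cyclic because the products involved
  are approximated by operators of finite rank, uniformly with a summable rank-weighted error.
*)

theory Submission
  imports Defs
begin

section \<open>Faces and rotations of chains\<close>

text \<open>The operator \<open>periodicity_op\<close> chooses among cycles whose morphisms lie in
  the type \<open>universal\<close>. The natural cycle, made of operators on the Hilbert spaces,
  lies in another type; without an admissible cycle of the right character the choice would be
  arbitrary. The operator cycle is therefore cut down to the span of its words and embedded into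
  that type by coordinates. The integer N = 2m + 1 governs the analysis. It is at least p, and it is
  the number of commutators in \<open>\<theta>\<^sub>0\<close> and in Tr(eps F df_0 ... df_{2m}), to
  which the supertrace of f_0 df_1 ... df_{2m} reduces; the latter operator need not itself be trace
  class. The constant m + 1 is half of r + 2 for r = 2m. With weights r + 1 - j on the faces, the
  coefficients of the rotations of \<open>\<theta>\<^sub>0\<close> become -1/2 times alternating
  signs, except that the unrotated term has an excess of (r + 2)/2. Since
  \<open>\<theta>\<^sub>0\<close> need not be cyclic, this excess cannot be discarded in cyclic
  cohomology, and its coboundary produces the class of \<phi>^{2m+2}.\<close>

lemma ob_rotate: "c \<noteq> [] \<Longrightarrow> ob (rotate k c) i = ob c (i + k)"
  by (simp add: ob_def nth_rotate mod_add_left_eq mod_add_right_eq add.commute)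

lemma mor_rotate: "c \<noteq> [] \<Longrightarrow> mor (rotate k c) i = mor c (i + k)"
  by (simp add: mor_def nth_rotate mod_add_left_eq mod_add_right_eq add.commute)

lemma ob_rotate1: "c \<noteq> [] \<Longrightarrow> ob (rotate1 c) i = ob c (Suc i)"
  using ob_rotate[of c 1 i] by simp

lemma mor_rotate1: "c \<noteq> [] \<Longrightarrow> mor (rotate1 c) i = mor c (Suc i)"
  using mor_rotate[of c 1 i] by simp

lemma ob_add_length: "ob c (i + length c) = ob c i" "ob c (length c + i) = ob c i"
  by (simp_all add: ob_def)

lemma mor_add_length: "mor c (i + length c) = mor c i" "mor c (length c + i) = mor c i"
  by (simp_all add: mor_def)

lemma chain_length: "chain C n c \<Longrightarrow> length c = Suc n"
  by (simp add: chain_def)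

lemma chain_nonempty: "chain C n c \<Longrightarrow> c \<noteq> []"
  by (auto simp: chain_def)

lemma chain_ob: "chain C n c \<Longrightarrow> ob c i \<in> Obj C"
proof -
  assume c: "chain C n c"
  have "ob c i = ob c (i mod Suc n)"
    using chain_length[OF c] by (simp add: ob_def)
  then show ?thesis using c by (simp add: chain_def)
qed

lemma chain_mor: "chain C n c \<Longrightarrow> mor c i \<in> Hom C (ob c (Suc i)) (ob c i)"
proof -
  assume c: "chain C n c"
  have "ob c i = ob c (i mod Suc n)" "mor c i = mor c (i mod Suc n)"
    "ob c (Suc i) = ob c (Suc (i mod Suc n))"
    using chain_length[OF c] by (simp_all add: ob_def mor_def mod_Suc_eq)
  then show ?thesis using c by (simp add: chain_def)
qed

lemma chainI:
  "\<lbrakk>length c = Suc n; \<And>i. i \<le> n \<Longrightarrow> ob c i \<in> Obj C;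
    \<And>i. i \<le> n \<Longrightarrow> mor c i \<in> Hom C (ob c (Suc i)) (ob c i)\<rbrakk> \<Longrightarrow> chain C n c"
  by (simp add: chain_def)

lemma chain_rotate: "chain C n c \<Longrightarrow> chain C n (rotate k c)"
  by (rule chainI)
    (auto simp: chain_length ob_rotate mor_rotate chain_nonempty chain_ob
      intro: chain_mor[of C n c "_ + k", simplified])

lemma chain_rotate1: "chain C n c \<Longrightarrow> chain C n (rotate1 c)"
  using chain_rotate[of C n c 1] by simp

text \<open>The operation in \<open>cyclic_op\<close> is a right shift; on n + 1 entries it equals n
  left shifts. Cyclicity can therefore be expressed with \<open>rotate\<close> throughout.\<close>

lemma last_butlast_rotate: "length c = Suc n \<Longrightarrow> last c # butlast c = rotate n c"
proof -
  assume l: "length c = Suc n"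
  then have "c \<noteq> []" by auto
  then have "rotate n c = rotate n (rotate1 (last c # butlast c))" by simp
  also have "\<dots> = rotate (Suc n) (last c # butlast c)" by (simp add: rotate1_rotate_swap)
  also have "\<dots> = last c # butlast c" using l \<open>c \<noteq> []\<close> by (intro rotate_id) simp
  finally show ?thesis by simp
qed

lemma length_face: "Suc i < length c \<Longrightarrow> length (face C i c) = length c - 1"
  by (simp add: face_def)

lemma nth_face:
  "\<lbrakk>Suc i < length c; j < length c - 1\<rbrakk> \<Longrightarrow> face C i c ! j =
    (if j < i then c ! j
     else if j = i then (ob c i, Comp C (ob c (i + 2)) (ob c (i + 1)) (ob c i) (mor c i) (mor c (i
       + 1)))
     else c ! Suc j)"
  by (auto simp: face_def nth_append nth_Cons split: nat.split) (metis Suc_diff_Suc add_Suc_right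
    add_diff_inverse_nat diff_Suc_Suc less_Suc_eq not_less_iff_gr_or_eq less_imp_le_nat add.commute
      le_add_diff_inverse)+

text \<open>The index j may be one past the last entry of the face, because the source of the last
  morphism is read there; the cyclic reading then returns to the first object.\<close>

lemma ob_face:
  assumes "Suc i < length c" "j \<le> length c - 1"
  shows "ob (face C i c) j = ob c (if j \<le> i then j else Suc j)"
proof (cases "j = length c - 1")
  case True
  have "ob (face C i c) j = fst (face C i c ! 0)"
    using True assms by (simp add: ob_def length_face)
  also have "\<dots> = ob c 0" using assms by (auto simp: nth_face ob_def)
  also have "\<dots> = ob c (Suc j)"
  proof -
    have "Suc j = length c + 0" using True assms by simp
    then show ?thesis by (simp only: ob_add_length)
  qed
  finally show ?thesis using True assms by auto
next
  case False
  then show ?thesis using assms by (auto simp: ob_def[of "face C i c"] length_face nth_face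
    ob_def[of c])
qed

lemma mor_face:
  assumes "Suc i < length c" "j < length c - 1"
  shows "mor (face C i c) j =
    (if j < i then mor c j
     else if j = i then Comp C (ob c (i + 2)) (ob c (i + 1)) (ob c i) (mor c i) (mor c (i + 1))
     else mor c (Suc j))"
  using assms by (auto simp: mor_def[of "face C i c"] length_face nth_face mor_def[of c])

lemma (in linear_category) Comp_Hom:
  "\<lbrakk>X \<in> Obj C; Y \<in> Obj C; Z \<in> Obj C; f \<in> Hom C X Y; g \<in> Hom C Y Z\<rbrakk>
    \<Longrightarrow> Comp C X Y Z g f \<in> Hom C X Z"
  using Comp_linear_left by (auto simp: clinear_on_def)

lemma (in linear_category) chain_face:
  assumes c: "chain C (Suc n) c" and i: "i \<le> n"
  shows "chain C n (face C i c)"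
proof (rule chainI)
  note l = chain_length[OF c]
  show "length (face C i c) = Suc n" using l i by (simp add: length_face)
  show "ob (face C i c) j \<in> Obj C" if "j \<le> n" for j
    using that l i chain_ob[OF c] by (simp add: ob_face)
  show "mor (face C i c) j \<in> Hom C (ob (face C i c) (Suc j)) (ob (face C i c) j)" if "j \<le> n" for j
    using that l i chain_mor[OF c, of j] chain_mor[OF c, of "Suc j"]
      chain_mor[OF c, of "Suc i"] chain_mor[OF c, of i] chain_ob[OF c]
    by (auto simp: ob_face mor_face intro!: Comp_Hom)
qed

text \<open>Simplicial identity for inner faces. The two faces act on disjoint entries unless b = a
  + 1, where three consecutive morphisms are composed and associativity decides.\<close>

lemma (in linear_category) face_face:
  assumes c: "chain C n c" and ab: "a < b" "Suc b \<le> n"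
  shows "face C a (face C b c) = face C (b - 1) (face C a c)"
proof (rule nth_equalityI)
  have l: "length c = Suc n" by (rule chain_length[OF c])
  have lb: "length (face C b c) = n" and la: "length (face C a c) = n"
    using l ab by (simp_all add: length_face)
  show "length (face C a (face C b c)) = length (face C (b - 1) (face C a c))"
    using la lb ab by (simp add: length_face)
  fix j assume "j < length (face C a (face C b c))"
  then have j: "j < n - 1" using lb ab by (simp add: length_face)
  have *: "Comp C (ob c (Suc (Suc (Suc a)))) (ob c (Suc a)) (ob c a) (mor c a)
      (Comp C (ob c (Suc (Suc (Suc a)))) (ob c (Suc (Suc a))) (ob c (Suc a)) (mor c (Suc a)) (mor c
        (Suc (Suc a)))) =
    Comp C (ob c (Suc (Suc (Suc a)))) (ob c (Suc (Suc a))) (ob c a)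
      (Comp C (ob c (Suc (Suc a))) (ob c (Suc a)) (ob c a) (mor c a) (mor c (Suc a))) (mor c (Suc
        (Suc a)))"
    using chain_ob[OF c] chain_mor[OF c] by (intro Comp_assoc)
  show "face C a (face C b c) ! j = face C (b - 1) (face C a c) ! j"
  proof (cases "b = Suc a")
    case True
    then show ?thesis using * j ab lb[unfolded True]
      by (auto simp: l la nth_face ob_face mor_face not_less)
  next
    case False
    then obtain d where d: "b = Suc (Suc (a + d))"
      using ab(1) by (metis Suc_lessI add_Suc_right less_imp_Suc_add add_Suc)
    then show ?thesis using j ab lb[unfolded d]
      by (auto simp: l la d nth_face ob_face mor_face)
  qed
qed

lemma rotate1_face:
  assumes "Suc (Suc i) < length c"
  shows "rotate1 (face C (Suc i) c) = face C i (rotate1 c)"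
proof -
  obtain x xs where c: "c = x # xs" using assms by (cases c) auto
  then have xs: "Suc i < length xs" using assms by simp
  have "c \<noteq> []" using c by simp
  note o = ob_rotate1[OF this] mor_rotate1[OF this]
  show ?thesis
    using xs unfolding face_def o by (simp add: c)
qed

text \<open>An inner face becomes the zeroth one after rotation by its index. For cochains that are
  covariant under rotation, only \<open>face C 0\<close> of rotated chains remains to be
  evaluated.\<close>

lemma rotate_face:
  "Suc i < length c \<Longrightarrow> rotate i (face C i c) = face C 0 (rotate i c)"
proof (induction i arbitrary: c)
  case (Suc i)
  have "rotate (Suc i) (face C (Suc i) c) = rotate i (rotate1 (face C (Suc i) c))"
    by (simp add: rotate1_rotate_swap)
  also have "\<dots> = face C 0 (rotate i (rotate1 c))"
    using Suc.prems by (simp add: rotate1_face Suc.IH)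
  finally show ?case by (simp add: rotate1_rotate_swap)
qed simp

lemma face_rotate1_rotate1:
  assumes "length c = Suc (Suc n)"
  shows "face C n (rotate1 (rotate1 c)) = rotate1 (face C 0 c)"
proof -
  obtain x y zs where c: "c = x # y # zs" and zs: "length zs = n"
    using assms by (metis length_Suc_conv)
  have ne: "c \<noteq> []" "rotate1 c \<noteq> []" using c by auto
  note o = ob_rotate1[OF ne(1)] mor_rotate1[OF ne(1)] ob_rotate1[OF ne(2)] mor_rotate1[OF ne(2)]
  have "ob c (n + 2 + i) = ob c i" "mor c (n + 2 + i) = mor c i" for i
    using ob_add_length(2)[of c i] mor_add_length(2)[of c i] assms by simp_all
  from this[of 0] this[of 1] this[of 2] show ?thesis
    using zs unfolding face_def o by (simp add: c numeral_2_eq_2)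
qed

text \<open>Bringing the last morphism to the front turns the wrap-around product into a zeroth
  face; n + 1 left shifts of n + 2 entries do this.\<close>

lemma last_face_eq:
  assumes "length c = Suc (Suc n)"
  shows "last_face C n c = face C 0 (rotate (Suc n) c)"
proof -
  have ne: "c \<noteq> []" using assms by auto
  have "ob c (n + 2 + i) = ob c i" "mor c (n + 2 + i) = mor c i" for i
    using ob_add_length(2)[of c i] mor_add_length(2)[of c i] assms by simp_all
  from this[of 0] this[of 1] this[of 2]
  have o: "ob (rotate (Suc n) c) 0 = ob c (n + 1)" "ob (rotate (Suc n) c) (0 + 1) = ob c 0"
    "ob (rotate (Suc n) c) (0 + 2) = ob c 1" "mor (rotate (Suc n) c) 0 = mor c (n + 1)"
    "mor (rotate (Suc n) c) (0 + 1) = mor c 0"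
    unfolding ob_rotate[OF ne] mor_rotate[OF ne] by (simp_all add: numeral_2_eq_2)
  obtain x xs where c: "c = x # xs" "xs \<noteq> []"
    using assms by (metis length_Suc_conv list.distinct(1))
  have "drop 2 (rotate (Suc n) c) = butlast (tl c)"
    unfolding last_butlast_rotate[OF assms, symmetric] using c by (simp add: drop_Suc numeral_2_eq_2)
  then show ?thesis unfolding last_face_def face_def o by (simp only: take0 append_Nil add_0)
qed

text \<open>All faces in one family; the last one, of index \<open>n + 1\<close>, is written with a rotation.\<close>

definition cyc_face :: "('o, 'm) lin_cat \<Rightarrow> nat \<Rightarrow> nat \<Rightarrow> ('o \<times> 'm) list \<Rightarrow> ('o \<times> 'm) list"
  where "cyc_face C n i c = (if i \<le> n then face C i c else face C 0 (rotate (Suc n) c))"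

lemma (in linear_category) chain_cyc_face:
  "chain C (Suc n) c \<Longrightarrow> chain C n (cyc_face C n i c)"
  by (auto simp: cyc_face_def simp del: rotate_Suc intro!: chain_face chain_rotate)

lemma hochschild_b_cyc_face:
  "chain C (Suc n) c \<Longrightarrow> hochschild_b C n \<phi> c = (\<Sum>i\<le>Suc n. (-1) ^ i * \<phi> (cyc_face C n i c))"
  by (simp add: hochschild_b_def cyc_face_def last_face_eq chain_length)

text \<open>The simplicial identities persist when the last face is involved. Wrap-around faces are
  rewritten as inner faces of a shifted chain, where \<open>face_face\<close> applies.\<close>

lemma (in linear_category) cyc_face_cyc_face:
  fixes c :: "('o \<times> 'm) list"
  assumes c: "chain C (Suc (Suc n)) c" and ab: "a < b" "b \<le> Suc (Suc n)"
  shows "cyc_face C n a (cyc_face C (Suc n) b c) = cyc_face C n (b - 1) (cyc_face C (Suc n) a c)"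
proof -
  note l = chain_length[OF c]
  have ne: "c \<noteq> []" using l by auto
  \<comment> \<open>One right shift: the last morphism stands in front, so the last face of
    \<open>c\<close> is the zeroth face of \<open>c'\<close>.\<close>
  define c' where "c' = rotate (Suc (Suc n)) c"
  have c': "chain C (Suc (Suc n)) c'" unfolding c'_def by (rule chain_rotate[OF c])
  have l': "length c' = Suc (Suc (Suc n))" by (rule chain_length[OF c'])
  have c_c': "c = rotate1 c'"
    using rotate_id[of "Suc (Suc (Suc n))" c] l by (simp add: c'_def rotate1_rotate_swap[symmetric])
  consider "b \<le> Suc n" | "b = Suc (Suc n)" "a \<le> n" | "b = Suc (Suc n)" "a = Suc n"
    using ab by linarith
  then show ?thesis
  proof cases
    case 1
    then show ?thesis using ab face_face[OF c, of a b] by (simp add: cyc_face_def)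
  next
    case 2
    have "face C a (face C 0 c') = face C 0 (face C (Suc a) c')"
      using face_face[OF c', of 0 "Suc a"] 2 by simp
    also have "face C (Suc a) c' = rotate (Suc n) (face C a c)"
    proof -
      have "rotate1 (face C (Suc a) c') = face C a c"
        using rotate1_face[of a c'] 2 l' c_c' by simp
      then have "rotate (Suc n) (face C a c) = rotate (Suc (Suc n)) (face C (Suc a) c')"
        by (metis rotate1_rotate_swap rotate_Suc)
      also have "\<dots> = face C (Suc a) c'"
        using l' 2 by (intro rotate_id) (simp add: length_face)
      finally show ?thesis by simp
    qed
    finally show ?thesis using 2 by (simp add: cyc_face_def c'_def)
  next
    case 3
    \<comment> \<open>Here three cyclically consecutive morphisms are composed, the last two and the
      first; \<open>c''\<close> brings them to the front.\<close>
    define c'' where "c'' = rotate (Suc (Suc n)) c'"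
    have c'': "chain C (Suc (Suc n)) c''" unfolding c''_def by (rule chain_rotate[OF c'])
    have l'': "length c'' = Suc (Suc (Suc n))" by (rule chain_length[OF c''])
    have c'_c'': "c' = rotate1 c''"
      using rotate_id[of "Suc (Suc (Suc n))" c'] l' by (simp add: c''_def
        rotate1_rotate_swap[symmetric])
    have i: "rotate (Suc n) (rotate1 x) = x" if "length x = Suc (Suc n)" for x :: "('o \<times> 'm) list"
      using that rotate_id[of "Suc (Suc n)" x] by (simp add: rotate1_rotate_swap[symmetric])
    have "face C 0 (rotate (Suc n) (face C 0 c')) = face C 0 (face C 1 c'')"
      using rotate1_face[of 0 c'' C] i[of "face C 1 c''"] l'' c'_c'' by (simp add: length_face)
    also have "\<dots> = face C 0 (face C 0 c'')"
      using face_face[OF c'', of 0 1] by simp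
    also have "face C 0 c'' = rotate (Suc n) (face C (Suc n) c)"
      using face_rotate1_rotate1[of c'' "Suc n" C] i[of "face C 0 c''"] l'' c'_c'' c_c'
      by (simp add: length_face)
    finally show ?thesis using 3 by (simp add: cyc_face_def c'_def)
  qed
qed

section \<open>Cyclic cochains\<close>

text \<open>Pairs with j < i are kept as (a, b) = (j, i); the others are renamed (a, b) = (i, j +
  1). This is the reindexing behind b^2 = 0: the two double faces belonging to a pair a < b are
  equal and carry opposite signs.\<close>

lemma sum_pairs:
  fixes F :: "nat \<Rightarrow> nat \<Rightarrow> 'a::comm_monoid_add"
  shows "(\<Sum>i\<le>Suc N. \<Sum>j\<le>N. F j i) = (\<Sum>b\<le>Suc N. \<Sum>a<b. F a b + F (b - 1) a)"
proof (induction N)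
  case 0
  then show ?case by (simp add: add.commute)
next
  case (Suc N)
  have "(\<Sum>i\<le>Suc (Suc N). \<Sum>j\<le>Suc N. F j i)
      = (\<Sum>i\<le>Suc N. \<Sum>j\<le>N. F j i) + (\<Sum>a\<le>Suc N. F (Suc N) a + F a (Suc (Suc N)))"
    by (simp add: sum.distrib ac_simps)
  also have "(\<Sum>a\<le>Suc N. F (Suc N) a + F a (Suc (Suc N)))
      = (\<Sum>a<Suc (Suc N). F a (Suc (Suc N)) + F (Suc (Suc N) - 1) a)"
    by (simp add: lessThan_Suc_atMost add.commute)
  finally show ?case
    using sum.atMost_Suc[of "\<lambda>b. \<Sum>a<b. F a b + F (b - 1) a" "Suc N"] by (simp only: Suc.IH)
qed

lemma minus_one_power_pred:
  "a < (b::nat) \<Longrightarrow> (-1) ^ (b - 1 + a) = - ((-1) ^ (a + b) :: complex)"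
  by (cases b) (auto simp: add.commute)

text \<open>Weighting the cocycle equations of the faces by their index, the terms with a fixed pair
  of faces have total weight \<open>b - a\<close> for the pair \<open>a < b\<close>.\<close>

lemma weighted_pairs:
  fixes F :: "nat \<Rightarrow> nat \<Rightarrow> complex"
  assumes sym: "\<And>a b. \<lbrakk>a < b; b \<le> Suc N\<rbrakk> \<Longrightarrow> F (b - 1) a = F a b"
    and zero: "\<And>i. i \<le> Suc N \<Longrightarrow> (\<Sum>j\<le>N. (-1) ^ j * F j i) = 0"
  shows "(\<Sum>i\<le>Suc N. (-1) ^ i * (\<Sum>j\<le>N. of_nat (N - j) * (-1) ^ j * F j i))
    = (\<Sum>i=1..N. \<Sum>j<i. (-1) ^ (i - 1 - j) * F j i)"
proof -
  define G where "G a b = (-1) ^ (a + b) * F a b" for a b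
  have "(\<Sum>i\<le>Suc N. (-1) ^ i * (\<Sum>j\<le>N. of_nat (N - j) * (-1) ^ j * F j i))
      = (\<Sum>i\<le>Suc N. \<Sum>j\<le>N. of_nat (N - j) * G j i)"
    unfolding G_def sum_distrib_left by (intro sum.cong refl) (simp add: power_add)
  also have "\<dots> = (\<Sum>b\<le>Suc N. \<Sum>a<b. of_nat (N - a) * G a b + of_nat (N - (b - 1)) * G (b - 1) a)"
    by (rule sum_pairs)
  also have "\<dots> = (\<Sum>b\<le>Suc N. \<Sum>a<b. (of_nat b - of_nat a) * G a b - G a b)"
  proof (intro sum.cong refl)
    fix b a assume "b \<in> {..Suc N}" and a: "a \<in> {..<b}"
    then have "G (b - 1) a = - G a b"
      by (simp only: G_def sym[of a b] minus_one_power_pred atMost_iff lessThan_iff mult_minus_left)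
    moreover have "a \<le> N" "b - 1 \<le> N" "1 \<le> b"
      using \<open>b \<in> {..Suc N}\<close> a by auto
    ultimately show "of_nat (N - a) * G a b + of_nat (N - (b - 1)) * G (b - 1) a
        = (of_nat b - of_nat a) * G a b - G a b"
      by (simp add: of_nat_diff algebra_simps)
  qed
  also have "\<dots> = (\<Sum>b\<le>Suc N. \<Sum>a<b. (of_nat b - of_nat a) * G a b) - (\<Sum>b\<le>Suc N. \<Sum>a<b. G a b)"
    by (simp add: sum_subtractf)
  \<comment> \<open>The cocycle equation of the face with index i, weighted by i, expands into this
    same sum, which therefore vanishes.\<close>
  also have "(\<Sum>b\<le>Suc N. \<Sum>a<b. (of_nat b - of_nat a) * G a b) = 0"
  proof -
    have "0 = (\<Sum>i\<le>Suc N. of_nat i * (-1) ^ i * (\<Sum>j\<le>N. (-1) ^ j * F j i))"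
      using zero by simp
    also have "\<dots> = (\<Sum>i\<le>Suc N. \<Sum>j\<le>N. of_nat i * G j i)"
      unfolding G_def sum_distrib_left by (intro sum.cong refl) (simp add: power_add)
    also have "\<dots> = (\<Sum>b\<le>Suc N. \<Sum>a<b. of_nat b * G a b + of_nat a * G (b - 1) a)"
      by (rule sum_pairs)
    also have "\<dots> = (\<Sum>b\<le>Suc N. \<Sum>a<b. (of_nat b - of_nat a) * G a b)"
    proof (intro sum.cong refl)
      fix b a assume "b \<in> {..Suc N}" and a: "a \<in> {..<b}"
      then have "G (b - 1) a = - G a b"
        by (simp only: G_def sym[of a b] minus_one_power_pred atMost_iff lessThan_iff mult_minus_left)
      then show "of_nat b * G a b + of_nat a * G (b - 1) a = (of_nat b - of_nat a) * G a b"
        by (simp add: algebra_simps)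
    qed
    finally show ?thesis by simp
  qed
  \<comment> \<open>The terms with b = N + 1 form the cocycle equation of the last face and drop
    out. What remains has the range of double faces used in \<open>S_cochain\<close>.\<close>
  also have "(\<Sum>b\<le>Suc N. \<Sum>a<b. G a b) = (\<Sum>b\<le>N. \<Sum>a<b. G a b)"
  proof -
    have "(\<Sum>a<Suc N. G a (Suc N)) = (-1) ^ Suc N * (\<Sum>j\<le>N. (-1) ^ j * F j (Suc N))"
      unfolding G_def sum_distrib_left lessThan_Suc_atMost
      by (intro sum.cong refl) (simp add: power_add)
    then show ?thesis using zero by simp
  qed
  also have "\<dots> = (\<Sum>b=1..N. \<Sum>a<b. G a b)"
    by (intro sum.mono_neutral_right) (auto simp: Suc_le_eq)
  also have "0 - \<dots> = (\<Sum>b=1..N. \<Sum>a<b. - G a b)"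
    by (simp add: sum_negf)
  also have "\<dots> = (\<Sum>i=1..N. \<Sum>j<i. (-1) ^ (i - 1 - j) * F j i)"
  proof (intro sum.cong refl)
    fix b a :: nat assume "a \<in> {..<b}"
    then obtain d where "b = Suc (a + d)" by (auto dest: less_imp_Suc_add)
    then show "- G a b = (-1) ^ (b - 1 - a) * F a b"
      by (simp add: G_def power_add flip: mult.assoc)
  qed
  finally show ?thesis .
qed

section \<open>Multilinearity and cyclic symmetry of cochains\<close>

lemma CN_zero: "\<lbrakk>\<phi> \<in> CN C n; \<not> chain C n c\<rbrakk> \<Longrightarrow> \<phi> c = 0"
  by (simp add: CN_def)

lemma CN_linear:
  "\<lbrakk>\<phi> \<in> CN C n; chain C n c; i \<le> n; g \<in> Hom C (ob c (Suc i)) (ob c i)\<rbrakk>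
    \<Longrightarrow> \<phi> (c[i := (ob c i, a *\<^sub>C mor c i + g)]) = a * \<phi> c + \<phi> (c[i := (ob c i, g)])"
  by (simp add: CN_def)

lemma CN_add: "\<lbrakk>\<phi> \<in> CN C n; \<psi> \<in> CN C n\<rbrakk> \<Longrightarrow> \<phi> + \<psi> \<in> CN C n"
  by (simp add: CN_def algebra_simps)

lemma CN_scale: "\<phi> \<in> CN C n \<Longrightarrow> a *\<^sub>C \<phi> \<in> CN C n"
  by (simp add: CN_def scaleC_fun_def scaleC_complex_def algebra_simps)

lemma C_lambda_rotate1:
  "\<lbrakk>\<phi> \<in> C_lambda C n; chain C n c\<rbrakk> \<Longrightarrow> \<phi> (rotate1 c) = (-1) ^ n * \<phi> c"
proof -
  assume \<phi>: "\<phi> \<in> C_lambda C n" and c: "chain C n c"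
  have "last (rotate1 c) # butlast (rotate1 c) = c" using chain_nonempty[OF c] by (cases c) auto
  moreover have "cyclic_op n \<phi> (rotate1 c) = \<phi> (rotate1 c)"
    using \<phi> chain_rotate1[OF c] by (simp add: C_lambda_def)
  ultimately show ?thesis by (simp add: cyclic_op_def)
qed

lemma C_lambdaI:
  assumes "\<phi> \<in> CN C n" and "\<And>c. chain C n c \<Longrightarrow> \<phi> (rotate1 c) = (-1) ^ n * \<phi> c"
  shows "\<phi> \<in> C_lambda C n"
proof -
  have "cyclic_op n \<phi> c = \<phi> c" if c: "chain C n c" for c
  proof -
    note l = chain_length[OF c]
    have "chain C n (last c # butlast c)"
      unfolding last_butlast_rotate[OF l] by (rule chain_rotate[OF c])
    from assms(2)[OF this] have "\<phi> c = (-1) ^ n * \<phi> (last c # butlast c)"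
      using chain_nonempty[OF c] by simp
    then show ?thesis by (simp add: cyclic_op_def)
  qed
  with assms(1) show ?thesis by (simp add: C_lambda_def)
qed

lemma C_lambda_rotate:
  "\<lbrakk>\<phi> \<in> C_lambda C n; chain C n c\<rbrakk> \<Longrightarrow> \<phi> (rotate k c) = (-1) ^ (n * k) * \<phi> c"
proof (induction k)
  case (Suc k)
  then show ?case
    using C_lambda_rotate1[of \<phi> C n "rotate k c"] chain_rotate[of C n c k]
    by (simp add: power_add)
qed simp

lemma C_lambda_add: "\<lbrakk>\<phi> \<in> C_lambda C n; \<psi> \<in> C_lambda C n\<rbrakk> \<Longrightarrow> \<phi> + \<psi> \<in> C_lambda C n"
  by (simp add: C_lambda_def CN_add cyclic_op_def algebra_simps)

lemma C_lambda_scale: "\<phi> \<in> C_lambda C n \<Longrightarrow> a *\<^sub>C \<phi> \<in> C_lambda C n"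
  using CN_scale[of \<phi> C n a]
  by (auto simp: C_lambda_def cyclic_op_def scaleC_fun_def scaleC_complex_def algebra_simps)

lemma hochschild_b_add: "hochschild_b C n (\<phi> + \<psi>) = hochschild_b C n \<phi> + hochschild_b C n \<psi>"
  by (rule ext) (simp add: hochschild_b_def algebra_simps sum.distrib)

lemma hochschild_b_scale: "hochschild_b C n (a *\<^sub>C \<phi>) = a *\<^sub>C hochschild_b C n \<phi>"
  by (rule ext)
    (simp add: hochschild_b_def algebra_simps sum_distrib_left scaleC_fun_def scaleC_complex_def)

lemma Z_lambda_add: "\<lbrakk>\<phi> \<in> Z_lambda C n; \<psi> \<in> Z_lambda C n\<rbrakk> \<Longrightarrow> \<phi> + \<psi> \<in> Z_lambda C n"
  by (simp add: Z_lambda_def C_lambda_add hochschild_b_add)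

lemma Z_lambda_scale: "\<phi> \<in> Z_lambda C n \<Longrightarrow> a *\<^sub>C \<phi> \<in> Z_lambda C n"
  by (simp add: Z_lambda_def C_lambda_scale hochschild_b_scale)

lemma chain_update:
  assumes "chain C n c" "i \<le> n" "g \<in> Hom C (ob c (Suc i)) (ob c i)"
  shows "chain C n (c[i := (ob c i, g)])"
proof (rule chainI)
  note l = chain_length[OF assms(1)]
  show "length (c[i := (ob c i, g)]) = Suc n" using l by simp
  have o: "ob (c[i := (ob c i, g)]) j = ob c j" for j
    using l assms(2) by (auto simp: ob_def nth_list_update)
  show "ob (c[i := (ob c i, g)]) j \<in> Obj C" for j unfolding o by (rule chain_ob[OF assms(1)])
  show "mor (c[i := (ob c i, g)]) j \<in> Hom C (ob (c[i := (ob c i, g)]) (Suc j)) (ob (c[i := (ob c i,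
    g)]) j)"
    if "j \<le> n" for j
    unfolding o using that l assms chain_mor[OF assms(1), of j]
    by (auto simp: mor_def nth_list_update)
qed

lemma ob_update: "i < length c \<Longrightarrow> ob (c[i := (ob c i, g)]) j = ob c j"
  by (auto simp: ob_def nth_list_update)

lemma mor_update:
  "i < length c \<Longrightarrow> mor (c[i := (x, g)]) j = (if j mod length c = i then g else mor c j)"
  by (auto simp: mor_def nth_list_update)

lemma rotate1_update:
  assumes "c \<noteq> []" "i < length c"
  shows "rotate1 (c[i := x]) = (rotate1 c)[(if i = 0 then length c - 1 else i - 1) := x]"
  using assms by (cases c) (auto simp: list_update_append split: nat.split)

lemma CN_rotate1:
  assumes \<phi>: "\<phi> \<in> CN C n"
  shows "(\<lambda>c. \<phi> (rotate1 c)) \<in> CN C n"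
proof -
  have z: "\<phi> (rotate1 c) = 0" if "\<not> chain C n c" for c
  proof (cases "chain C n (rotate1 c)")
    case True
    have "rotate n (rotate1 c) = c"
      using rotate_id[of "Suc n" c] chain_length[OF True] by (simp add: rotate1_rotate_swap[symmetric])
    with chain_rotate[OF True, of n] that show ?thesis by simp
  qed (simp add: CN_zero[OF \<phi>])
  have "\<phi> (rotate1 (c[i := (ob c i, a *\<^sub>C mor c i + g)])) = a * \<phi> (rotate1 c) + \<phi> (rotate1 (c[i :=
    (ob c i, g)]))"
    if c: "chain C n c" and i: "i \<le> n" and g: "g \<in> Hom C (ob c (Suc i)) (ob c i)" for c i g a
  proof -
    note l = chain_length[OF c] and ne = chain_nonempty[OF c]
    define k where "k = (if i = 0 then n else i - 1)"
    have k: "k \<le> n" using i by (auto simp: k_def)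
    have o: "ob (rotate1 c) k = ob c i" "mor (rotate1 c) k = mor c i" "ob (rotate1 c) (Suc k) = ob
      c (Suc i)"
      unfolding ob_rotate1[OF ne] mor_rotate1[OF ne] using l ob_add_length[of c] mor_add_length[of c]
        ob_add_length(2)[of c 0] ob_add_length(2)[of c 1] mor_add_length(2)[of c 0]
      by (auto simp: k_def)
    have r: "rotate1 (c[i := x]) = (rotate1 c)[k := x]" for x
      using rotate1_update[OF ne, of i x] i l by (simp add: k_def)
    show ?thesis
      using CN_linear[OF \<phi> chain_rotate1[OF c] k, of g a] g unfolding o r by simp
  qed
  with z show ?thesis by (simp add: CN_def)
qed

lemma CN_rotate: "\<phi> \<in> CN C n \<Longrightarrow> (\<lambda>c. \<phi> (rotate k c)) \<in> CN C n"
proof (induction k)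
  case (Suc k)
  then show ?case using CN_rotate1[of "\<lambda>c. \<phi> (rotate k c)" C n] by (simp add: rotate1_rotate_swap)
qed simp

lemma CN_sum: "(\<And>i. i \<in> I \<Longrightarrow> \<phi> i \<in> CN C n) \<Longrightarrow> (\<lambda>c. \<Sum>i\<in>I. k i * \<phi> i c) \<in> CN C n"
  by (simp add: CN_def sum.distrib sum_distrib_left algebra_simps)

lemma (in linear_category) CN_face:
  assumes \<phi>: "\<phi> \<in> CN C n" and j: "j \<le> n"
  shows "(\<lambda>c. if chain C (Suc n) c then \<phi> (face C j c) else 0) \<in> CN C (Suc n)"
proof -
  have "\<phi> (face C j (c[i := (ob c i, a *\<^sub>C mor c i + g)]))
      = a * \<phi> (face C j c) + \<phi> (face C j (c[i := (ob c i, g)]))"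
    if c: "chain C (Suc n) c" and i: "i \<le> Suc n" and g: "g \<in> Hom C (ob c (Suc i)) (ob c i)"
    for c i g a
  proof -
    note l = chain_length[OF c]
    have il: "i < length c" using i l by simp
    define k where "k = (if i \<le> j then i else i - 1)"
    have k: "k \<le> n" using i j by (auto simp: k_def)
    \<comment> \<open>A replacement x of the i-th morphism appears in the face as \<open>h x\<close>
      at position \<open>k\<close>: as a factor of the composite when i is j or j + 1, and unchanged
      otherwise.\<close>
    define h where "h x = (if i = j then Comp C (ob c (j + 2)) (ob c (j + 1)) (ob c j) x (mor c (j + 1))
      else if i = Suc j then Comp C (ob c (j + 2)) (ob c (j + 1)) (ob c j) (mor c j) x else x)" for x
    have f: "face C j (c[i := (ob c i, x)]) = (face C j c)[k := (ob (face C j c) k, h x)]" for x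
    proof (rule nth_equalityI)
      show "length (face C j (c[i := (ob c i, x)])) = length ((face C j c)[k := (ob (face C j c) k,
        h x)])"
        using l j by (simp add: length_face)
      fix q assume "q < length (face C j (c[i := (ob c i, x)]))"
      then have q: "q < Suc n" using l j by (simp add: length_face)
      show "face C j (c[i := (ob c i, x)]) ! q = (face C j c)[k := (ob (face C j c) k, h x)] ! q"
        using q i j l il
        by (auto simp: nth_face nth_list_update length_face ob_face ob_update mor_update k_def h_def)
    qed
    have h0: "h (mor c i) = mor (face C j c) k"
      using i j l by (auto simp: h_def k_def mor_face)
    have hg: "h x \<in> Hom C (ob (face C j c) (Suc k)) (ob (face C j c) k)"
      if "x \<in> Hom C (ob c (Suc i)) (ob c i)" for x
      using that i j l chain_ob[OF c] chain_mor[OF c, of j] chain_mor[OF c, of "Suc j"]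
      by (auto simp: h_def k_def ob_face intro!: Comp_Hom)
    have lin: "h (a *\<^sub>C mor c i + g) = a *\<^sub>C h (mor c i) + h g"
    proof -
      have "mor c i \<in> Hom C (ob c (Suc i)) (ob c i)" by (rule chain_mor[OF c])
      moreover have "a *\<^sub>C mor c i \<in> Hom C (ob c (Suc i)) (ob c i)"
        using calculation Hom_subspace chain_ob[OF c] by (simp add: cvs.subspace_scale)
      ultimately show ?thesis
        using g Comp_linear_left[of "ob c (j + 2)" "ob c (j + 1)" "ob c j" "mor c (j + 1)"]
          Comp_linear_right[of "ob c (j + 2)" "ob c (j + 1)" "ob c j" "mor c j"]
          chain_ob[OF c] chain_mor[OF c, of j] chain_mor[OF c, of "Suc j"]
        by (auto simp: h_def clinear_on_def)
    qed
    show ?thesis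
      using CN_linear[OF \<phi> chain_face[OF c j] k hg[OF g], of a] unfolding f lin h0 .
  qed
  moreover have "a *\<^sub>C mor c i + g \<in> Hom C (ob c (Suc i)) (ob c i)"
    if "chain C (Suc n) c" "g \<in> Hom C (ob c (Suc i)) (ob c i)" for c i g a
    using that Hom_subspace chain_ob chain_mor by (metis cvs.subspace_add cvs.subspace_scale)
  ultimately show ?thesis
    by (auto simp: CN_def chain_update)
qed

lemma (in linear_category) CN_hochschild_b:
  assumes \<phi>: "\<phi> \<in> CN C n"
  shows "hochschild_b C n \<phi> \<in> CN C (Suc n)"
proof -
  have "(\<lambda>c. if chain C (Suc n) c then \<phi> (cyc_face C n i c) else 0) \<in> CN C (Suc n)" if "i \<le> Suc n" for i
  proof (cases "i \<le> n")
    case True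
    then show ?thesis using CN_face[OF \<phi> True] by (simp add: cyc_face_def cong: if_cong)
  next
    case False
    have "chain C (Suc n) (rotate (Suc n) c) \<longleftrightarrow> chain C (Suc n) c" for c
    proof
      assume c: "chain C (Suc n) (rotate (Suc n) c)"
      have "rotate 1 (rotate (Suc n) c) = c"
        using rotate_id[of "Suc (Suc n)" c] chain_length[OF c] by (simp add: rotate1_rotate_swap)
      with chain_rotate[OF c, of 1] show "chain C (Suc n) c" by simp
    qed (rule chain_rotate)
    then show ?thesis
      using CN_rotate[OF CN_face[OF \<phi>, of 0], of "Suc n"] False
      by (simp add: cyc_face_def del: rotate_Suc cong: if_cong)
  qed
  then have "(\<lambda>c. \<Sum>i\<le>Suc n. (-1) ^ i * (if chain C (Suc n) c then \<phi> (cyc_face C n i c) else 0)) \<in>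
    CN C (Suc n)"
    by (intro CN_sum) auto
  moreover have "(\<lambda>c. \<Sum>i\<le>Suc n. (-1) ^ i * (if chain C (Suc n) c then \<phi> (cyc_face C n i c) else 0))
    = hochschild_b C n \<phi>"
    by (rule ext) (simp add: hochschild_b_cyc_face, simp add: hochschild_b_def)
  ultimately show ?thesis by simp
qed

text \<open>Each step of the rotation that turns a face into a zeroth face costs the sign (-1)^n.
  The formula also fits the last face, since the exponent n(n + 1) is even.\<close>

lemma (in linear_category) C_lambda_cyc_face:
  assumes \<phi>: "\<phi> \<in> C_lambda C n" and c: "chain C (Suc n) c" and i: "i \<le> Suc n"
  shows "\<phi> (cyc_face C n i c) = (-1) ^ (n * i) * \<phi> (face C 0 (rotate i c))"
proof (cases "i \<le> n")
  case True
  have "\<phi> (rotate i (face C i c)) = (-1) ^ (n * i) * \<phi> (face C i c)"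
    by (rule C_lambda_rotate[OF \<phi> chain_face[OF c True]])
  then show ?thesis
    using True chain_length[OF c] by (simp add: rotate_face cyc_face_def power_mult_distrib flip:
      mult.assoc power_add)
next
  case False
  with i have "i = Suc n" by simp
  moreover have "even (n * Suc n)" by simp
  ultimately show ?thesis by (simp add: cyc_face_def del: rotate_Suc even_mult_iff mult_Suc_right)
qed

text \<open>On cyclic cochains the coboundary is a sum over all n + 2 rotations of the chain, with
  signs (-1)^((n+1)i). Rotating the chain shifts this sum cyclically and yields the factor
  (-1)^(n+1).\<close>

lemma (in linear_category) C_lambda_hochschild_b:
  assumes \<phi>: "\<phi> \<in> C_lambda C n"
  shows "hochschild_b C n \<phi> \<in> C_lambda C (Suc n)"
proof (rule C_lambdaI)
  show "hochschild_b C n \<phi> \<in> CN C (Suc n)"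
    using \<phi> by (simp add: C_lambda_def CN_hochschild_b)
  fix c assume c: "chain C (Suc n) c"
  define g where "g i = (-1) ^ (Suc n * i) * \<phi> (face C 0 (rotate i c))" for i
  have b: "hochschild_b C n \<phi> (rotate k c) = (-1) ^ (Suc n * k) * (\<Sum>i\<le>Suc n. g (i + k))" for k
  proof -
    have "hochschild_b C n \<phi> (rotate k c)
        = (\<Sum>i\<le>Suc n. (-1) ^ i * ((-1) ^ (n * i) * \<phi> (face C 0 (rotate i (rotate k c)))))"
      using chain_rotate[OF c] by (simp add: hochschild_b_cyc_face C_lambda_cyc_face[OF \<phi>] del:
        sum.atMost_Suc)
    also have "\<dots> = (\<Sum>i\<le>Suc n. (-1) ^ (Suc n * k) * g (i + k))"
    proof (rule sum.cong)
      fix i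
      have "(-1) ^ i * (-1) ^ (n * i) = ((-1) ^ (Suc n * k) * (-1) ^ (Suc n * (i + k)) :: complex)"
        by (cases "even n"; cases "even k"; cases "even i") auto
      then show "(-1) ^ i * ((-1) ^ (n * i) * \<phi> (face C 0 (rotate i (rotate k c)))) = (-1) ^ (Suc n
        * k) * g (i + k)"
        by (simp only: g_def rotate_rotate mult.assoc[symmetric])
    qed simp
    finally show ?thesis by (simp only: sum_distrib_left)
  qed
  have "rotate (Suc (Suc n)) c = c" using chain_length[OF c] by (intro rotate_id) simp
  then have "g (Suc (Suc n)) = g 0" by (simp add: g_def del: rotate_Suc)
  then have "(\<Sum>i\<le>Suc n. g (i + 1)) = (\<Sum>i\<le>Suc n. g (i + 0))"
    using sum.atMost_Suc_shift[of g "Suc n"] by simp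
  then show "hochschild_b C n \<phi> (rotate1 c) = (-1) ^ Suc n * hochschild_b C n \<phi> c"
    using b[of 0] b[of 1] by simp
qed

lemma (in linear_category) hochschild_b_hochschild_b:
  "hochschild_b C (Suc n) (hochschild_b C n \<phi>) = 0"
proof
  fix c
  show "hochschild_b C (Suc n) (hochschild_b C n \<phi>) c = 0 c"
  proof (cases "chain C (Suc (Suc n)) c")
    case c: True
    have "hochschild_b C (Suc n) (hochschild_b C n \<phi>) c
        = (\<Sum>i\<le>Suc (Suc n). (-1) ^ i * (\<Sum>j\<le>Suc n. (-1) ^ j * \<phi> (cyc_face C n j (cyc_face C (Suc n) i
          c))))"
      using c by (simp add: hochschild_b_cyc_face chain_cyc_face del: sum.atMost_Suc)
    also have "\<dots> = (\<Sum>i\<le>Suc (Suc n). \<Sum>j\<le>Suc n. (-1) ^ (j + i) * \<phi> (cyc_face C n j (cyc_face C (Suc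
      n) i c)))"
      unfolding sum_distrib_left by (intro sum.cong refl) (simp add: power_add)
    also have "\<dots> = (\<Sum>b\<le>Suc (Suc n). \<Sum>a<b. (-1) ^ (a + b) * \<phi> (cyc_face C n a (cyc_face C (Suc n) b c))
        + (-1) ^ (b - 1 + a) * \<phi> (cyc_face C n (b - 1) (cyc_face C (Suc n) a c)))"
      by (rule sum_pairs)
    also have "\<dots> = 0"
      by (intro sum.neutral ballI) (simp only: minus_one_power_pred cyc_face_cyc_face[OF c]
        atMost_iff lessThan_iff
          mult_minus_left add.right_inverse)
    finally show ?thesis by simp
  qed (simp add: hochschild_b_def)
qed

text \<open>The value of \<open>\<phi> # \<psi>_0\<close>, written in terms of the character \<open>\<phi>\<close> alone.\<close>

definition S_cochain :: "('o, 'm) lin_cat \<Rightarrow> nat \<Rightarrow> ('o, 'm) cochain \<Rightarrow> ('o, 'm) cochain"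
  where "S_cochain C r \<phi> = (\<lambda>c. if chain C (r + 2) c
    then \<Sum>i=1..r + 1. \<Sum>j<i. (-1) ^ (i - 1 - j) * \<phi> (face C j (face C i c)) else 0)"

text \<open>The hypothesis b \<phi> = 0, applied to the faces of the chain, removes all but the
  double faces counted in \<open>S_cochain\<close>. The identity holds for any Hochschild cocycle
  and makes no claim that \<open>\<eta>\<close> is cyclic; recovering a cyclic cochain is the task
  of the later sections.\<close>

lemma (in linear_category) S_cochain_eq_hochschild_b:
  assumes \<phi>: "hochschild_b C r \<phi> = 0"
    and \<eta>: "\<And>c. chain C (Suc r) c \<Longrightarrow> \<eta> c = (\<Sum>j\<le>r. of_nat (r + 1 - j) * (-1) ^ j * \<phi> (face C j c))"
  shows "S_cochain C r \<phi> = hochschild_b C (Suc r) \<eta>"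
proof
  fix c
  show "S_cochain C r \<phi> c = hochschild_b C (Suc r) \<eta> c"
  proof (cases "chain C (Suc (Suc r)) c")
    case c: True
    define F where "F j i = \<phi> (cyc_face C r j (cyc_face C (Suc r) i c))" for j i
    \<comment> \<open>The last face enters with weight 0, so the sum may run over all faces, as the
      double-face identity requires.\<close>
    have \<eta>': "\<eta> c' = (\<Sum>j\<le>Suc r. of_nat (Suc r - j) * (-1) ^ j * \<phi> (cyc_face C r j c'))"
      if "chain C (Suc r) c'" for c'
      using \<eta>[OF that] by (simp add: cyc_face_def)
    have "hochschild_b C (Suc r) \<eta> c
        = (\<Sum>i\<le>Suc (Suc r). (-1) ^ i * (\<Sum>j\<le>Suc r. of_nat (Suc r - j) * (-1) ^ j * F j i))"
      unfolding F_def using c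
      by (simp add: hochschild_b_cyc_face \<eta>' chain_cyc_face del: sum.atMost_Suc)
    also have "\<dots> = (\<Sum>i=1..Suc r. \<Sum>j<i. (-1) ^ (i - 1 - j) * F j i)"
    proof (rule weighted_pairs)
      show "F (b - 1) a = F a b" if "a < b" "b \<le> Suc (Suc r)" for a b
        using cyc_face_cyc_face[OF c that] by (simp only: F_def)
      show "(\<Sum>j\<le>Suc r. (-1) ^ j * F j i) = 0" for i
        using \<phi> hochschild_b_cyc_face[OF chain_cyc_face[OF c], of \<phi> i] by (simp add: F_def del:
          sum.atMost_Suc)
    qed
    also have "\<dots> = S_cochain C r \<phi> c"
      using c by (auto simp: S_cochain_def F_def cyc_face_def intro!: sum.cong)
    finally show ?thesis by simp
  qed (simp add: hochschild_b_def S_cochain_def)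
qed

lemma (in linear_category) cohomology_class_eqI:
  assumes \<phi>: "\<phi> \<in> Z_lambda C (Suc n)" and \<psi>: "\<psi> \<in> Z_lambda C (Suc n)"
    and \<theta>: "\<theta> \<in> C_lambda C n" "\<phi> - \<psi> = hochschild_b C n \<theta>"
  shows "cohomology_class C (Suc n) \<phi> = cohomology_class C (Suc n) \<psi>"
    and "cohomology_class C (Suc n) \<phi> \<in> H_lambda C (Suc n)"
proof -
  have B: "x + y \<in> B_lambda C (Suc n)" if "x \<in> B_lambda C (Suc n)" "y \<in> B_lambda C (Suc n)" for x y
    using that by (auto simp: B_lambda_def intro!: C_lambda_add simp flip: hochschild_b_add)
  have B': "(-1) *\<^sub>C x \<in> B_lambda C (Suc n)" if x: "x \<in> B_lambda C (Suc n)" for x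
  proof -
    obtain y where "y \<in> C_lambda C n" "x = hochschild_b C n y" using x by (auto simp: B_lambda_def)
    then have "(-1) *\<^sub>C x = hochschild_b C n ((-1) *\<^sub>C y)" "(-1) *\<^sub>C y \<in> C_lambda C n"
      by (simp_all only: hochschild_b_scale C_lambda_scale)
    then show ?thesis by (simp add: B_lambda_def)
  qed
  have m: "(-1) *\<^sub>C x = - x" for x :: "('o, 'm) cochain"
    by (simp add: scaleC_fun_def scaleC_complex_def fun_eq_iff)
  have d: "\<phi> - \<psi> \<in> B_lambda C (Suc n)" using \<theta> by (auto simp: B_lambda_def)
  have "(\<phi> - \<xi> \<in> B_lambda C (Suc n)) = (\<psi> - \<xi> \<in> B_lambda C (Suc n))" for \<xi>
    using B[of "\<phi> - \<xi>" "- (\<phi> - \<psi>)"] B[of "\<psi> - \<xi>" "\<phi> - \<psi>"] B'[OF d] d unfolding m by auto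
  then show "cohomology_class C (Suc n) \<phi> = cohomology_class C (Suc n) \<psi>"
    using \<phi> \<psi> by (auto simp: cohomology_class_def cohomologous_def)
  show "cohomology_class C (Suc n) \<phi> \<in> H_lambda C (Suc n)"
    using \<phi> by (auto simp: cohomology_class_def H_lambda_def intro: quotientI)
qed

section \<open>Composites in differential graded semicategories\<close>

lemma clinear_onD:
  assumes "clinear_on U V T"
  shows "x \<in> U \<Longrightarrow> T x \<in> V"
    and "\<lbrakk>x \<in> U; y \<in> U\<rbrakk> \<Longrightarrow> T (x + y) = T x + T y"
    and "x \<in> U \<Longrightarrow> T (a *\<^sub>C x) = a *\<^sub>C T x"
  using assms by (auto simp: clinear_on_def)

lemma clinear_on_0:
  assumes "clinear_on U V T" "cvs.subspace U" shows "T 0 = 0"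
  using clinear_onD(3)[OF assms(1), of 0 0] cvs.subspace_0[OF assms(2)] by simp

lemma clinear_on_sum:
  assumes "clinear_on U V T" "cvs.subspace U" "\<And>i. i \<in> I \<Longrightarrow> x i \<in> U"
  shows "T (\<Sum>i\<in>I. x i) = (\<Sum>i\<in>I. T (x i))"
  using assms(3)
proof (induction I rule: infinite_finite_induct)
  case (insert j I)
  then have "x j \<in> U" "sum x I \<in> U" by (auto intro!: cvs.subspace_sum[OF assms(2)])
  with insert show ?case using clinear_onD(2)[OF assms(1)] by simp
qed (simp_all add: clinear_on_0[OF assms(1,2)])

text \<open>The composite \<open>Z_a Z_{a+1} ... Z_{a+k}\<close>, where \<open>Z_i\<close> goes from \<open>Y_{i+1}\<close> to \<open>Y_i\<close>.\<close>

fun seg :: "('d \<Rightarrow> 'd \<Rightarrow> 'd \<Rightarrow> 'a \<Rightarrow> 'a \<Rightarrow> 'a) \<Rightarrow> (nat \<Rightarrow> 'd) \<Rightarrow> (nat \<Rightarrow> 'a) \<Rightarrow> nat \<Rightarrow> nat \<Rightarrow> 'a"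
  where
    "seg cmp Y Z a 0 = Z a"
  | "seg cmp Y Z a (Suc k) = cmp (Y (a + k + 2)) (Y (Suc a)) (Y a) (Z a) (seg cmp Y Z (Suc a) k)"

lemma path_comp_seg:
  "path_comp cmp (Y (a + k + 1)) (map (\<lambda>i. (Y i, Z i)) [a..<a + k + 1]) = seg cmp Y Z a k"
proof (induction k arbitrary: a)
  case (Suc k)
  have "[a..<a + Suc k + 1] = a # Suc a # [Suc (Suc a)..<Suc a + k + 1]"
    "[Suc a..<Suc a + k + 1] = Suc a # [Suc (Suc a)..<Suc a + k + 1]"
    by (simp_all add: upt_conv_Cons del: upt_Suc)
  with Suc.IH[of "Suc a"] show ?case by (simp add: numeral_2_eq_2 del: upt_Suc)
qed simp

lemma seg_cong:
  assumes "\<And>i. a \<le> i \<Longrightarrow> i \<le> a + k + 1 \<Longrightarrow> Y i = Y' i"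
    and "\<And>i. a \<le> i \<Longrightarrow> i \<le> a + k \<Longrightarrow> Z i = Z' i"
  shows "seg cmp Y Z a k = seg cmp Y' Z' a k"
  using assms
proof (induction k arbitrary: a)
  case (Suc k)
  have "seg cmp Y Z (Suc a) k = seg cmp Y' Z' (Suc a) k"
    using Suc.prems by (intro Suc.IH) auto
  then show ?case using Suc.prems by simp
qed simp

lemma seg_shift: "seg cmp (\<lambda>i. Y (i + s)) (\<lambda>i. Z (i + s)) a k = seg cmp Y Z (a + s) k"
  by (induction k arbitrary: a) (simp_all add: ac_simps)

context dg_semicategory
begin

lemma DDiff_DHom: "\<lbrakk>X \<in> DObj S; Y \<in> DObj S; f \<in> DHom S n X Y\<rbrakk> \<Longrightarrow> DDiff S X Y f \<in> DHom S (Suc n) X Y"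
  using DDiff_linear clinear_onD(1) by metis

lemma DComp_DHom:
  "\<lbrakk>X \<in> DObj S; Y \<in> DObj S; Z \<in> DObj S; f \<in> DHom S i X Y; g \<in> DHom S j Y Z\<rbrakk>
    \<Longrightarrow> DComp S X Y Z g f \<in> DHom S (j + i) X Z"
  using clinear_onD(1)[OF DComp_linear_left] by metis

text \<open>All natural indices are allowed because objects and morphisms of a chain are read
  cyclically; segments may thus run past the end of the list.\<close>

definition dg_path :: "(nat \<Rightarrow> 'd) \<Rightarrow> (nat \<Rightarrow> 's) \<Rightarrow> (nat \<Rightarrow> nat) \<Rightarrow> bool"
  where "dg_path Y Z \<delta> \<longleftrightarrow> (\<forall>i. Y i \<in> DObj S \<and> Z i \<in> DHom S (\<delta> i) (Y (Suc i)) (Y i))"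

abbreviation "dseg \<equiv> seg (DComp S)"

lemma dseg_DHom:
  assumes "dg_path Y Z \<delta>"
  shows "dseg Y Z a k \<in> DHom S (\<Sum>i=a..a + k. \<delta> i) (Y (a + k + 1)) (Y a)"
proof (induction k arbitrary: a)
  case 0
  then show ?case using assms by (simp add: dg_path_def)
next
  case (Suc k)
  have "(\<Sum>i=a..a + Suc k. \<delta> i) = \<delta> a + (\<Sum>i=Suc a..Suc a + k. \<delta> i)"
    by (subst sum.atLeast_Suc_atMost) auto
  moreover have "DComp S (Y (Suc a + k + 1)) (Y (Suc a)) (Y a) (Z a) (dseg Y Z (Suc a) k)
      \<in> DHom S (\<delta> a + (\<Sum>i=Suc a..Suc a + k. \<delta> i)) (Y (Suc a + k + 1)) (Y a)"
    by (rule DComp_DHom[OF _ _ _ Suc.IH]) (use assms in \<open>auto simp: dg_path_def\<close>)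
  ultimately show ?case by (simp only: seg.simps) (simp add: numeral_2_eq_2)
qed

lemma dseg_append:
  assumes p: "dg_path Y Z \<delta>"
  shows "dseg Y Z a (Suc (k + l)) =
    DComp S (Y (a + k + l + 2)) (Y (a + k + 1)) (Y a) (dseg Y Z a k) (dseg Y Z (a + k + 1) l)"
proof (induction k arbitrary: a)
  case (Suc k)
  have Y: "Y i \<in> DObj S" for i using p by (simp add: dg_path_def)
  have "dseg Y Z a (Suc (Suc k + l)) = DComp S (Y (a + k + l + 3)) (Y (Suc a)) (Y a) (Z a)
      (DComp S (Y (a + k + l + 3)) (Y (a + k + 2)) (Y (Suc a)) (dseg Y Z (Suc a) k) (dseg Y Z (a +
        k + 2) l))"
    using Suc.IH[of "Suc a"] by (simp add: eval_nat_numeral add.assoc del: seg.simps(2)) (simp add: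
      eval_nat_numeral add.assoc)
  also have "\<dots> = DComp S (Y (a + k + l + 3)) (Y (a + k + 2)) (Y a)
      (DComp S (Y (a + k + 2)) (Y (Suc a)) (Y a) (Z a) (dseg Y Z (Suc a) k)) (dseg Y Z (a + k + 2) l)"
  proof (rule DComp_assoc[OF Y Y Y Y])
    show "dseg Y Z (a + k + 2) l \<in> DHom S (\<Sum>i=a + k + 2..a + k + 2 + l. \<delta> i) (Y (a + k + l + 3)) (Y
      (a + k + 2))"
      using dseg_DHom[OF p, of "a + k + 2" l] by (simp add: eval_nat_numeral ac_simps)
    show "dseg Y Z (Suc a) k \<in> DHom S (\<Sum>i=Suc a..Suc a + k. \<delta> i) (Y (a + k + 2)) (Y (Suc a))"
      using dseg_DHom[OF p, of "Suc a" k] by simp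
    show "Z a \<in> DHom S (\<delta> a) (Y (Suc a)) (Y a)" using p by (simp add: dg_path_def)
  qed
  finally show ?case by (simp add: eval_nat_numeral)
qed (simp add: eval_nat_numeral)

lemma dseg_linear:
  assumes p: "dg_path Y (Z(j := x)) \<delta>" and y: "y \<in> DHom S (\<delta> j) (Y (Suc j)) (Y j)"
    and j: "a \<le> j" "j \<le> a + k"
  shows "dseg Y (Z(j := c *\<^sub>C x + y)) a k = c *\<^sub>C dseg Y (Z(j := x)) a k + dseg Y (Z(j := y)) a k"
  using j
proof (induction k arbitrary: a)
  case (Suc k)
  have Y: "Y i \<in> DObj S" for i using p by (simp add: dg_path_def)
  have x: "x \<in> DHom S (\<delta> j) (Y (Suc j)) (Y j)" using p by (auto simp: dg_path_def dest: spec[of _ j])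
  have p': "dg_path Y (Z(j := y)) \<delta>" using p y by (auto simp: dg_path_def split: if_splits)
  note H = dseg_DHom[OF p, of "Suc a" k] dseg_DHom[OF p', of "Suc a" k]
  show ?case
  proof (cases "j = a")
    case True
    have q: "dseg Y (Z(j := z)) (Suc a) k = dseg Y (Z(j := x)) (Suc a) k" for z
      by (rule seg_cong) (use True in auto)
    define P where "P = dseg Y (Z(j := x)) (Suc a) k"
    have e: "dseg Y (Z(j := z)) a (Suc k)
        = DComp S (Y (Suc a + k + 1)) (Y (Suc a)) (Y a) z P" for z
      using q[of z] True by (simp add: P_def del: fun_upd_apply) simp
    have cx: "c *\<^sub>C x \<in> DHom S (\<delta> a) (Y (Suc a)) (Y a)"
      using x DHom_subspace[OF Y Y] True by (simp add: cvs.subspace_scale)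
    have "clinear_on (DHom S (\<delta> a) (Y (Suc a)) (Y a))
        (DHom S (\<delta> a + (\<Sum>i=Suc a..Suc a + k. \<delta> i)) (Y (Suc a + k + 1)) (Y a))
        (\<lambda>g. DComp S (Y (Suc a + k + 1)) (Y (Suc a)) (Y a) g P)"
      by (rule DComp_linear_left[OF Y Y Y H(1)[folded P_def]])
    note lin = clinear_onD[OF this]
    show ?thesis
      unfolding e using lin(2)[OF cx] lin(3) x y True by simp
  next
    case False
    with Suc.prems have "Suc a \<le> j" "j \<le> Suc a + k" by auto
    note IH = Suc.IH[OF this]
    have Za: "Z a \<in> DHom S (\<delta> a) (Y (Suc a)) (Y a)"
      using p False by (auto simp: dg_path_def dest: spec[of _ a])
    have "clinear_on (DHom S (\<Sum>i=Suc a..Suc a + k. \<delta> i) (Y (Suc a + k + 1)) (Y (Suc a)))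
        (DHom S (\<delta> a + (\<Sum>i=Suc a..Suc a + k. \<delta> i)) (Y (Suc a + k + 1)) (Y a))
        (DComp S (Y (Suc a + k + 1)) (Y (Suc a)) (Y a) (Z a))"
      by (rule DComp_linear_right[OF Y Y Y Za])
    note lin = clinear_onD[OF this]
    have cx: "c *\<^sub>C dseg Y (Z(j := x)) (Suc a) k \<in> DHom S (\<Sum>i=Suc a..Suc a + k. \<delta> i) (Y (Suc a + k
      + 1)) (Y (Suc a))"
      using H(1) DHom_subspace[OF Y Y] by (intro cvs.subspace_scale)
    have e: "dseg Y (Z(j := z)) a (Suc k)
        = DComp S (Y (Suc a + k + 1)) (Y (Suc a)) (Y a) (Z a) (dseg Y (Z(j := z)) (Suc a) k)" for z
      using False by simp
    show ?thesis
      unfolding e IH lin(2)[OF cx H(2)] lin(3)[OF H(1)] ..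
  qed
qed simp

text \<open>Associativity allows letters j and j + 1 to be composed first. The reindexing beyond j
  is that of \<open>face\<close>, so words of a face can be compared with words of the original
  chain.\<close>

lemma dseg_merge:
  assumes p: "dg_path Y Z \<delta>" and j: "a \<le> j" "j \<le> a + k"
  shows "dseg (\<lambda>i. Y (if i \<le> j then i else Suc i))
      (\<lambda>i. if i = j then DComp S (Y (j + 2)) (Y (j + 1)) (Y j) (Z j) (Z (j + 1)) else Z (if i \<le> j
        then i else Suc i)) a k
    = dseg Y Z a (Suc k)"
  using j
proof (induction k arbitrary: a)
  case (Suc k)
  have Y: "Y i \<in> DObj S" for i using p by (simp add: dg_path_def)
  have Z: "Z i \<in> DHom S (\<delta> i) (Y (Suc i)) (Y i)" for i using p by (simp add: dg_path_def)
  show ?case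
  proof (cases "j = a")
    case True
    have "dseg (\<lambda>i. Y (if i \<le> j then i else Suc i))
      (\<lambda>i. if i = j then DComp S (Y (j + 2)) (Y (j + 1)) (Y j) (Z j) (Z (j + 1)) else Z (if i \<le> j
        then i else Suc i)) (Suc a) k
      = dseg (\<lambda>i. Y (i + 1)) (\<lambda>i. Z (i + 1)) (Suc a) k"
      by (rule seg_cong) (use True in auto)
    also have "\<dots> = dseg Y Z (Suc (Suc a)) k" using seg_shift[of _ Y 1 Z "Suc a" k] by simp
    finally have "dseg (\<lambda>i. Y (if i \<le> j then i else Suc i))
      (\<lambda>i. if i = j then DComp S (Y (j + 2)) (Y (j + 1)) (Y j) (Z j) (Z (j + 1)) else Z (if i \<le> j
        then i else Suc i)) (Suc a) k
      = dseg Y Z (Suc (Suc a)) k" .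
    then show ?thesis
      using DComp_assoc[OF Y Y Y Y dseg_DHom[OF p, of "Suc (Suc a)" k] Z Z] True by simp
  next
    case False
    with Suc.prems have "Suc a \<le> j" "j \<le> Suc a + k" by auto
    from Suc.IH[OF this] show ?thesis using False Suc.prems by simp
  qed
next
  case 0
  then show ?case by simp
qed

end

section \<open>Words of a semifunctor into a differential graded semicategory\<close>

text \<open>A cycle stripped of its trace and of its units in degree 0. Leaving the trace free lets
  the same calculus of words serve arbitrary cycles and, for a Fredholm module, both functionals
  \<open>fr_trace\<close> and \<open>SG\<close>.\<close>

locale dg_over = linear_category C + dg_semicategory S
  for C :: "('o, 'm::complex_vector) lin_cat"
    and S :: "('d, 's::complex_vector) dg_semicat"
    and rho_ob :: "'o \<Rightarrow> 'd"
    and rho :: "'o \<Rightarrow> 'o \<Rightarrow> 'm \<Rightarrow> 's" +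
  assumes rho_ob_Obj: "X \<in> Obj C \<Longrightarrow> rho_ob X \<in> DObj S"
    and rho_linear: "\<lbrakk>X \<in> Obj C; Y \<in> Obj C\<rbrakk>
      \<Longrightarrow> clinear_on (Hom C X Y) (DHom S 0 (rho_ob X) (rho_ob Y)) (rho X Y)"
    and rho_Comp: "\<lbrakk>X \<in> Obj C; Y \<in> Obj C; Z \<in> Obj C; f \<in> Hom C X Y; g \<in> Hom C Y Z\<rbrakk>
      \<Longrightarrow> rho X Z (Comp C X Y Z g f) =
           DComp S (rho_ob X) (rho_ob Y) (rho_ob Z) (rho Y Z g) (rho X Y f)"
begin

definition Yc :: "('o \<times> 'm) list \<Rightarrow> nat \<Rightarrow> 'd"
  where "Yc c i = rho_ob (ob c i)"

definition Rc :: "('o \<times> 'm) list \<Rightarrow> nat \<Rightarrow> 's"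
  where "Rc c i = rho (ob c (Suc i)) (ob c i) (mor c i)"

definition Dc :: "('o \<times> 'm) list \<Rightarrow> nat \<Rightarrow> 's"
  where "Dc c i = DDiff S (Yc c (Suc i)) (Yc c i) (Rc c i)"

definition letter :: "('o \<times> 'm) list \<Rightarrow> nat set \<Rightarrow> nat \<Rightarrow> 's"
  where "letter c K i = (if i \<in> K then Rc c i else Dc c i)"

text \<open>With \<open>K\<close> = {0} this is the argument of a character, with \<open>K\<close> =
  {} the differential of that argument. Larger \<open>K\<close> arise from faces and from the
  factors de in the tensor product.\<close>

definition word :: "('o \<times> 'm) list \<Rightarrow> nat set \<Rightarrow> nat \<Rightarrow> nat \<Rightarrow> 's"
  where "word c K a k = dseg (Yc c) (letter c K) a k"

lemma Yc_DObj: "chain C n c \<Longrightarrow> Yc c i \<in> DObj S"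
  by (simp add: Yc_def rho_ob_Obj chain_ob)

lemma Rc_DHom: "chain C n c \<Longrightarrow> Rc c i \<in> DHom S 0 (Yc c (Suc i)) (Yc c i)"
  using clinear_onD(1)[OF rho_linear] by (simp add: Rc_def Yc_def chain_ob chain_mor)

lemma Dc_DHom: "chain C n c \<Longrightarrow> Dc c i \<in> DHom S 1 (Yc c (Suc i)) (Yc c i)"
  using DDiff_DHom[OF Yc_DObj Yc_DObj Rc_DHom] by (simp add: Dc_def)

lemma letter_path:
  "chain C n c \<Longrightarrow> dg_path (Yc c) (letter c K) (\<lambda>i. if i \<in> K then 0 else 1)"
  using Rc_DHom Dc_DHom Yc_DObj by (simp add: dg_path_def letter_def)

lemma word_DHom:
  assumes "chain C n c"
  shows "word c K a k \<in> DHom S (card ({a..a + k} - K)) (Yc c (a + k + 1)) (Yc c a)"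
proof -
  have "(\<Sum>i=a..a + k. if i \<in> K then 0 else 1) = card ({a..a + k} - K)"
    by (subst sum.mono_neutral_cong_right[of _ "{a..a + k} - K" _ "\<lambda>_. 1"]) auto
  then show ?thesis
    using dseg_DHom[OF letter_path[OF assms, of K], of a k] by (simp add: word_def)
qed

lemma word_append:
  assumes "chain C n c"
  shows "word c K a (Suc (k + l)) =
    DComp S (Yc c (a + k + l + 2)) (Yc c (a + k + 1)) (Yc c a) (word c K a k) (word c K (a + k + 1) l)"
  unfolding word_def by (rule dseg_append[OF letter_path[OF assms]])

lemma word_cong:
  assumes "\<And>i. a \<le> i \<Longrightarrow> i \<le> a + k \<Longrightarrow> i \<in> K \<longleftrightarrow> i \<in> K'"
  shows "word c K a k = word c K' a k"
  unfolding word_def by (rule seg_cong) (simp_all add: letter_def assms)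

lemma word_rotate:
  assumes "c \<noteq> []"
  shows "word (rotate s c) K a k = word c ((\<lambda>i. i + s) ` K) (a + s) k"
proof -
  have "Yc (rotate s c) = (\<lambda>i. Yc c (i + s))" "letter (rotate s c) K = (\<lambda>i. letter c ((\<lambda>i. i + s) `
    K) (i + s))"
    using assms by (auto simp: fun_eq_iff Yc_def letter_def Rc_def Dc_def ob_rotate mor_rotate)
  then show ?thesis unfolding word_def by (simp add: seg_shift)
qed

text \<open>A differentiated composite splits by d(f_j f_{j+1}) = df_j f_{j+1} + f_j df_{j+1}; an
  undifferentiated one contributes two undifferentiated letters. \<open>K'\<close> is
  \<open>K\<close> in the numbering of the longer chain.\<close>

lemma word_face:
  fixes K :: "nat set"
  assumes c: "chain C (Suc n) c" and j: "j \<le> n"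
  defines "K' \<equiv> {i. (if i \<le> j then i else i - 1) \<in> K}"
  shows "word (face C j c) K 0 n =
    (if j \<in> K then word c K' 0 (Suc n) else word c (insert j K') 0 (Suc n) + word c (insert (Suc j)
      K') 0 (Suc n))"
proof -
  note l = chain_length[OF c]
  define \<sigma> where "\<sigma> i = (if i \<le> j then i else Suc i)" for i
  have YF: "Yc (face C j c) i = Yc c (\<sigma> i)" if "i \<le> Suc n" for i
    using that l j by (simp add: Yc_def \<sigma>_def ob_face)
  have RF: "Rc (face C j c) i = Rc c (\<sigma> i)" if "i \<le> n" "i \<noteq> j" for i
    using that l j by (auto simp: Rc_def \<sigma>_def ob_face mor_face)
  have RFj: "Rc (face C j c) j = DComp S (Yc c (j + 2)) (Yc c (j + 1)) (Yc c j) (Rc c j) (Rc c (j + 1))"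
    using l j rho_Comp[OF chain_ob[OF c] chain_ob[OF c] chain_ob[OF c] chain_mor[OF c] chain_mor[OF
      c], of j]
    by (simp add: Rc_def Yc_def ob_face mor_face)
  have DF: "Dc (face C j c) i = Dc c (\<sigma> i)" if "i \<le> n" "i \<noteq> j" for i
    using that RF[OF that] YF[of i] YF[of "Suc i"] by (auto simp: Dc_def \<sigma>_def)
  have DFj: "Dc (face C j c) j = DComp S (Yc c (j + 2)) (Yc c (j + 1)) (Yc c j) (Dc c j) (Rc c (j + 1))
      + DComp S (Yc c (j + 2)) (Yc c (j + 1)) (Yc c j) (Rc c j) (Dc c (j + 1))"
    using j YF[of j] YF[of "Suc j"]
      DDiff_Leibniz[OF Yc_DObj[OF c] Yc_DObj[OF c] Yc_DObj[OF c] Rc_DHom[OF c] Rc_DHom[OF c], of j]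
    by (simp add: Dc_def RFj \<sigma>_def scaleC_one)
  have merge: "word c L 0 (Suc n) = dseg (Yc (face C j c)) (\<lambda>i. if i = j
      then DComp S (Yc c (j + 2)) (Yc c (j + 1)) (Yc c j) (letter c L j) (letter c L (j + 1))
      else letter (face C j c) K i) 0 n"
    if L: "\<And>i. i \<noteq> j \<Longrightarrow> i \<le> n \<Longrightarrow> \<sigma> i \<in> L \<longleftrightarrow> i \<in> K" for L
  proof -
    have l: "letter (face C j c) K i = letter c L (\<sigma> i)" if "i \<noteq> j" "i \<le> n" for i
      using L[OF that] RF[of i] DF[of i] that by (simp add: letter_def)
    have "word c L 0 (Suc n) = dseg (\<lambda>i. Yc c (\<sigma> i)) (\<lambda>i. if i = j
      then DComp S (Yc c (j + 2)) (Yc c (j + 1)) (Yc c j) (letter c L j) (letter c L (j + 1))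
      else letter c L (\<sigma> i)) 0 n"
      using dseg_merge[OF letter_path[OF c, of L], where a=0 and j=j and k=n] j unfolding word_def
        \<sigma>_def by simp
    also have "\<dots> = dseg (Yc (face C j c)) (\<lambda>i. if i = j
      then DComp S (Yc c (j + 2)) (Yc c (j + 1)) (Yc c j) (letter c L j) (letter c L (j + 1))
      else letter (face C j c) K i) 0 n"
      by (rule seg_cong) (simp_all add: YF l)
    finally show ?thesis .
  qed
  show ?thesis
  proof (cases "j \<in> K")
    case True
    have "word (face C j c) K 0 n = dseg (Yc (face C j c)) (\<lambda>i. if i = j
      then DComp S (Yc c (j + 2)) (Yc c (j + 1)) (Yc c j) (letter c K' j) (letter c K' (j + 1))
      else letter (face C j c) K i) 0 n"
      unfolding word_def by (rule seg_cong) (use True RFj in \<open>auto simp: letter_def K'_def\<close>)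
    also have "\<dots> = word c K' 0 (Suc n)"
      by (rule merge[symmetric]) (auto simp: K'_def \<sigma>_def)
    finally show ?thesis using True by simp
  next
    case False
    define x where "x = DComp S (Yc c (j + 2)) (Yc c (j + 1)) (Yc c j) (Dc c j) (Rc c (j + 1))"
    define y where "y = DComp S (Yc c (j + 2)) (Yc c (j + 1)) (Yc c j) (Rc c j) (Dc c (j + 1))"
    have F: "chain C n (face C j c)" by (rule chain_face[OF c j])
    have x: "x \<in> DHom S 1 (Yc (face C j c) (Suc j)) (Yc (face C j c) j)"
      using DComp_DHom[OF Yc_DObj[OF c] Yc_DObj[OF c] Yc_DObj[OF c] Rc_DHom[OF c] Dc_DHom[OF c], of
        j] YF[of j] YF[of "Suc j"] j
      by (simp add: x_def \<sigma>_def)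
    have y: "y \<in> DHom S 1 (Yc (face C j c) (Suc j)) (Yc (face C j c) j)"
      using DComp_DHom[OF Yc_DObj[OF c] Yc_DObj[OF c] Yc_DObj[OF c] Dc_DHom[OF c] Rc_DHom[OF c], of
        j] YF[of j] YF[of "Suc j"] j
      by (simp add: y_def \<sigma>_def)
    have "word (face C j c) K 0 n = dseg (Yc (face C j c)) ((letter (face C j c) K)(j := 1 *\<^sub>C x +
      y)) 0 n"
      unfolding word_def by (rule seg_cong) (use False DFj in \<open>auto simp: letter_def x_def y_def
        scaleC_one\<close>)
    also have "\<dots> = 1 *\<^sub>C dseg (Yc (face C j c)) ((letter (face C j c) K)(j := x)) 0 n
        + dseg (Yc (face C j c)) ((letter (face C j c) K)(j := y)) 0 n"
    proof (rule dseg_linear)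
      show "dg_path (Yc (face C j c)) ((letter (face C j c) K)(j := x)) (\<lambda>i. if i \<in> K then 0 else 1)"
        using letter_path[OF F, of K] x False by (auto simp: dg_path_def)
    qed (use y False j in auto)
    also have "dseg (Yc (face C j c)) ((letter (face C j c) K)(j := x)) 0 n = word c (insert (Suc
      j) K') 0 (Suc n)"
      by (subst merge)
        (use False in \<open>auto intro!: seg_cong simp: K'_def \<sigma>_def x_def letter_def\<close>)
    also have "dseg (Yc (face C j c)) ((letter (face C j c) K)(j := y)) 0 n = word c (insert j K')
      0 (Suc n)"
      by (subst merge)
        (use False in \<open>auto intro!: seg_cong simp: K'_def \<sigma>_def y_def letter_def\<close>)
    finally show ?thesis using False by (simp add: scaleC_one add.commute)
  qed
qed

lemma word_face_0:
  assumes "chain C (Suc n) c" "0 < j" "j \<le> n"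
  shows "word (face C j c) {0} 0 n = word c {0, j} 0 (Suc n) + word c {0, Suc j} 0 (Suc n)"
proof -
  have "{i. (if i \<le> j then i else i - 1) \<in> {0}} = {0}" using assms by auto
  then show ?thesis using word_face[OF assms(1,3), of "{0}"] assms by (simp add: insert_commute)
qed

lemma word_first_face:
  assumes "chain C (Suc n) c"
  shows "word (face C 0 c) {0} 0 n = word c {0, 1} 0 (Suc n)"
proof -
  have "{i. (if i \<le> 0 then i else i - 1) \<in> {0}} = {0, 1::nat}" by auto
  then show ?thesis using word_face[OF assms, of 0 "{0}"] by simp
qed

text \<open>By \<open>word_face_0\<close>, the word with undifferentiated letters 0 and k + 1 is
  that of the k-th face minus the word with undifferentiated letters 0 and k. Iteration moves the
  second such letter leftwards until it is absorbed by the first.\<close>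

lemma word_two_undifferentiated:
  assumes c: "chain C (Suc n) c" and k: "k \<le> n"
  shows "word c {0, Suc k} 0 (Suc n) = (\<Sum>j\<le>k. (-1) ^ (k - j) *\<^sub>C word (face C j c) {0} 0 n)"
  using k
proof (induction k)
  case 0
  then show ?case using word_first_face[OF c] by (simp add: scaleC_one)
next
  case (Suc k)
  have "(\<Sum>j\<le>k. (-1) ^ (Suc k - j) *\<^sub>C word (face C j c) {0} 0 n)
      = (\<Sum>j\<le>k. (-1) *\<^sub>C (-1) ^ (k - j) *\<^sub>C word (face C j c) {0} 0 n)"
    by (intro sum.cong refl) (simp add: scaleC_scaleC Suc_diff_le)
  also have "\<dots> = - word c {0, Suc k} 0 (Suc n)"
    using Suc by (simp add: cvs.scale_minus_left scaleC_one sum_negf)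
  finally show ?case using word_face_0[OF c, of "Suc k"] Suc.prems by (simp add: scaleC_one)
qed

lemma word_linear:
  assumes c: "chain C n c" and i: "i \<le> n" and g: "g \<in> Hom C (ob c (Suc i)) (ob c i)"
  shows "word (c[i := (ob c i, a *\<^sub>C mor c i + g)]) K 0 n
    = a *\<^sub>C word c K 0 n + word (c[i := (ob c i, g)]) K 0 n"
proof -
  have il: "i < length c" using chain_length[OF c] i by simp
  define Lr where "Lr x = (if i \<in> K then rho (ob c (Suc i)) (ob c i) x
    else DDiff S (Yc c (Suc i)) (Yc c i) (rho (ob c (Suc i)) (ob c i) x))" for x
  have w: "word (c[i := (ob c i, x)]) K 0 n = dseg (Yc c) ((letter c K)(i := Lr x)) 0 n" for x
    unfolding word_def
    by (rule seg_cong)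
      (use il chain_length[OF c] in \<open>auto simp: Yc_def letter_def Rc_def Dc_def Lr_def ob_update
        mor_update\<close>)
  note lin = clinear_onD[OF rho_linear[OF chain_ob[OF c] chain_ob[OF c]]]
  have R: "rho (ob c (Suc i)) (ob c i) x \<in> DHom S 0 (Yc c (Suc i)) (Yc c i)"
    if "x \<in> Hom C (ob c (Suc i)) (ob c i)" for x
    using lin(1)[OF that] by (simp add: Yc_def)
  note dlin = clinear_onD[OF DDiff_linear[OF Yc_DObj[OF c] Yc_DObj[OF c]]]
  have m: "mor c i \<in> Hom C (ob c (Suc i)) (ob c i)" by (rule chain_mor[OF c])
  have am: "a *\<^sub>C mor c i \<in> Hom C (ob c (Suc i)) (ob c i)"
    using m Hom_subspace chain_ob[OF c] by (simp add: cvs.subspace_scale)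
  have L: "Lr (a *\<^sub>C mor c i + g) = a *\<^sub>C Lr (mor c i) + Lr g"
    using lin(2)[OF am g] lin(3)[OF m] dlin(2)[OF R[OF am] R[OF g]] dlin(3)[OF R[OF m]]
    by (auto simp: Lr_def)
  have LH: "Lr x \<in> DHom S (if i \<in> K then 0 else 1) (Yc c (Suc i)) (Yc c i)"
    if "x \<in> Hom C (ob c (Suc i)) (ob c i)" for x
    using R[OF that] dlin(1)[OF R[OF that]] by (auto simp: Lr_def)
  have "dseg (Yc c) ((letter c K)(i := Lr (mor c i))) 0 n = word c K 0 n"
    unfolding word_def by (rule seg_cong) (auto simp: letter_def Lr_def Rc_def Dc_def)
  moreover have "dg_path (Yc c) ((letter c K)(i := Lr (mor c i))) (\<lambda>i. if i \<in> K then 0 else 1)"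
    using letter_path[OF c, of K] LH[OF m] by (auto simp: dg_path_def)
  ultimately show ?thesis
    unfolding w L using dseg_linear[of "Yc c" "letter c K" i "Lr (mor c i)" "\<lambda>i. if i \<in> K then 0
      else 1" "Lr g" 0 n a] LH[OF g] i
    by simp
qed

definition word_cochain :: "nat \<Rightarrow> ('d \<Rightarrow> 's \<Rightarrow> complex) \<Rightarrow> ('o, 'm) cochain"
  where "word_cochain n T = (\<lambda>c. if chain C n c then T (Yc c 0) (word c {0} 0 n) else 0)"

lemma Yc_Suc: "chain C n c \<Longrightarrow> Yc c (Suc n) = Yc c 0"
  using ob_add_length(2)[of c 0] by (simp add: Yc_def chain_length)

lemma word_0_DHom: "chain C n c \<Longrightarrow> word c {0} 0 n \<in> DHom S n (Yc c 0) (Yc c 0)"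
proof -
  assume c: "chain C n c"
  have "{0..n} - {0} = {1..n}" by auto
  then show ?thesis using word_DHom[OF c, of "{0}" 0 n] Yc_Suc[OF c] by simp
qed

lemma word_cochain_CN:
  assumes T: "\<And>X. X \<in> DObj S \<Longrightarrow> clinear_on (DHom S n X X) UNIV (T X)"
  shows "word_cochain n T \<in> CN C n"
proof -
  have "T (Yc c 0) (word (c[i := (ob c i, a *\<^sub>C mor c i + g)]) {0} 0 n)
      = a * T (Yc c 0) (word c {0} 0 n) + T (Yc c 0) (word (c[i := (ob c i, g)]) {0} 0 n)"
    if c: "chain C n c" and i: "i \<le> n" and g: "g \<in> Hom C (ob c (Suc i)) (ob c i)" for c i g a
  proof -
    note lin = clinear_onD[OF T[OF Yc_DObj[OF c]]]
    have w: "word c {0} 0 n \<in> DHom S n (Yc c 0) (Yc c 0)" by (rule word_0_DHom[OF c])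
    have "Yc (c[i := (ob c i, g)]) 0 = Yc c 0"
      using i chain_length[OF c] by (simp add: Yc_def ob_update)
    then have wg: "word (c[i := (ob c i, g)]) {0} 0 n \<in> DHom S n (Yc c 0) (Yc c 0)"
      using word_0_DHom[OF chain_update[OF c i g]] by simp
    have "a *\<^sub>C word c {0} 0 n \<in> DHom S n (Yc c 0) (Yc c 0)"
      using w DHom_subspace Yc_DObj[OF c] by (simp add: cvs.subspace_scale)
    then show ?thesis
      using lin(2)[OF _ wg] lin(3)[OF w] by (simp add: word_linear[OF c i g] scaleC_complex_def)
  qed
  moreover have "a *\<^sub>C mor c i + g \<in> Hom C (ob c (Suc i)) (ob c i)"
    if "chain C n c" "g \<in> Hom C (ob c (Suc i)) (ob c i)" for c i g a
    using that Hom_subspace chain_ob chain_mor by (metis cvs.subspace_add cvs.subspace_scale)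
  moreover have "Yc (c[i := (ob c i, g)]) 0 = Yc c 0" if "chain C n c" "i \<le> n" for c i g
    using that chain_length[of C n c] by (simp add: Yc_def ob_update)
  ultimately show ?thesis
    by (auto simp: CN_def word_cochain_def chain_update)
qed

lemma cycle_character_eq_word_cochain: "cycle_character C n S T rho_ob rho = word_cochain n T"
proof
  fix c
  show "cycle_character C n S T rho_ob rho c = word_cochain n T c"
  proof (cases "chain C n c")
    case c: True
    have "(Yc c 0, Rc c 0) # map (\<lambda>i. (Yc c i, Dc c i)) [1..<Suc n] = map (\<lambda>i. (Yc c i, letter c
      {0} i)) [0..<0 + n + 1]"
      by (simp add: upt_conv_Cons letter_def del: upt_Suc)
    then have "path_comp (DComp S) (Yc c 0) ((Yc c 0, Rc c 0) # map (\<lambda>i. (Yc c i, Dc c i)) [1..<Suc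
      n]) = word c {0} 0 n"
      using path_comp_seg[of "DComp S" "Yc c" 0 n "letter c {0}"] Yc_Suc[OF c] by (simp add:
        word_def del: upt_Suc)
    then show ?thesis
      using c unfolding cycle_character_def word_cochain_def Yc_def Rc_def Dc_def Let_def by simp
  qed (simp add: cycle_character_def word_cochain_def)
qed

end

section \<open>The periodicity operator in terms of the character\<close>

lemma finite_omega_upto [simp]: "finite (omega_upto k)"
  by (simp add: omega_upto_def)

lemma in_omega_upto [simp]: "x \<in> omega_upto k \<longleftrightarrow> omega_degree x \<le> k"
  by (cases x) (auto simp: omega_upto_def)

lemma omega_mult_EDe_0:
  "omega_mult (EDe 0) b x = of_bool (x = EDe (omega_degree b))"
  by (cases b) auto

lemma omega_mult_De_1:
  "omega_mult (De 1) b (De q) = of_bool (Suc (omega_degree b) = q)"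
  "omega_mult (De 1) b (EDe q) = - of_bool (q \<noteq> 0 \<and> b = EDe (q - 1))"
  by (cases b; auto)+

context dg_semicategory
begin

lemma zero_DHom: "\<lbrakk>X \<in> DObj S; Y \<in> DObj S\<rbrakk> \<Longrightarrow> 0 \<in> DHom S n X Y"
  by (rule cvs.subspace_0[OF DHom_subspace])

lemma DComp_0:
  assumes "X \<in> DObj S" "Y \<in> DObj S" "Z \<in> DObj S"
  shows "f \<in> DHom S i X Y \<Longrightarrow> DComp S X Y Z 0 f = 0"
    and "g \<in> DHom S j Y Z \<Longrightarrow> DComp S X Y Z g 0 = 0"
  using clinear_on_0[OF DComp_linear_left DHom_subspace] clinear_on_0[OF DComp_linear_right
    DHom_subspace] assms
  by blast+

lemma tensor_diff_pure_tensor: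
  assumes "X \<in> DObj S" "Y \<in> DObj S"
  shows "tensor_diff S X Y (pure_tensor 0 a (EDe 0)) = (\<lambda>k x.
    if k = 1 \<and> x = EDe 0 then DDiff S X Y a else if k = 0 \<and> x = De 1 then a else 0)"
proof (intro ext)
  fix k x
  have s: "(\<Sum>b\<in>omega_upto (omega_degree x). omega_diff b x *\<^sub>C pure_tensor 0 a (EDe 0) k b)
      = (if k = 0 \<and> x = De 1 then a else 0)"
  proof -
    have "(\<Sum>b\<in>omega_upto (omega_degree x). omega_diff b x *\<^sub>C pure_tensor 0 a (EDe 0) k b)
        = (\<Sum>b\<in>omega_upto (omega_degree x). if b = EDe 0 then (if k = 0 \<and> x = De 1 then a else 0)
          else 0)"
      by (intro sum.cong refl) (auto simp: pure_tensor_def scaleC_one)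
    then show ?thesis by simp
  qed
  have "DDiff S X Y 0 = 0"
    using clinear_on_0[OF DDiff_linear DHom_subspace] assms by blast
  then show "tensor_diff S X Y (pure_tensor 0 a (EDe 0)) k x =
      (if k = 1 \<and> x = EDe 0 then DDiff S X Y a else if k = 0 \<and> x = De 1 then a else 0)"
    unfolding tensor_diff_def s by (cases k) (auto simp: pure_tensor_def scaleC_one)
qed

text \<open>The left factor has the shape of D(f \<otimes> e) = df \<otimes> e + f \<otimes> de,
  with only two nonzero components. The sign (-1)^k comes from moving de past a morphism of degree
  k, the negative contribution at \<open>EDe\<close> from (de) e = (1 - e) de.\<close>

lemma tensor_comp_left:
  assumes O: "X \<in> DObj S" "Y \<in> DObj S" "Z \<in> DObj S"
    and v: "\<And>k x. v k x \<in> DHom S k X Y"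
  shows "tensor_comp S X Y Z (\<lambda>k x. if k = 1 \<and> x = EDe 0 then d else if k = 0 \<and> x = De 1 then a
    else 0) v k x =
    (case x of
      EDe q \<Rightarrow> (if k = 0 then 0 else DComp S X Y Z d (v (k - 1) (De q)) + DComp S X Y Z d (v (k - 1)
        (EDe q)))
        - (if q = 0 then 0 else (-1) ^ k *\<^sub>C DComp S X Y Z a (v k (EDe (q - 1))))
    | De q \<Rightarrow> if q = 0 then 0 else
        (-1) ^ k *\<^sub>C (DComp S X Y Z a (v k (De (q - 1))) + DComp S X Y Z a (v k (EDe (q - 1)))))"
    (is "tensor_comp S X Y Z ?u v k x = ?rhs")
proof -
  let ?W = "omega_upto (omega_degree x)"
  define t where "t i b b' = ((-1) ^ (omega_degree b * (k - i)) * omega_mult b b' x) *\<^sub>C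
      DComp S X Y Z (?u i b) (v (k - i) b')" for i b b'
  have z: "t i b b' = 0" if "\<not> (i = 1 \<and> b = EDe 0)" "\<not> (i = 0 \<and> b = De 1)" for i b b'
    using that DComp_0(1)[OF O v] by (auto simp: t_def)
  have "tensor_comp S X Y Z ?u v k x = (\<Sum>i\<le>k. \<Sum>b\<in>?W. \<Sum>b'\<in>?W. t i b b')"
    by (simp add: tensor_comp_def t_def)
  also have "\<dots> = (\<Sum>i\<le>k. \<Sum>b\<in>?W. (if i = 1 then (if b = EDe 0 then \<Sum>b'\<in>?W. t 1 (EDe 0) b' else 0) else 0)
      + (if i = 0 then (if b = De 1 then \<Sum>b'\<in>?W. t 0 (De 1) b' else 0) else 0))"
    by (intro sum.cong refl) (auto simp: z)
  also have "\<dots> = (\<Sum>i\<le>k. (if i = 1 then (\<Sum>b'\<in>?W. t 1 (EDe 0) b') else 0)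
      + (if i = 0 then (if 1 \<le> omega_degree x then \<Sum>b'\<in>?W. t 0 (De 1) b' else 0) else 0))"
    by (intro sum.cong refl) (auto simp: sum.distrib)
  also have "\<dots> = (if 1 \<le> k then \<Sum>b'\<in>?W. t 1 (EDe 0) b' else 0)
      + (if 1 \<le> omega_degree x then \<Sum>b'\<in>?W. t 0 (De 1) b' else 0)"
    by (simp add: sum.distrib)
  also have "\<dots> = ?rhs"
  proof (cases x)
    case (EDe q)
    have "(\<Sum>b'\<in>?W. t 1 (EDe 0) b') = (\<Sum>b'\<in>{De q, EDe q}. DComp S X Y Z d (v (k - 1) b'))"
    proof (rule sum.mono_neutral_cong_right)
      show "\<forall>i\<in>?W - {De q, EDe q}. t 1 (EDe 0) i = 0"
      proof
        fix b assume "b \<in> ?W - {De q, EDe q}"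
        then show "t 1 (EDe 0) b = 0" using EDe by (cases b) (auto simp: t_def)
      qed
    qed (auto simp: EDe t_def scaleC_one)
    moreover have "(\<Sum>b'\<in>?W. t 0 (De 1) b') = (\<Sum>b'\<in>{EDe (q - 1)}. (- ((-1) ^ k)) *\<^sub>C DComp S X Y Z a
      (v k b'))" if "1 \<le> q"
    proof (rule sum.mono_neutral_cong_right)
      show "\<forall>i\<in>?W - {EDe (q - 1)}. t 0 (De 1) i = 0"
        using EDe by (auto simp: t_def omega_mult_De_1 omega_mult_De_1[simplified] simp del:
          omega_mult.simps)
    qed (use that in \<open>auto simp: EDe t_def omega_mult_De_1 omega_mult_De_1[simplified]
      cvs.scale_minus_left simp del: omega_mult.simps\<close>)
    ultimately show ?thesis by (auto simp: EDe)
  next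
    case (De q)
    have "(\<Sum>b'\<in>?W. t 1 (EDe 0) b') = 0"
      by (intro sum.neutral) (auto simp: De t_def omega_mult_EDe_0 simp del: omega_mult.simps)
    moreover have "(\<Sum>b'\<in>?W. t 0 (De 1) b') = (\<Sum>b'\<in>{De (q - 1), EDe (q - 1)}. (-1) ^ k *\<^sub>C DComp S X
      Y Z a (v k b'))" if "1 \<le> q"
    proof (rule sum.mono_neutral_cong_right)
      show "\<forall>i\<in>?W - {De (q - 1), EDe (q - 1)}. t 0 (De 1) i = 0"
      proof
        fix b assume "b \<in> ?W - {De (q - 1), EDe (q - 1)}"
        then show "t 0 (De 1) b = 0" using De
          by (cases b) (auto simp: t_def omega_mult_De_1 omega_mult_De_1[simplified] simp del:
            omega_mult.simps)
      qed
    qed (use that in \<open>auto simp: De t_def omega_mult_De_1 omega_mult_De_1[simplified] simp del: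
      omega_mult.simps\<close>)
    ultimately show ?thesis by (auto simp: De scaleC_add_right)
  qed
  finally show ?thesis .
qed

text \<open>Since \<open>e (de) e = 0\<close>, the two factors \<open>de\<close> of a term of degree 2 in
  \<open>e \<cdot> D a_a \<cdots> D a_{a+k}\<close> are adjacent.\<close>

lemma tensor_seg:
  fixes Y :: "nat \<Rightarrow> 'd" and f :: "nat \<Rightarrow> 's"
  assumes p: "dg_path Y f (\<lambda>_. 0)"
  defines "d \<equiv> \<lambda>i. DDiff S (Y (Suc i)) (Y i) (f i)"
  defines "w \<equiv> \<lambda>K. dseg Y (\<lambda>i. if i \<in> K then f i else d i)"
  defines "U \<equiv> seg (tensor_comp S) Y (\<lambda>i. tensor_diff S (Y (Suc i)) (Y i) (pure_tensor 0 (f i) (EDe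
    0)))"
  shows "U a l k x \<in> DHom S k (Y (a + l + 1)) (Y a) \<and> U a l k (De 0) = 0 \<and>
    U a l k (EDe 0) = (if k = Suc l then w {} a l else 0) \<and>
    U a l k (De 1) = (if k = l then (-1) ^ l *\<^sub>C w {a} a l else 0) \<and>
    U a l k (EDe 2) + U a l k (De 2) = (if Suc k = l then \<Sum>i\<in>{a..<a + l}. w {i, Suc i} a l else 0)"
proof (induction l arbitrary: a k x)
  case 0
  have Y: "Y i \<in> DObj S" for i using p by (simp add: dg_path_def)
  have f: "f i \<in> DHom S 0 (Y (Suc i)) (Y i)" for i using p by (simp add: dg_path_def)
  have d: "d i \<in> DHom S 1 (Y (Suc i)) (Y i)" for i
    using DDiff_DHom[OF Y Y f] by (simp add: d_def)
  have "U a 0 = (\<lambda>k x. if k = 1 \<and> x = EDe 0 then d a else if k = 0 \<and> x = De 1 then f a else 0)"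
    unfolding U_def d_def by (simp add: tensor_diff_pure_tensor[OF Y Y])
  then show ?case using d f zero_DHom[OF Y Y] by (auto simp: w_def scaleC_one)
next
  case (Suc l)
  have Y: "Y i \<in> DObj S" for i using p by (simp add: dg_path_def)
  have f: "f i \<in> DHom S 0 (Y (Suc i)) (Y i)" for i using p by (simp add: dg_path_def)
  have d: "d i \<in> DHom S 1 (Y (Suc i)) (Y i)" for i
    using DDiff_DHom[OF Y Y f] by (simp add: d_def)
  have p': "dg_path Y (\<lambda>i. if i \<in> K then f i else d i) (\<lambda>i. if i \<in> K then 0 else 1)" for K
    using Y f d by (simp add: dg_path_def)
  define v where "v = U (Suc a) l"
  have v: "v k x \<in> DHom S k (Y (Suc a + l + 1)) (Y (Suc a))" for k x
    unfolding v_def using Suc.IH[of "Suc a"] by blast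
  have v0: "v k (De 0) = 0" "v k (EDe 0) = (if k = Suc l then w {} (Suc a) l else 0)"
    "v k (De 1) = (if k = l then (-1) ^ l *\<^sub>C w {Suc a} (Suc a) l else 0)"
    "v k (EDe 2) + v k (De 2) = (if Suc k = l then \<Sum>i\<in>{Suc a..<Suc a + l}. w {i, Suc i} (Suc a) l
      else 0)" for k
    unfolding v_def using Suc.IH[of "Suc a"] by blast+
  let ?c = "DComp S (Y (Suc a + l + 1)) (Y (Suc a)) (Y a)"
  note Fl = clinear_onD[OF DComp_linear_right[OF Y Y Y f]]
  note Dl = clinear_onD[OF DComp_linear_right[OF Y Y Y d]]
  have UU: "U a (Suc l) k x = (case x of
      EDe q \<Rightarrow> (if k = 0 then 0 else ?c (d a) (v (k - 1) (De q)) + ?c (d a) (v (k - 1) (EDe q)))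
        - (if q = 0 then 0 else (-1) ^ k *\<^sub>C ?c (f a) (v k (EDe (q - 1))))
    | De q \<Rightarrow> if q = 0 then 0 else
        (-1) ^ k *\<^sub>C (?c (f a) (v k (De (q - 1))) + ?c (f a) (v k (EDe (q - 1)))))" for k x
  proof -
    have "U a (Suc l) = tensor_comp S (Y (Suc a + l + 1)) (Y (Suc a)) (Y a)
        (\<lambda>k x. if k = 1 \<and> x = EDe 0 then d a else if k = 0 \<and> x = De 1 then f a else 0) v"
      unfolding U_def v_def d_def by (simp add: tensor_diff_pure_tensor[OF Y Y])
    then show ?thesis using tensor_comp_left[OF Y Y Y v] by simp
  qed
  have fc: "?c (f a) y \<in> DHom S k (Y (Suc a + l + 1)) (Y a)"
    if "y \<in> DHom S k (Y (Suc a + l + 1)) (Y (Suc a))" for y k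
    using DComp_DHom[OF Y Y Y that f] by simp
  have dc: "?c (d a) y \<in> DHom S k (Y (Suc a + l + 1)) (Y a)"
    if "y \<in> DHom S (k - 1) (Y (Suc a + l + 1)) (Y (Suc a))" "k \<noteq> 0" for y k
    using DComp_DHom[OF Y Y Y that(1) d] that(2) by simp
  have in_DHom: "U a (Suc l) k x \<in> DHom S k (Y (Suc a + l + 1)) (Y a)"
    unfolding UU using fc[OF v] dc[OF v] zero_DHom[OF Y Y] DHom_subspace[OF Y Y]
    by (cases x) (auto simp: cvs.subspace_add cvs.subspace_diff cvs.subspace_scale)
  have w0: "w K a (Suc l) = ?c (if a \<in> K then f a else d a) (w K (Suc a) l)" for K
    by (simp add: w_def)
  have wH: "w K (Suc a) l \<in> DHom S (\<Sum>i=Suc a..Suc a + l. if i \<in> K then 0 else 1) (Y (Suc a + l +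
    1)) (Y (Suc a))" for K
    unfolding w_def by (rule dseg_DHom[OF p'])
  have w_eq: "w K (Suc a) l = w K' (Suc a) l" if "\<And>i. Suc a \<le> i \<Longrightarrow> i \<in> K \<longleftrightarrow> i \<in> K'" for K K'
    unfolding w_def by (rule seg_cong) (simp_all add: that)
  have c0: "?c (f a) 0 = 0" "?c (d a) 0 = 0"
    using DComp_0(2)[OF Y Y Y f] DComp_0(2)[OF Y Y Y d] by simp_all
  have sq: "(-1) ^ l *\<^sub>C (-1) ^ l *\<^sub>C y = y" for y :: 's
    by (simp add: scaleC_scaleC scaleC_one flip: power_add)
  have e1: "U a (Suc l) k (EDe 0) = (if k = Suc (Suc l) then w {} a (Suc l) else 0)"
    by (auto simp: UU v0(1,2) c0[simplified] w0)
  have e2: "U a (Suc l) k (De 1) = (if k = Suc l then (-1) ^ Suc l *\<^sub>C w {a} a (Suc l) else 0)"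
    using w_eq[of "{a}" "{}"] by (auto simp: UU v0(1,2) c0[simplified] w0)
  \<comment> \<open>The two components are added because left multiplication by e sends both basis
    elements to e (de)^2. In the sum the terms with \<open>v k (EDe 1)\<close> cancel, which
    reflects e (de) e = 0.\<close>
  have "U a (Suc l) k (EDe 2) + U a (Suc l) k (De 2)
      = (if k = 0 then 0 else ?c (d a) (v (k - 1) (EDe 2) + v (k - 1) (De 2))) + (-1) ^ k *\<^sub>C ?c (f
        a) (v k (De 1))"
    by (simp add: UU Dl(2)[OF v v, simplified] scaleC_add_right add.commute)
  also have "?c (f a) (v k (De 1)) = (if k = l then (-1) ^ l *\<^sub>C w {a, Suc a} a (Suc l) else 0)"
    using Fl(3)[OF wH, of "(-1) ^ l"] w_eq[of "{Suc a}" "{a, Suc a}"] by (simp add: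
      v0(3)[simplified] c0[simplified] w0)
  also have "(if k = 0 then 0 else ?c (d a) (v (k - 1) (EDe 2) + v (k - 1) (De 2)))
      = (if k = l then \<Sum>i\<in>{Suc a..<Suc a + l}. w {i, Suc i} a (Suc l) else 0)"
  proof -
    have s: "cvs.subspace (DHom S (l - 1) (Y (Suc a + l + 1)) (Y (Suc a)))"
      by (rule DHom_subspace[OF Y Y])
    have "w {i, Suc i} (Suc a) l \<in> DHom S (l - 1) (Y (Suc a + l + 1)) (Y (Suc a))" if "i \<in> {Suc
      a..<Suc a + l}" for i
    proof -
      have "(\<Sum>j=Suc a..Suc a + l. if j \<in> {i, Suc i} then 0 else 1) = card ({Suc a..Suc a + l} - {i,
        Suc i})"
        by (subst sum.mono_neutral_cong_right[of _ "{Suc a..Suc a + l} - {i, Suc i}" _ "\<lambda>_. 1"]) auto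
      also have "\<dots> = l - 1" using that by (subst card_Diff_subset) auto
      finally show ?thesis using wH[of "{i, Suc i}"] by simp
    qed
    then have "?c (d a) (\<Sum>i\<in>{Suc a..<Suc a + l}. w {i, Suc i} (Suc a) l)
        = (\<Sum>i\<in>{Suc a..<Suc a + l}. ?c (d a) (w {i, Suc i} (Suc a) l))"
      by (rule clinear_on_sum[OF DComp_linear_right[OF Y Y Y d] s])
    also have "\<dots> = (\<Sum>i\<in>{Suc a..<Suc a + l}. w {i, Suc i} a (Suc l))"
      by (intro sum.cong) (auto simp: w0)
    finally show ?thesis by (auto simp: v0(4) c0[simplified])
  qed
  also have "(if k = l then \<Sum>i\<in>{Suc a..<Suc a + l}. w {i, Suc i} a (Suc l) else 0)
      + (-1) ^ k *\<^sub>C (if k = l then (-1) ^ l *\<^sub>C w {a, Suc a} a (Suc l) else 0)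
      = (if Suc k = Suc l then \<Sum>i\<in>{a..<a + Suc l}. w {i, Suc i} a (Suc l) else 0)"
    by (simp add: sq sum.atLeast_Suc_lessThan add.commute)
  finally show ?case using in_DHom e1 e2 by (simp add: UU)
qed

end

context dg_over
begin

text \<open>The trace sees bidegree (r, 2) only: two of the r + 2 later factors supply de, the
  others a differentiated letter. By \<open>tensor_seg\<close> the two are adjacent, at positions i
  and i + 1, and every surviving term has sign +1.\<close>

lemma cup_psi0_eq_words:
  assumes c: "chain C (r + 2) c"
    and T: "clinear_on (DHom S r (Yc c 0) (Yc c 0)) UNIV (T (Yc c 0))"
  shows "cup_psi0 C r S T rho_ob rho c = (\<Sum>i=1..r + 1. T (Yc c 0) (word c {0, i, Suc i} 0 (r + 2)))"
proof -
  let ?D = "\<lambda>i. tensor_diff S (Yc c (Suc i)) (Yc c i) (pure_tensor 0 (Rc c i) (EDe 0))"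
  define Z where "Z i = (if i = 0 then pure_tensor 0 (Rc c 0) (EDe 0) else ?D i)" for i
  define U where "U = seg (tensor_comp S) (Yc c) ?D 1 (r + 1)"
  note Y = Yc_DObj[OF c]
  have p: "dg_path (Yc c) (Rc c) (\<lambda>_. 0)" using Y Rc_DHom[OF c] by (simp add: dg_path_def)
  have YL: "Yc c (r + 3) = Yc c 0" using Yc_Suc[OF c] by (simp add: eval_nat_numeral)
  have w: "word c {i, Suc i} 1 (r + 1) = dseg (Yc c) (\<lambda>j. if j \<in> {i, Suc i} then Rc c j
      else DDiff S (Yc c (Suc j)) (Yc c j) (Rc c j)) 1 (r + 1)" for i
    unfolding word_def letter_def Dc_def ..
  have UH: "U k x \<in> DHom S k (Yc c 0) (Yc c 1)" for k x
    using tensor_seg[OF p, of 1 "r + 1" k x] YL unfolding U_def by (simp add: eval_nat_numeral)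
  have U2: "U r (EDe 2) + U r (De 2) = (\<Sum>i=1..r + 1. word c {i, Suc i} 1 (r + 1))"
    using tensor_seg[OF p, of 1 "r + 1" r] unfolding U_def w by (simp add:
      atLeastLessThanSuc_atLeastAtMost)
  let ?c = "DComp S (Yc c 0) (Yc c 1) (Yc c 0) (Rc c 0)"
  have "(Yc c 0, pure_tensor 0 (Rc c 0) (EDe 0)) # map (\<lambda>i. (Yc c i, ?D i)) [1..<r + 3]
      = map (\<lambda>i. (Yc c i, Z i)) [0..<0 + (r + 2) + 1]"
    by (simp add: upt_conv_Cons Z_def eval_nat_numeral del: upt_Suc)
  then have "path_comp (tensor_comp S) (Yc c 0)
      ((Yc c 0, pure_tensor 0 (Rc c 0) (EDe 0)) # map (\<lambda>i. (Yc c i, ?D i)) [1..<r + 3])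
      = seg (tensor_comp S) (Yc c) Z 0 (r + 2)"
    using path_comp_seg[of "tensor_comp S" "Yc c" 0 "r + 2" Z] YL by (simp add: eval_nat_numeral
      del: upt_Suc)
  also have "\<dots> = tensor_comp S (Yc c 0) (Yc c 1) (Yc c 0) (pure_tensor 0 (Rc c 0) (EDe 0)) U"
  proof -
    have "seg (tensor_comp S) (Yc c) Z 1 (r + 1) = U"
      unfolding U_def by (rule seg_cong) (auto simp: Z_def)
    then show ?thesis using YL by (simp add: Z_def eval_nat_numeral)
  qed
  finally have "cup_psi0 C r S T rho_ob rho c
      = tensor_trace r T (Yc c 0) (tensor_comp S (Yc c 0) (Yc c 1) (Yc c 0) (pure_tensor 0 (Rc c 0)
        (EDe 0)) U)"
    using c unfolding cup_psi0_def Let_def Yc_def Rc_def by simp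
  also have "\<dots> = T (Yc c 0) (tensor_comp S (Yc c 0) (Yc c 1) (Yc c 0) (pure_tensor 0 (Rc c 0) (EDe
    0)) U r (EDe 2))"
  proof -
    have "{b. omega_degree b = 2} = {EDe 2, De 2}"
    proof (intro set_eqI)
      fix b show "b \<in> {b. omega_degree b = 2} \<longleftrightarrow> b \<in> {EDe 2, De 2}" by (cases b) auto
    qed
    then show ?thesis by (simp add: tensor_trace_def)
  qed
  also have "tensor_comp S (Yc c 0) (Yc c 1) (Yc c 0) (pure_tensor 0 (Rc c 0) (EDe 0)) U r (EDe 2)
      = ?c (U r (EDe 2) + U r (De 2))"
  proof -
    define t where "t i b b' = ((-1) ^ (omega_degree b * (r - i)) * omega_mult b b' (EDe 2)) *\<^sub>C
        DComp S (Yc c 0) (Yc c 1) (Yc c 0) (pure_tensor 0 (Rc c 0) (EDe 0) i b) (U (r - i) b')" for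
          i b b'
    have z: "t i b b' = 0" if "\<not> (i = 0 \<and> b = EDe 0)" for i b b'
      using that DComp_0(1)[OF Y Y Y UH] by (auto simp: t_def pure_tensor_def)
    have "tensor_comp S (Yc c 0) (Yc c 1) (Yc c 0) (pure_tensor 0 (Rc c 0) (EDe 0)) U r (EDe 2)
        = (\<Sum>i\<le>r. \<Sum>b\<in>omega_upto 2. \<Sum>b'\<in>omega_upto 2. t i b b')"
      by (simp add: tensor_comp_def t_def)
    also have "\<dots> = (\<Sum>i\<le>r. \<Sum>b\<in>omega_upto 2. if i = 0 then (if b = EDe 0 then \<Sum>b'\<in>omega_upto 2. t 0
      (EDe 0) b' else 0) else 0)"
      by (intro sum.cong refl) (auto simp: z)
    also have "\<dots> = (\<Sum>i\<le>r. if i = 0 then \<Sum>b'\<in>omega_upto 2. t 0 (EDe 0) b' else 0)"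
      by (intro sum.cong refl) auto
    also have "\<dots> = (\<Sum>b'\<in>omega_upto 2. t 0 (EDe 0) b')" by simp
    also have "\<dots> = (\<Sum>b'\<in>{EDe 2, De 2}. ?c (U r b'))"
    proof (rule sum.mono_neutral_cong_right)
      show "\<forall>i\<in>omega_upto 2 - {EDe 2, De 2}. t 0 (EDe 0) i = 0"
      proof
        fix b assume "b \<in> omega_upto 2 - {EDe 2, De 2}"
        then show "t 0 (EDe 0) b = 0" by (cases b) (auto simp: t_def)
      qed
    qed (auto simp: t_def pure_tensor_def scaleC_one)
    also have "\<dots> = ?c (U r (EDe 2) + U r (De 2))"
      using clinear_onD(2)[OF DComp_linear_right[OF Y Y Y Rc_DHom[OF c, of 0, folded One_nat_def]]
        UH UH] by simp
    finally show ?thesis .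
  qed
  also have "\<dots> = ?c (\<Sum>i=1..r + 1. word c {i, Suc i} 1 (r + 1))" by (simp only: U2)
  also have "\<dots> = (\<Sum>i=1..r + 1. word c {0, i, Suc i} 0 (r + 2))"
  proof -
    have H: "word c {i, Suc i} 1 (r + 1) \<in> DHom S r (Yc c 0) (Yc c 1)" if "i \<in> {1..r + 1}" for i
    proof -
      have "card ({1..1 + (r + 1)} - {i, Suc i}) = r" using that by (subst card_Diff_subset) auto
      then show ?thesis using word_DHom[OF c, of "{i, Suc i}" 1 "r + 1"] YL by (simp add:
        eval_nat_numeral)
    qed
    have s: "cvs.subspace (DHom S r (Yc c 0) (Yc c 1))" by (rule DHom_subspace[OF Y Y])
    have "?c (\<Sum>i=1..r + 1. word c {i, Suc i} 1 (r + 1)) = (\<Sum>i=1..r + 1. ?c (word c {i, Suc i} 1 (r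
      + 1)))"
      by (rule clinear_on_sum[OF DComp_linear_right[OF Y Y Y Rc_DHom[OF c, of 0, folded
        One_nat_def]] s H]) auto
    also have "\<dots> = (\<Sum>i=1..r + 1. word c {0, i, Suc i} 0 (r + 2))"
    proof (intro sum.cong refl)
      fix i assume "i \<in> {1..r + 1}"
      then have "word c {i, Suc i} 1 (r + 1) = word c {0, i, Suc i} 1 (r + 1)"
        by (intro word_cong) auto
      then show "?c (word c {i, Suc i} 1 (r + 1)) = word c {0, i, Suc i} 0 (r + 2)"
        using YL by (simp add: word_def letter_def eval_nat_numeral)
    qed
    finally show ?thesis .
  qed
  also have "T (Yc c 0) \<dots> = (\<Sum>i=1..r + 1. T (Yc c 0) (word c {0, i, Suc i} 0 (r + 2)))"
  proof (rule clinear_on_sum[OF T DHom_subspace[OF Y Y]])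
    fix i assume "i \<in> {1..r + 1}"
    then have "card ({0..0 + (r + 2)} - {0, i, Suc i}) = r" by (subst card_Diff_subset) auto
    then show "word c {0, i, Suc i} 0 (r + 2) \<in> DHom S r (Yc c 0) (Yc c 0)"
      using word_DHom[OF c, of "{0, i, Suc i}" 0 "r + 2"] YL by (simp add: eval_nat_numeral)
  qed
  finally show ?thesis .
qed

text \<open>The adjacent pair i, i + 1 is a composite in the i-th face, where letters 0 and i are
  then undifferentiated; \<open>word_two_undifferentiated\<close> expresses this word by faces of
  that face. Only character values on double faces remain, so the product depends on the cycle
  through its character alone.\<close>

theorem cup_psi0_eq_S_cochain:
  assumes T: "\<And>X. X \<in> DObj S \<Longrightarrow> clinear_on (DHom S r X X) UNIV (T X)"
  shows "cup_psi0 C r S T rho_ob rho = S_cochain C r (word_cochain r T)"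
proof
  fix c
  show "cup_psi0 C r S T rho_ob rho c = S_cochain C r (word_cochain r T) c"
  proof (cases "chain C (r + 2) c")
    case True
    then have c: "chain C (Suc (Suc r)) c" by simp
    note Y = Yc_DObj[OF c]
    have "T (Yc c 0) (word c {0, i, Suc i} 0 (r + 2))
        = (\<Sum>j<i. (-1) ^ (i - 1 - j) * word_cochain r T (face C j (face C i c)))"
      if i: "i \<in> {1..r + 1}" for i
    proof -
      obtain k where k: "i = Suc k" "k \<le> r" using i by (cases i) auto
      have F: "chain C (Suc r) (face C i c)" using chain_face[OF c, of i] i by simp
      have YF: "Yc (face C i c) 0 = Yc c 0"
        using i chain_length[OF c] by (simp add: Yc_def ob_face)
      have YFF: "Yc (face C j (face C i c)) 0 = Yc c 0" "chain C r (face C j (face C i c))" if "j \<le>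
        k" for j
        using that k chain_face[OF F, of j] chain_length[OF F] YF by (auto simp: Yc_def ob_face)
      have "{l. (if l \<le> i then l else l - 1) \<in> {0, i}} = {0, i, Suc i}" using i by auto
      then have "word c {0, i, Suc i} 0 (r + 2) = word (face C i c) {0, i} 0 (Suc r)"
        using word_face[OF c, of i "{0, i}"] i by simp
      also have "\<dots> = (\<Sum>j\<le>k. (-1) ^ (k - j) *\<^sub>C word (face C j (face C i c)) {0} 0 r)"
        using word_two_undifferentiated[OF F k(2)] k(1) by simp
      also have "T (Yc c 0) \<dots> = (\<Sum>j\<le>k. T (Yc c 0) ((-1) ^ (k - j) *\<^sub>C word (face C j (face C i c))
        {0} 0 r))"
        using word_0_DHom[OF YFF(2)] YFF(1) DHom_subspace[OF Y Y]
        by (intro clinear_on_sum[OF T[OF Y] DHom_subspace[OF Y Y]]) (auto intro!: cvs.subspace_scale)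
      also have "\<dots> = (\<Sum>j\<le>k. (-1) ^ (k - j) * T (Yc c 0) (word (face C j (face C i c)) {0} 0 r))"
        using word_0_DHom[OF YFF(2)] YFF(1)
        by (intro sum.cong refl) (simp add: clinear_onD(3)[OF T[OF Y]] scaleC_complex_def)
      finally show ?thesis
        using YFF k by (simp add: word_cochain_def lessThan_Suc_atMost)
    qed
    then show ?thesis
      using True cup_psi0_eq_words[OF True, of T] T[OF Y[of 0]] by (simp add: S_cochain_def)
  qed (simp add: cup_psi0_def S_cochain_def)
qed

end

section \<open>Orthonormal expansions\<close>

context complex_hilbert_space
begin

lemma cinner_add_left: "cinner (x + y) z = cinner x z + cinner y z"
  by (metis cinner_commute cinner_add_right complex_cnj_add)

lemma cinner_scaleC_left: "cinner (a *\<^sub>C x) y = cnj a * cinner x y"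
  by (metis cinner_commute cinner_scaleC_right complex_cnj_mult)

lemma cinner_zero_right [simp]: "cinner x 0 = 0"
  using cinner_add_right[of x 0 0] by simp

lemma cinner_zero_left [simp]: "cinner 0 x = 0"
  using cinner_add_left[of 0 0 x] by simp

lemma cinner_diff_right: "cinner x (y - z) = cinner x y - cinner x z"
  using cinner_add_right[of x "y - z" z] by simp

lemma cinner_diff_left: "cinner (x - y) z = cinner x z - cinner y z"
  using cinner_add_left[of "x - y" y z] by simp

lemma cinner_sum_right: "cinner x (\<Sum>i\<in>I. f i) = (\<Sum>i\<in>I. cinner x (f i))"
  by (induction I rule: infinite_finite_induct) (simp_all add: cinner_add_right)

lemma cinner_sum_left: "cinner (\<Sum>i\<in>I. f i) x = (\<Sum>i\<in>I. cinner (f i) x)"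
  by (induction I rule: infinite_finite_induct) (simp_all add: cinner_add_left)

lemma cinner_self: "cinner x x = complex_of_real ((norm x)\<^sup>2)"
proof -
  have "Im (cinner x x) = 0" using cinner_commute[of x x] by (metis Reals_cnj_iff complex_is_Real_iff)
  moreover have "0 \<le> sqrt (Re (cinner x x))" using norm_eq_sqrt_cinner[of x] norm_ge_zero[of x] by simp
  then have "Re (cinner x x) = (norm x)\<^sup>2" using norm_eq_sqrt_cinner[of x] by simp
  ultimately show ?thesis by (simp add: complex_eq_iff)
qed

lemma norm_scaleC: "norm (a *\<^sub>C x) = cmod a * norm x"
proof -
  have "complex_of_real ((norm (a *\<^sub>C x))\<^sup>2) = complex_of_real ((cmod a * norm x)\<^sup>2)"
    unfolding cinner_self[symmetric] cinner_scaleC_left cinner_scaleC_right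
    by (simp add: cinner_self complex_norm_square power_mult_distrib mult.assoc flip: of_real_power)
  then have "(norm (a *\<^sub>C x))\<^sup>2 = (cmod a * norm x)\<^sup>2" by (simp only: of_real_eq_iff)
  then show ?thesis by (rule power2_eq_imp_eq) simp_all
qed

lemma cinner_Cauchy_Schwarz: "cmod (cinner x y) \<le> norm x * norm y"
proof (cases "norm x = 0")
  case True
  then show ?thesis by simp
next
  case False
  define a where "a = cinner x y / complex_of_real ((norm x)\<^sup>2)"
  have "complex_of_real ((norm (y - a *\<^sub>C x))\<^sup>2)
      = cinner y y - a * cinner y x - cnj a * cinner x y + cnj a * a * cinner x x"
    unfolding cinner_self[symmetric]
    by (simp add: cinner_diff_left cinner_diff_right cinner_scaleC_left cinner_scaleC_right
      algebra_simps)
  also have "\<dots> = complex_of_real ((norm y)\<^sup>2 - (cmod (cinner x y))\<^sup>2 / (norm x)\<^sup>2)"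
    using False complex_norm_square[of "cinner x y"] unfolding cinner_commute[of y x] cinner_self a_def
    by (simp add: field_simps power2_eq_square)
  finally have "0 \<le> (norm y)\<^sup>2 - (cmod (cinner x y))\<^sup>2 / (norm x)\<^sup>2"
    by (metis of_real_eq_iff zero_le_power2)
  then have "(cmod (cinner x y))\<^sup>2 \<le> (norm x * norm y)\<^sup>2"
    using False by (simp add: field_simps power_mult_distrib)
  then show ?thesis by (rule power2_le_imp_le) simp
qed

end

lemma orthonormal_onD:
  "\<lbrakk>orthonormal_on I e; i \<in> I; j \<in> I\<rbrakk> \<Longrightarrow> cinner (e i) (e j) = (if i = j then 1 else 0)"
  by (simp add: orthonormal_on_def)

lemma orthonormal_on_subset: "\<lbrakk>orthonormal_on I e; J \<subseteq> I\<rbrakk> \<Longrightarrow> orthonormal_on J e"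
  by (simp add: orthonormal_on_def subset_iff)

lemma orthonormal_norm: "\<lbrakk>orthonormal_on I e; i \<in> I\<rbrakk> \<Longrightarrow> norm (e i) = 1"
  using orthonormal_onD[of I e i i] by (simp add: norm_eq_sqrt_cinner)

lemma cinner_orthonormal_sum:
  assumes "orthonormal_on F e" "finite F" "j \<in> F"
  shows "cinner (e j) (\<Sum>i\<in>F. c i *\<^sub>C e i) = c j"
proof -
  have "cinner (e j) (\<Sum>i\<in>F. c i *\<^sub>C e i) = (\<Sum>i\<in>F. if i = j then c i else 0)"
    unfolding cinner_sum_right
    by (intro sum.cong refl) (use assms in \<open>simp add: cinner_scaleC_right orthonormal_onD\<close>)
  then show ?thesis using assms by simp
qed

lemma norm_orthonormal_sum:
  assumes "orthonormal_on F e" "finite F"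
  shows "(norm (\<Sum>i\<in>F. c i *\<^sub>C e i))\<^sup>2 = (\<Sum>i\<in>F. (cmod (c i))\<^sup>2)"
proof -
  have "complex_of_real ((norm (\<Sum>i\<in>F. c i *\<^sub>C e i))\<^sup>2) = (\<Sum>j\<in>F. cnj (c j) * c j)"
    unfolding cinner_self[symmetric] cinner_sum_left cinner_scaleC_left
    by (intro sum.cong refl) (simp add: cinner_orthonormal_sum[OF assms])
  also have "\<dots> = complex_of_real (\<Sum>i\<in>F. (cmod (c i))\<^sup>2)"
    unfolding of_real_sum complex_norm_square by (intro sum.cong refl) (simp add: mult.commute)
  finally show ?thesis by (simp only: of_real_eq_iff)
qed

text \<open>Pythagoras: the residual of the Fourier sum is orthogonal to the span, so other
  coefficients add an orthogonal error. The choice c = 0 yields Bessel's inequality, general c best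
  approximation.\<close>

lemma norm_orthonormal_residual:
  assumes "orthonormal_on F e" "finite F"
  shows "(norm (x - (\<Sum>i\<in>F. c i *\<^sub>C e i)))\<^sup>2
    = (norm (x - (\<Sum>i\<in>F. cinner (e i) x *\<^sub>C e i)))\<^sup>2 + (\<Sum>i\<in>F. (cmod (cinner (e i) x - c i))\<^sup>2)"
proof -
  define y where "y = x - (\<Sum>i\<in>F. cinner (e i) x *\<^sub>C e i)"
  define z where "z = (\<Sum>i\<in>F. (cinner (e i) x - c i) *\<^sub>C e i)"
  have "cinner (e j) y = 0" if "j \<in> F" for j
    using cinner_orthonormal_sum[OF assms that] by (simp add: y_def cinner_diff_right)
  then have zy: "cinner z y = 0" by (simp add: z_def cinner_sum_left cinner_scaleC_left)
  have yz: "cinner y z = 0" using cinner_commute[of y z] zy by simp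
  have "x - (\<Sum>i\<in>F. c i *\<^sub>C e i) = y + z"
    by (simp add: y_def z_def cvs.scale_left_diff_distrib sum_subtractf)
  moreover have "complex_of_real ((norm (y + z))\<^sup>2) = complex_of_real ((norm y)\<^sup>2 + (norm z)\<^sup>2)"
    unfolding of_real_add cinner_self[symmetric] by (simp add: cinner_add_left cinner_add_right zy yz)
  ultimately show ?thesis
    using norm_orthonormal_sum[OF assms, of "\<lambda>i. cinner (e i) x - c i"]
    by (simp only: of_real_eq_iff flip: y_def z_def)
qed

lemma Bessel:
  assumes "orthonormal_on F e" "finite F"
  shows "(\<Sum>i\<in>F. (cmod (cinner (e i) x))\<^sup>2) \<le> (norm x)\<^sup>2"
proof -
  define s where "s = (norm (x - (\<Sum>i\<in>F. cinner (e i) x *\<^sub>C e i)))\<^sup>2"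
  have "0 \<le> s" by (simp add: s_def)
  moreover have "(norm x)\<^sup>2 = s + (\<Sum>i\<in>F. (cmod (cinner (e i) x))\<^sup>2)"
    using norm_orthonormal_residual[OF assms, of x "\<lambda>_. 0"]
    by (simp only: s_def cvs.scale_zero_left sum.neutral_const diff_zero)
  ultimately show ?thesis by simp
qed

lemma orthonormal_best_approximation:
  assumes "orthonormal_on F e" "finite F"
  shows "norm (x - (\<Sum>i\<in>F. cinner (e i) x *\<^sub>C e i)) \<le> norm (x - (\<Sum>i\<in>F. c i *\<^sub>C e i))"
proof (rule power2_le_imp_le)
  have "0 \<le> (\<Sum>i\<in>F. (cmod (cinner (e i) x - c i))\<^sup>2)" by (simp add: sum_nonneg)
  then show "(norm (x - (\<Sum>i\<in>F. cinner (e i) x *\<^sub>C e i)))\<^sup>2 \<le> (norm (x - (\<Sum>i\<in>F. c i *\<^sub>C e i)))\<^sup>2"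
    using norm_orthonormal_residual[OF assms, of x c] by linarith
qed simp

lemma span_finite_sum:
  assumes "y \<in> cvs.span B"
  obtains F c where "finite F" "F \<subseteq> B" "y = (\<Sum>e\<in>F. c e *\<^sub>C e)"
  using assms unfolding cvs.span_explicit by blast

text \<open>Some finite combination of basis vectors lies within \<epsilon> of x. For every finite
  set containing its support, the partial Fourier sum is at least as close to x.\<close>

lemma onb_expansion:
  assumes B: "is_orthonormal_basis U B" and x: "x \<in> U"
  shows "((\<lambda>e. cinner e x *\<^sub>C e) has_sum x) B"
  unfolding has_sum_def tendsto_iff
proof (intro allI impI)
  fix \<epsilon> :: real assume \<epsilon>: "\<epsilon> > 0"
  have on: "orthonormal_on B (\<lambda>e. e)" using B by (simp add: is_orthonormal_basis_def)
  have "x \<in> closure (cvs.span B)" using B x by (auto simp: is_orthonormal_basis_def)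
  then obtain y where y: "y \<in> cvs.span B" "dist y x < \<epsilon>"
    using \<epsilon> by (auto simp: closure_approachable)
  obtain F c where F: "finite F" "F \<subseteq> B" "y = (\<Sum>e\<in>F. c e *\<^sub>C e)"
    by (rule span_finite_sum[OF y(1)])
  have "dist (\<Sum>e\<in>G. cinner e x *\<^sub>C e) x < \<epsilon>" if G: "finite G" "F \<subseteq> G" "G \<subseteq> B" for G
  proof -
    have "y = (\<Sum>e\<in>G. (if e \<in> F then c e else 0) *\<^sub>C e)"
      unfolding F(3) by (rule sum.mono_neutral_cong_left) (use G in auto)
    then have "norm (x - (\<Sum>e\<in>G. cinner e x *\<^sub>C e)) \<le> norm (x - y)"
      using orthonormal_best_approximation[OF orthonormal_on_subset[OF on G(3)] G(1), of x] by simp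
    then show ?thesis using y(2) by (simp add: dist_norm norm_minus_commute)
  qed
  then show "\<forall>\<^sub>F G in finite_subsets_at_top B. dist (\<Sum>e\<in>G. cinner e x *\<^sub>C e) x < \<epsilon>"
    unfolding eventually_finite_subsets_at_top using F by blast
qed

text \<open>The normalised residual of x is adjoined unless it vanishes. Counting at most one new
  vector per step lets an orthonormal frame of a range obey the same rank bound as the given
  spanning set.\<close>

lemma Gram_Schmidt_step:
  assumes U: "cvs.subspace U" and B: "finite B" "B \<subseteq> U" "orthonormal_on B (\<lambda>e. e)" and x: "x \<in> U"
  shows "\<exists>B'. finite B' \<and> B' \<subseteq> U \<and> orthonormal_on B' (\<lambda>e. e) \<and> B \<subseteq> B' \<and> x \<in> cvs.span B' \<and> card B' \<le>
    Suc (card B)"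
proof -
  define s where "s = (\<Sum>e\<in>B. cinner e x *\<^sub>C e)"
  define y where "y = x - s"
  have s: "s \<in> cvs.span B" unfolding s_def by (intro cvs.span_sum cvs.span_scale cvs.span_base)
  show ?thesis
  proof (cases "y = 0")
    case True
    then have "x \<in> cvs.span B" using s by (simp add: y_def)
    then show ?thesis using B by (intro exI[of _ B]) auto
  next
    case False
    define u where "u = complex_of_real (inverse (norm y)) *\<^sub>C y"
    have orth: "cinner e y = 0" if "e \<in> B" for e
      using cinner_orthonormal_sum[OF B(3,1) that, of "\<lambda>e. cinner e x"] by (simp add: y_def s_def
        cinner_diff_right)
    have uB: "cinner e u = 0" "cinner u e = 0" if "e \<in> B" for e
      using orth[OF that] cinner_commute[of u e] by (simp_all add: u_def cinner_scaleC_right)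
    have "norm u = 1"
      using False unfolding u_def norm_scaleC norm_of_real by simp
    then have uu: "cinner u u = 1" by (simp add: cinner_self)
    have "s \<in> U" using s B(2) U by (meson cvs.span_minimal subsetD)
    then have "u \<in> U" using U x by (simp add: u_def y_def cvs.subspace_diff cvs.subspace_scale)
    moreover have "x = s + complex_of_real (norm y) *\<^sub>C u"
      using False by (simp add: u_def scaleC_scaleC scaleC_one y_def)
    moreover have "s \<in> cvs.span (insert u B)" using s cvs.span_mono[of B "insert u B"] by auto
    moreover have "complex_of_real (norm y) *\<^sub>C u \<in> cvs.span (insert u B)"
      by (intro cvs.span_scale cvs.span_base) simp
    ultimately have "u \<in> U" "x \<in> cvs.span (insert u B)" by (auto intro: cvs.span_add)
    moreover have "orthonormal_on (insert u B) (\<lambda>e. e)"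
      using B(3) uB uu unfolding orthonormal_on_def by auto
    moreover have "card (insert u B) \<le> Suc (card B)" using B(1) by (simp add: card_insert_if)
    ultimately show ?thesis using B by (intro exI[of _ "insert u B"]) auto
  qed
qed

lemma Gram_Schmidt_finite:
  assumes U: "cvs.subspace U" and S: "finite S" "S \<subseteq> U"
  shows "\<exists>B. finite B \<and> B \<subseteq> U \<and> orthonormal_on B (\<lambda>e. e) \<and> S \<subseteq> cvs.span B \<and> card B \<le> card S"
  using S
proof (induction S rule: finite_induct)
  case empty
  then show ?case by (intro exI[of _ "{}"]) (simp add: orthonormal_on_def)
next
  case (insert x S)
  then obtain B where B: "finite B" "B \<subseteq> U" "orthonormal_on B (\<lambda>e. e)" "S \<subseteq> cvs.span B" "card B \<le>
    card S"
    by auto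
  obtain B' where B': "finite B'" "B' \<subseteq> U" "orthonormal_on B' (\<lambda>e. e)" "B \<subseteq> B'" "x \<in> cvs.span B'"
    "card B' \<le> Suc (card B)"
    using Gram_Schmidt_step[OF U B(1,2,3), of x] insert.prems by auto
  have "insert x S \<subseteq> cvs.span B'" using B(4) B'(5) cvs.span_mono[OF B'(4)] by auto
  then show ?case using B B' insert.hyps by (intro exI[of _ B']) auto
qed

text \<open>Gram-Schmidt along a countable dense sequence; the union of the increasing finite stages
  has dense span. Existence matters because \<open>op_trace\<close> obtains its basis by
  choice.\<close>

lemma separable_onb_exists:
  assumes U: "cvs.subspace U" and sep: "separable_space (top_of_set U)"
  shows "\<exists>B. is_orthonormal_basis U B"
proof -
  obtain D where D: "countable D" "D \<subseteq> U" "top_of_set U closure_of D = U"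
    using sep by (auto simp: separable_space_def)
  have UD: "U \<subseteq> closure D"
    using D(3) closure_mono[of "U \<inter> D" D] unfolding closure_of_subtopology by auto
  have "D \<noteq> {}" using UD cvs.subspace_0[OF U] by auto
  define x where "x = from_nat_into D"
  have xU: "x n \<in> U" for n using from_nat_into[OF \<open>D \<noteq> {}\<close>] D(2) by (auto simp: x_def)
  have Dx: "D = range x" using range_from_nat_into[OF \<open>D \<noteq> {}\<close> D(1)] by (simp add: x_def)
  define P where "P (n::nat) B \<longleftrightarrow> finite B \<and> B \<subseteq> U \<and> orthonormal_on B (\<lambda>e. e)" for n and B :: "'a set"
  have "\<exists>f. \<forall>n. P n (f n) \<and> (f n \<subseteq> f (Suc n) \<and> x n \<in> cvs.span (f (Suc n)))"
  proof (rule dependent_nat_choice)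
    show "\<exists>B. P 0 B" by (intro exI[of _ "{}"]) (simp add: P_def orthonormal_on_def)
    fix B n assume "P n B"
    then show "\<exists>B'. P (Suc n) B' \<and> (B \<subseteq> B' \<and> x n \<in> cvs.span B')"
      using Gram_Schmidt_step[OF U _ _ _ xU, of B n] by (auto simp: P_def)
  qed
  then obtain f where f: "\<And>n. P n (f n)" "\<And>n. f n \<subseteq> f (Suc n)" "\<And>n. x n \<in> cvs.span (f (Suc n))"
    by blast
  define B where "B = (\<Union>n. f n)"
  have mono: "f m \<subseteq> f n" if "m \<le> n" for m n using f(2) that by (rule lift_Suc_mono_le)
  have "orthonormal_on B (\<lambda>e. e)"
    unfolding orthonormal_on_def
  proof (intro ballI)
    fix e e' assume "e \<in> B" "e' \<in> B"
    then obtain m n where "e \<in> f m" "e' \<in> f n" by (auto simp: B_def)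
    then have "e \<in> f (max m n)" "e' \<in> f (max m n)" using mono[of m "max m n"] mono[of n "max m n"]
      by auto
    then show "cinner e e' = (if e = e' then 1 else 0)"
      using f(1)[of "max m n"] by (auto simp: P_def orthonormal_on_def)
  qed
  moreover have "B \<subseteq> U" using f(1) by (auto simp: B_def P_def)
  moreover have "D \<subseteq> cvs.span B"
    unfolding Dx using f(3) cvs.span_mono[of "f (Suc _)" B] by (auto simp: B_def)
  then have "U \<subseteq> closure (cvs.span B)" using UD closure_mono by blast
  ultimately show ?thesis by (auto simp: is_orthonormal_basis_def)
qed

section \<open>The trace\<close>

definition onb :: "'h::complex_hilbert_space set \<Rightarrow> 'h set"
  where "onb U = (SOME B. is_orthonormal_basis U B)"

definition onb_space :: "'h::complex_hilbert_space set \<Rightarrow> bool"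
  where "onb_space U \<longleftrightarrow> cvs.subspace U \<and> is_orthonormal_basis U (onb U)"

lemma onb_spaceI:
  "\<lbrakk>cvs.subspace U; separable_space (top_of_set U)\<rbrakk> \<Longrightarrow> onb_space U"
  unfolding onb_space_def onb_def using separable_onb_exists someI_ex by metis

lemma onb_space_subspace: "onb_space U \<Longrightarrow> cvs.subspace U"
  by (simp add: onb_space_def)

lemma onb_subset: "onb_space U \<Longrightarrow> onb U \<subseteq> U"
  by (simp add: onb_space_def is_orthonormal_basis_def)

lemma onb_orthonormal: "onb_space U \<Longrightarrow> orthonormal_on (onb U) (\<lambda>e. e)"
  by (simp add: onb_space_def is_orthonormal_basis_def)

lemma op_trace_onb: "op_trace U A = (\<Sum>\<^sub>\<infinity>e\<in>onb U. cinner e (A e))"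
  by (simp add: op_trace_def onb_def)

text \<open>Absolute summability along the one basis that \<open>op_trace\<close> uses. This is
  weaker than being trace class, but it suffices for additivity of the trace.\<close>

definition trace_summable :: "'h::complex_hilbert_space set \<Rightarrow> ('h \<Rightarrow> 'h) \<Rightarrow> bool"
  where "trace_summable U A \<longleftrightarrow> (\<lambda>e. norm (cinner e (A e))) summable_on onb U"

lemma op_trace_cong:
  assumes "onb_space U" "\<And>x. x \<in> U \<Longrightarrow> A x = B x"
  shows "op_trace U A = op_trace U B"
  unfolding op_trace_onb using assms onb_subset[of U] by (intro infsum_cong) auto

lemma
  assumes "trace_summable U A" "trace_summable U B"
  shows trace_summable_add: "trace_summable U (\<lambda>x. A x + B x)"
    and op_trace_add: "op_trace U (\<lambda>x. A x + B x) = op_trace U A + op_trace U B"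
proof -
  show "trace_summable U (\<lambda>x. A x + B x)"
    using summable_on_add[OF assms[unfolded trace_summable_def]]
    unfolding trace_summable_def cinner_add_right
    by (rule summable_on_comparison_test) (simp_all add: norm_triangle_ineq)
  show "op_trace U (\<lambda>x. A x + B x) = op_trace U A + op_trace U B"
    unfolding op_trace_onb cinner_add_right
    by (rule infsum_add; rule Infinite_Sum.abs_summable_summable)
      (use assms in \<open>simp_all add: trace_summable_def\<close>)
qed

lemma trace_summable_scale:
  assumes "trace_summable U A"
  shows "trace_summable U (\<lambda>x. a *\<^sub>C A x)"
  using summable_on_cmult_right[OF assms[unfolded trace_summable_def], of "cmod a"]
  by (simp only: trace_summable_def cinner_scaleC_right norm_mult)

lemma op_trace_scale: "op_trace U (\<lambda>x. a *\<^sub>C A x) = a * op_trace U A"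
  by (simp only: op_trace_onb cinner_scaleC_right infsum_cmult_right')

lemma op_trace_diff:
  assumes "trace_summable U A" "trace_summable U B"
  shows "op_trace U (\<lambda>x. A x - B x) = op_trace U A - op_trace U B"
  using op_trace_add[OF assms(1) trace_summable_scale[OF assms(2), of "-1"]] op_trace_scale[of U "-1" B]
  by (simp add: cvs.scale_minus_left scaleC_one)

lemma op_trace_sum:
  assumes "\<And>h. h \<in> H \<Longrightarrow> trace_summable U (A h)"
  shows "op_trace U (\<lambda>x. \<Sum>h\<in>H. A h x) = (\<Sum>h\<in>H. op_trace U (A h))"
proof -
  have "trace_summable U (\<lambda>x. \<Sum>h\<in>H. A h x) \<and>
      op_trace U (\<lambda>x. \<Sum>h\<in>H. A h x) = (\<Sum>h\<in>H. op_trace U (A h))"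
    using assms
  proof (induction H rule: infinite_finite_induct)
    case (insert h H)
    then have "trace_summable U (\<lambda>x. \<Sum>h\<in>H. A h x)" "trace_summable U (A h)"
      "op_trace U (\<lambda>x. \<Sum>h\<in>H. A h x) = (\<Sum>h\<in>H. op_trace U (A h))" by auto
    then show ?case
      using insert.hyps trace_summable_add[of U "A h" "\<lambda>x. \<Sum>h\<in>H. A h x"]
        op_trace_add[of U "A h" "\<lambda>x. \<Sum>h\<in>H. A h x"] by simp
  qed (auto simp: trace_summable_def op_trace_onb)
  then show ?thesis by blast
qed

lemma trace_summableI_bound:
  assumes "\<And>F. finite F \<Longrightarrow> F \<subseteq> onb U \<Longrightarrow> (\<Sum>e\<in>F. cmod (cinner e (A e))) \<le> c"
  shows "trace_summable U A" and "cmod (op_trace U A) \<le> c"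
proof -
  show s: "trace_summable U A"
    unfolding trace_summable_def
    by (rule nonneg_bdd_above_summable_on) (use assms in \<open>auto intro!: bdd_aboveI[of _ c]\<close>)
  have "cmod (op_trace U A) \<le> (\<Sum>\<^sub>\<infinity>e\<in>onb U. cmod (cinner e (A e)))"
    unfolding op_trace_onb by (rule norm_infsum_bound) (use s in \<open>simp add: trace_summable_def\<close>)
  also have "\<dots> \<le> c"
    by (rule infsum_le_finite_sums) (use s assms in \<open>simp_all add: trace_summable_def\<close>)
  finally show "cmod (op_trace U A) \<le> c" .
qed

section \<open>Bounded operators and operators of finite rank\<close>

lemma bounded_clinear_onD:
  assumes "bounded_clinear_on U V T"
  shows "x \<in> U \<Longrightarrow> T x \<in> V"
    and "\<lbrakk>x \<in> U; y \<in> U\<rbrakk> \<Longrightarrow> T (x + y) = T x + T y"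
    and "x \<in> U \<Longrightarrow> T (a *\<^sub>C x) = a *\<^sub>C T x"
  using assms by (auto simp: bounded_clinear_on_def clinear_on_def)

lemma bounded_clinear_on_bound:
  assumes "bounded_clinear_on U V T"
  obtains K where "K \<ge> 0" "\<And>x. x \<in> U \<Longrightarrow> norm (T x) \<le> K * norm x"
proof -
  obtain K where K: "\<And>x. x \<in> U \<Longrightarrow> norm (T x) \<le> K * norm x"
    using assms by (auto simp: bounded_clinear_on_def)
  have "norm (T x) \<le> max K 0 * norm x" if "x \<in> U" for x
    using K[OF that] mult_right_mono[of K "max K 0" "norm x"] by simp
  then show ?thesis by (intro that[of "max K 0"]) auto
qed

lemma bounded_clinear_onI:
  assumes "\<And>x. x \<in> U \<Longrightarrow> T x \<in> V" "\<And>x y. \<lbrakk>x \<in> U; y \<in> U\<rbrakk> \<Longrightarrow> T (x + y) = T x + T y"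
    "\<And>a x. x \<in> U \<Longrightarrow> T (a *\<^sub>C x) = a *\<^sub>C T x" "\<And>x. x \<in> U \<Longrightarrow> norm (T x) \<le> K * norm x"
  shows "bounded_clinear_on U V T"
  unfolding bounded_clinear_on_def clinear_on_def using assms by blast

lemma bounded_clinear_on_clinear: "bounded_clinear_on U V T \<Longrightarrow> clinear_on U V T"
  by (simp add: bounded_clinear_on_def)

lemma bounded_clinear_on_cong:
  "\<lbrakk>cvs.subspace U; \<And>x. x \<in> U \<Longrightarrow> T x = T' x\<rbrakk> \<Longrightarrow> bounded_clinear_on U V T \<longleftrightarrow> bounded_clinear_on U V T'"
  by (simp add: bounded_clinear_on_def clinear_on_def cvs.subspace_add cvs.subspace_scale)

lemma bounded_clinear_on_comp:
  assumes B: "bounded_clinear_on V W B" and A: "bounded_clinear_on U V A"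
  shows "bounded_clinear_on U W (\<lambda>x. B (A x))"
proof -
  obtain K where K: "K \<ge> 0" "\<And>x. x \<in> V \<Longrightarrow> norm (B x) \<le> K * norm x"
    using bounded_clinear_on_bound[OF B] by blast
  obtain L where L: "L \<ge> 0" "\<And>x. x \<in> U \<Longrightarrow> norm (A x) \<le> L * norm x"
    using bounded_clinear_on_bound[OF A] by blast
  have "norm (B (A x)) \<le> K * L * norm x" if "x \<in> U" for x
    using K(2)[OF bounded_clinear_onD(1)[OF A that]] mult_left_mono[OF L(2)[OF that] K(1)] by simp
  then show ?thesis
    by (intro bounded_clinear_onI[where K="K * L"])
      (simp_all add: bounded_clinear_onD[OF A] bounded_clinear_onD[OF B])
qed

lemma bounded_clinear_on_add:
  assumes V: "cvs.subspace V" and A: "bounded_clinear_on U V A" and B: "bounded_clinear_on U V B"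
  shows "bounded_clinear_on U V (\<lambda>x. A x + B x)"
proof -
  obtain K where K: "K \<ge> 0" "\<And>x. x \<in> U \<Longrightarrow> norm (A x) \<le> K * norm x"
    using bounded_clinear_on_bound[OF A] by blast
  obtain L where L: "L \<ge> 0" "\<And>x. x \<in> U \<Longrightarrow> norm (B x) \<le> L * norm x"
    using bounded_clinear_on_bound[OF B] by blast
  have "norm (A x + B x) \<le> (K + L) * norm x" if "x \<in> U" for x
    using norm_triangle_mono[OF K(2)[OF that] L(2)[OF that]] by (simp add: distrib_right)
  then show ?thesis
    by (intro bounded_clinear_onI[where K="K + L"])
      (simp_all add: bounded_clinear_onD[OF A] bounded_clinear_onD[OF B] cvs.subspace_add[OF V]
        scaleC_add_right add_ac)
qed

lemma bounded_clinear_on_scale: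
  assumes V: "cvs.subspace V" and A: "bounded_clinear_on U V A"
  shows "bounded_clinear_on U V (\<lambda>x. a *\<^sub>C A x)"
proof -
  obtain K where K: "K \<ge> 0" "\<And>x. x \<in> U \<Longrightarrow> norm (A x) \<le> K * norm x"
    using bounded_clinear_on_bound[OF A] by blast
  have "norm (a *\<^sub>C A x) \<le> (cmod a * K) * norm x" if "x \<in> U" for x
    using mult_left_mono[OF K(2)[OF that], of "cmod a"] by (simp add: norm_scaleC mult.assoc)
  then show ?thesis
    by (intro bounded_clinear_onI[where K="cmod a * K"])
      (simp_all add: bounded_clinear_onD[OF A] cvs.subspace_scale[OF V]
        scaleC_add_right scaleC_scaleC mult.commute)
qed

lemma bounded_clinear_on_diff:
  assumes "cvs.subspace V" "bounded_clinear_on U V A" "bounded_clinear_on U V B"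
  shows "bounded_clinear_on U V (\<lambda>x. A x - B x)"
  using bounded_clinear_on_add[OF assms(1,2) bounded_clinear_on_scale[OF assms(1,3), of "-1"]]
  by (simp add: cvs.scale_minus_left scaleC_one)

definition finite_rank ::
    "'h::complex_hilbert_space set \<Rightarrow> 'k::complex_hilbert_space set \<Rightarrow> nat \<Rightarrow> ('h \<Rightarrow> 'k) \<Rightarrow> bool"
  where "finite_rank U V r R \<longleftrightarrow> bounded_clinear_on U V R \<and>
    (\<exists>S. finite S \<and> S \<subseteq> V \<and> card S \<le> r \<and> (\<forall>x\<in>U. R x \<in> cvs.span S))"

lemma finite_rank_bounded: "finite_rank U V r R \<Longrightarrow> bounded_clinear_on U V R"
  by (simp add: finite_rank_def)

lemma finite_rank_frame:
  assumes V: "cvs.subspace V" and R: "finite_rank U V r R"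
  obtains H where "finite H" "H \<subseteq> V" "orthonormal_on H (\<lambda>h. h)" "card H \<le> r"
    "\<And>x. x \<in> U \<Longrightarrow> R x = (\<Sum>h\<in>H. cinner h (R x) *\<^sub>C h)"
proof -
  obtain S where S: "finite S" "S \<subseteq> V" "card S \<le> r" "\<forall>x\<in>U. R x \<in> cvs.span S"
    using R by (auto simp: finite_rank_def)
  obtain H where H: "finite H" "H \<subseteq> V" "orthonormal_on H (\<lambda>h. h)" "S \<subseteq> cvs.span H" "card H \<le> card S"
    using Gram_Schmidt_finite[OF V S(1,2)] by auto
  have "R x = (\<Sum>h\<in>H. cinner h (R x) *\<^sub>C h)" if "x \<in> U" for x
  proof -
    have "R x \<in> cvs.span H" using S(4) that H(4) by (meson cvs.span_minimal cvs.subspace_span subsetD)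
    then obtain c where c: "R x = (\<Sum>h\<in>H. c h *\<^sub>C h)"
      using cvs.span_finite[OF H(1)] by auto
    have "cinner h (R x) = c h" if "h \<in> H" for h
      unfolding c by (rule cinner_orthonormal_sum[OF H(3,1) that])
    then show ?thesis using c by simp
  qed
  then show ?thesis using H S(3) by (intro that[of H]) auto
qed

lemma finite_rank_add:
  assumes V: "cvs.subspace V" and A: "finite_rank U V r A" and B: "finite_rank U V s B"
  shows "finite_rank U V (r + s) (\<lambda>x. A x + B x)"
proof -
  obtain S where S: "finite S" "S \<subseteq> V" "card S \<le> r" "\<forall>x\<in>U. A x \<in> cvs.span S"
    using A by (auto simp: finite_rank_def)
  obtain S' where S': "finite S'" "S' \<subseteq> V" "card S' \<le> s" "\<forall>x\<in>U. B x \<in> cvs.span S'"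
    using B by (auto simp: finite_rank_def)
  have "A x + B x \<in> cvs.span (S \<union> S')" if "x \<in> U" for x
    using S(4) S'(4) that cvs.span_mono[of S "S \<union> S'"] cvs.span_mono[of S' "S \<union> S'"]
    by (intro cvs.span_add) auto
  moreover have "card (S \<union> S') \<le> r + s" using card_Un_le[of S S'] S(3) S'(3) by simp
  ultimately show ?thesis
    unfolding finite_rank_def using S S' bounded_clinear_on_add[OF V] A B
    by (intro conjI exI[of _ "S \<union> S'"]) (auto simp: finite_rank_def)
qed

lemma finite_rank_scale:
  assumes V: "cvs.subspace V" and A: "finite_rank U V r A"
  shows "finite_rank U V r (\<lambda>x. a *\<^sub>C A x)"
proof -
  obtain S where S: "finite S" "S \<subseteq> V" "card S \<le> r" "\<forall>x\<in>U. A x \<in> cvs.span S"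
    using A by (auto simp: finite_rank_def)
  then have "\<forall>x\<in>U. a *\<^sub>C A x \<in> cvs.span S" by (simp add: cvs.span_scale)
  then show ?thesis
    using S bounded_clinear_on_scale[OF V finite_rank_bounded[OF A]] unfolding finite_rank_def by blast
qed

lemma finite_rank_diff:
  assumes "cvs.subspace V" "finite_rank U V r A" "finite_rank U V s B"
  shows "finite_rank U V (r + s) (\<lambda>x. A x - B x)"
  using finite_rank_add[OF assms(1,2) finite_rank_scale[OF assms(1,3), of "-1"]]
  by (simp add: cvs.scale_minus_left scaleC_one)

lemma finite_rank_comp_right:
  assumes A: "finite_rank V W r A" and B: "bounded_clinear_on U V B"
  shows "finite_rank U W r (\<lambda>x. A (B x))"
proof -
  obtain S where S: "finite S" "S \<subseteq> W" "card S \<le> r" "\<forall>x\<in>V. A x \<in> cvs.span S"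
    using A by (auto simp: finite_rank_def)
  then have "\<forall>x\<in>U. A (B x) \<in> cvs.span S" using bounded_clinear_onD(1)[OF B] by simp
  then show ?thesis
    using S bounded_clinear_on_comp[OF finite_rank_bounded[OF A] B] unfolding finite_rank_def by blast
qed

lemma finite_rank_comp_left:
  assumes V: "cvs.subspace V" and B: "bounded_clinear_on V W B" and A: "finite_rank U V r A"
  shows "finite_rank U W r (\<lambda>x. B (A x))"
proof -
  obtain H where H: "finite H" "H \<subseteq> V" "card H \<le> r"
    "\<And>x. x \<in> U \<Longrightarrow> A x = (\<Sum>h\<in>H. cinner h (A x) *\<^sub>C h)"
    by (rule finite_rank_frame[OF V A]) (rule that)
  have "B (A x) \<in> cvs.span (B ` H)" if "x \<in> U" for x
  proof -
    have "B (A x) = B (\<Sum>h\<in>H. cinner h (A x) *\<^sub>C h)"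
      by (rule arg_cong[OF H(4)[OF that]])
    also have "\<dots> = (\<Sum>h\<in>H. B (cinner h (A x) *\<^sub>C h))"
      using H(2) by (intro clinear_on_sum[OF bounded_clinear_on_clinear[OF B] V]) (auto intro:
        cvs.subspace_scale[OF V])
    also have "\<dots> = (\<Sum>h\<in>H. cinner h (A x) *\<^sub>C B h)"
      using H(2) by (intro sum.cong refl bounded_clinear_onD(3)[OF B]) auto
    also have "\<dots> \<in> cvs.span (B ` H)" by (intro cvs.span_sum cvs.span_scale cvs.span_base) auto
    finally show ?thesis .
  qed
  moreover have "card (B ` H) \<le> r" using card_image_le[OF H(1), of B] H(3) by simp
  moreover have "B ` H \<subseteq> W" using H(2) bounded_clinear_onD(1)[OF B] by auto
  ultimately show ?thesis
    using H(1) bounded_clinear_on_comp[OF B finite_rank_bounded[OF A]] unfolding finite_rank_def by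
      blast
qed

text \<open>For a unit vector \<open>h\<close> the sum of the \<open>|\<langle>h, R e\<rangle> \<langle>e, h\<rangle>|\<close> is the value of \<open>\<langle>h, R \<cdot>\<rangle>\<close>
  on a vector of norm at most 1.\<close>

lemma finite_rank_trace_bound:
  assumes U: "cvs.subspace U" and R: "finite_rank U U r R"
    and c: "\<And>x. x \<in> U \<Longrightarrow> norm (R x) \<le> c * norm x" "0 \<le> c"
    and F: "finite F" "F \<subseteq> U" "orthonormal_on F (\<lambda>e. e)"
  shows "(\<Sum>e\<in>F. cmod (cinner e (R e))) \<le> real r * c"
proof -
  obtain H where H: "finite H" "H \<subseteq> U" "orthonormal_on H (\<lambda>h. h)" "card H \<le> r"
    "\<And>x. x \<in> U \<Longrightarrow> R x = (\<Sum>h\<in>H. cinner h (R x) *\<^sub>C h)"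
    by (rule finite_rank_frame[OF U R]) (rule that)
  note Rl = bounded_clinear_on_clinear[OF finite_rank_bounded[OF R]]
  have h: "(\<Sum>e\<in>F. cmod (cinner h (R e)) * cmod (cinner e h)) \<le> c" if "h \<in> H" for h
  proof -
    have n1: "norm h = 1" by (rule orthonormal_norm[OF H(3) that])
    \<comment> \<open>The phases are chosen so that the terms of \<open>cinner h (R y)\<close>
      become nonnegative and add up to the sum to be bounded.\<close>
    define a where "a e = complex_of_real (cmod (cinner e h)) * cnj (sgn (cinner h (R e)))" for e
    define y where "y = (\<Sum>e\<in>F. a e *\<^sub>C e)"
    have ca: "cmod (a e) \<le> cmod (cinner e h)" for e
      by (auto simp: a_def norm_mult norm_sgn)
    have yU: "y \<in> U" unfolding y_def using F(2) by (intro cvs.subspace_sum[OF U]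
      cvs.subspace_scale[OF U]) auto
    have "(norm y)\<^sup>2 = (\<Sum>e\<in>F. (cmod (a e))\<^sup>2)"
      unfolding y_def by (rule norm_orthonormal_sum[OF F(3,1)])
    also have "\<dots> \<le> (\<Sum>e\<in>F. (cmod (cinner e h))\<^sup>2)" by (intro sum_mono power_mono ca) simp
    also have "\<dots> \<le> (norm h)\<^sup>2" by (rule Bessel[OF F(3,1)])
    finally have y1: "norm y \<le> 1" using n1 by (simp add: power_le_one_iff abs_square_le_1)
    have sg: "cnj (sgn z) * z = complex_of_real (cmod z)" for z
      by (cases "z = 0") (simp_all add: sgn_div_norm scaleR_conv_of_real field_simps
        complex_norm_square[symmetric] power2_eq_square[of "complex_of_real _", symmetric] flip:
          of_real_power)
    have "R y = (\<Sum>e\<in>F. R (a e *\<^sub>C e))"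
      unfolding y_def using F(2) by (intro clinear_on_sum[OF Rl U] cvs.subspace_scale[OF U]) auto
    also have "\<dots> = (\<Sum>e\<in>F. a e *\<^sub>C R e)"
      using F(2) by (intro sum.cong refl clinear_onD(3)[OF Rl]) auto
    finally have "cinner h (R y) = (\<Sum>e\<in>F. a e * cinner h (R e))"
      by (simp add: cinner_sum_right cinner_scaleC_right)
    also have "\<dots> = complex_of_real (\<Sum>e\<in>F. cmod (cinner h (R e)) * cmod (cinner e h))"
      unfolding of_real_sum a_def by (intro sum.cong refl) (simp add: sg sg[unfolded
        mult.commute[of "cnj _"]] mult.assoc mult.commute)
    finally have eq: "cinner h (R y) = complex_of_real (\<Sum>e\<in>F. cmod (cinner h (R e)) * cmod (cinner
      e h))" .
    have "(\<Sum>e\<in>F. cmod (cinner h (R e)) * cmod (cinner e h)) = cmod (cinner h (R y))"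
      unfolding eq norm_of_real by (simp add: sum_nonneg)
    also have "\<dots> \<le> norm h * norm (R y)" by (rule cinner_Cauchy_Schwarz)
    also have "\<dots> \<le> c * norm y" using c(1)[OF yU] n1 by simp
    also have "\<dots> \<le> c" using y1 c(2) by (simp add: mult_left_le)
    finally show ?thesis .
  qed
  have "(\<Sum>e\<in>F. cmod (cinner e (R e))) \<le> (\<Sum>e\<in>F. \<Sum>h\<in>H. cmod (cinner h (R e)) * cmod (cinner e h))"
  proof (rule sum_mono)
    fix e assume "e \<in> F"
    then have "e \<in> U" using F(2) by auto
    then have "cinner e (R e) = cinner e (\<Sum>h\<in>H. cinner h (R e) *\<^sub>C h)"
      by (intro arg_cong[OF H(5)])
    then have "cinner e (R e) = (\<Sum>h\<in>H. cinner h (R e) * cinner e h)"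
      by (simp add: cinner_sum_right cinner_scaleC_right)
    then show "cmod (cinner e (R e)) \<le> (\<Sum>h\<in>H. cmod (cinner h (R e)) * cmod (cinner e h))"
      using norm_sum[of "\<lambda>h. cinner h (R e) * cinner e h" H] by (simp add: norm_mult)
  qed
  also have "\<dots> = (\<Sum>h\<in>H. \<Sum>e\<in>F. cmod (cinner h (R e)) * cmod (cinner e h))" by (rule sum.swap)
  also have "\<dots> \<le> (\<Sum>h\<in>H. c)" by (intro sum_mono h)
  also have "\<dots> \<le> real r * c" using H(4) c(2) by (simp add: mult_right_mono)
  finally show ?thesis .
qed

lemma finite_rank_trace_summable:
  assumes U: "onb_space U" and R: "finite_rank U U r R"
  shows "trace_summable U R"
proof -
  obtain K where K: "K \<ge> 0" "\<And>x. x \<in> U \<Longrightarrow> norm (R x) \<le> K * norm x"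
    using bounded_clinear_on_bound[OF finite_rank_bounded[OF R]] by blast
  show ?thesis
    using finite_rank_trace_bound[OF onb_space_subspace[OF U] R K(2,1)] onb_subset[OF U]
      orthonormal_on_subset[OF onb_orthonormal[OF U]]
    by (intro trace_summableI_bound(1)[where c="real r * K"]) auto
qed

text \<open>The vector h is expanded in the basis and the continuous functional f is applied
  termwise. The value no longer mentions the basis, which is what makes traces over two different
  spaces comparable.\<close>

lemma rank_one_trace:
  assumes U: "onb_space U" and f: "bounded_clinear_on U UNIV f" and h: "h \<in> U"
  shows "op_trace U (\<lambda>x. f x *\<^sub>C h) = f h"
proof -
  obtain K where K: "K \<ge> 0" "\<And>x. x \<in> U \<Longrightarrow> norm (f x) \<le> K * norm x"
    using bounded_clinear_on_bound[OF f] by blast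
  note s = onb_space_subspace[OF U]
  have fs: "f (\<Sum>e\<in>F. cinner e h *\<^sub>C e) = (\<Sum>e\<in>F. cinner e (f e *\<^sub>C h))" if "F \<subseteq> onb U" for F
  proof -
    have FU: "F \<subseteq> U" using that onb_subset[OF U] by auto
    have "f (\<Sum>e\<in>F. cinner e h *\<^sub>C e) = (\<Sum>e\<in>F. f (cinner e h *\<^sub>C e))"
      using FU by (intro clinear_on_sum[OF bounded_clinear_on_clinear[OF f] s]
        cvs.subspace_scale[OF s]) auto
    also have "\<dots> = (\<Sum>e\<in>F. cinner e (f e *\<^sub>C h))"
      using FU by (intro sum.cong refl)
        (auto simp: bounded_clinear_onD(3)[OF f] cinner_scaleC_right scaleC_complex_def subset_iff)
    finally show ?thesis .
  qed
  have "((\<lambda>e. cinner e h *\<^sub>C e) has_sum h) (onb U)"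
    using U h by (intro onb_expansion[of U]) (auto simp: onb_space_def)
  then have lim: "(sum (\<lambda>e. cinner e h *\<^sub>C e) \<longlongrightarrow> h) (finite_subsets_at_top (onb U))"
    by (simp add: has_sum_def)
  have "((\<lambda>F. f (sum (\<lambda>e. cinner e h *\<^sub>C e) F)) \<longlongrightarrow> f h) (finite_subsets_at_top (onb U))"
  proof (rule Lim_transform2[OF tendsto_const])
    have "((\<lambda>F. K * norm (sum (\<lambda>e. cinner e h *\<^sub>C e) F - h)) \<longlongrightarrow> K * norm (h - h))
      (finite_subsets_at_top (onb U))"
      by (intro tendsto_intros lim)
    then have g0: "((\<lambda>F. K * norm (sum (\<lambda>e. cinner e h *\<^sub>C e) F - h)) \<longlongrightarrow> 0) (finite_subsets_at_top
      (onb U))"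
      by simp
    show "((\<lambda>F. f h - f (sum (\<lambda>e. cinner e h *\<^sub>C e) F)) \<longlongrightarrow> 0) (finite_subsets_at_top (onb U))"
    proof (rule Lim_null_comparison[OF _ g0])
      show "\<forall>\<^sub>F F in finite_subsets_at_top (onb U).
          norm (f h - f (sum (\<lambda>e. cinner e h *\<^sub>C e) F)) \<le> K * norm (sum (\<lambda>e. cinner e h *\<^sub>C e) F - h)"
      proof (rule eventually_finite_subsets_at_top_weakI)
        fix F assume F: "finite F" "F \<subseteq> onb U"
        define y where "y = (\<Sum>e\<in>F. cinner e h *\<^sub>C e)"
        have y: "y \<in> U" unfolding y_def using F onb_subset[OF U]
          by (intro cvs.subspace_sum[OF s] cvs.subspace_scale[OF s]) auto
        have "f h = f (h - y) + f y"
          using bounded_clinear_onD(2)[OF f, of "h - y" y] y h cvs.subspace_diff[OF s] by simp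
        then show "norm (f h - f (sum (\<lambda>e. cinner e h *\<^sub>C e) F)) \<le> K * norm (sum (\<lambda>e. cinner e h
          *\<^sub>C e) F - h)"
          using K(2)[of "h - y"] y h cvs.subspace_diff[OF s] by (simp add: norm_minus_commute flip:
            y_def)
      qed
    qed
  qed
  then have "((\<lambda>F. \<Sum>e\<in>F. cinner e (f e *\<^sub>C h)) \<longlongrightarrow> f h) (finite_subsets_at_top (onb U))"
    by (rule Lim_transform_eventually) (auto intro!: eventually_finite_subsets_at_top_weakI simp: fs)
  then show ?thesis
    unfolding op_trace_onb by (intro infsumI) (simp add: has_sum_def)
qed

lemma rank_one_trace_summable:
  assumes W: "onb_space W" and g: "bounded_clinear_on W UNIV g" and h: "h \<in> W"
  shows "trace_summable W (\<lambda>x. g x *\<^sub>C h)"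
proof (rule finite_rank_trace_summable[OF W, of 1])
  obtain K where K: "K \<ge> 0" "\<And>x. x \<in> W \<Longrightarrow> norm (g x) \<le> K * norm x"
    using bounded_clinear_on_bound[OF g] by blast
  have "norm (g x *\<^sub>C h) \<le> K * norm h * norm x" if "x \<in> W" for x
    using mult_right_mono[OF K(2)[OF that], of "norm h"] by (simp add: norm_scaleC mult_ac)
  then have "bounded_clinear_on W W (\<lambda>x. g x *\<^sub>C h)"
    using h by (intro bounded_clinear_onI[where K="K * norm h"])
      (simp_all add: bounded_clinear_onD[OF g] cvs.subspace_scale[OF onb_space_subspace[OF W]]
        scaleC_add_left scaleC_scaleC scaleC_complex_def)
  then show "finite_rank W W 1 (\<lambda>x. g x *\<^sub>C h)"
    unfolding finite_rank_def using h
    by (intro conjI exI[of _ "{h}"]) (auto intro: cvs.span_scale cvs.span_base)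
qed

text \<open>With R written as a sum of rank one operators over an orthonormal set \<open>H\<close>
  spanning its range, both traces equal the finite sum of \<open>cinner h (R (B h))\<close> over
  \<open>H\<close>.\<close>

lemma finite_rank_trace_commute:
  assumes U: "onb_space U" and V: "onb_space V"
    and R: "finite_rank U V r R" and B: "bounded_clinear_on V U B"
  shows "op_trace V (\<lambda>x. R (B x)) = op_trace U (\<lambda>x. B (R x))"
proof -
  note sU = onb_space_subspace[OF U] and sV = onb_space_subspace[OF V]
  obtain H where H: "finite H" "H \<subseteq> V" "orthonormal_on H (\<lambda>h. h)" "card H \<le> r"
    "\<And>x. x \<in> U \<Longrightarrow> R x = (\<Sum>h\<in>H. cinner h (R x) *\<^sub>C h)"
    by (rule finite_rank_frame[OF sV R]) (rule that)
  note Rb = finite_rank_bounded[OF R]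
  have c: "bounded_clinear_on V UNIV (cinner h)" for h :: 'b
    by (rule bounded_clinear_onI[where K="norm h"])
      (auto simp: cinner_add_right cinner_scaleC_right scaleC_complex_def cinner_Cauchy_Schwarz)
  have f: "bounded_clinear_on U UNIV (\<lambda>x. cinner h (R x))" for h
    by (rule bounded_clinear_on_comp[OF c Rb])
  have fB: "bounded_clinear_on V UNIV (\<lambda>x. cinner h (R (B x)))" for h
    by (rule bounded_clinear_on_comp[OF f B])
  have "op_trace V (\<lambda>x. R (B x)) = op_trace V (\<lambda>x. \<Sum>h\<in>H. cinner h (R (B x)) *\<^sub>C h)"
    using bounded_clinear_onD(1)[OF B] H(5) by (intro op_trace_cong[OF V]) blast
  also have "\<dots> = (\<Sum>h\<in>H. op_trace V (\<lambda>x. cinner h (R (B x)) *\<^sub>C h))"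
    using H(2) by (intro op_trace_sum rank_one_trace_summable[OF V]) (auto simp: fB)
  also have "\<dots> = (\<Sum>h\<in>H. cinner h (R (B h)))"
    using H(2) by (intro sum.cong refl rank_one_trace[OF V fB]) auto
  also have "\<dots> = (\<Sum>h\<in>H. op_trace U (\<lambda>x. cinner h (R x) *\<^sub>C B h))"
    using H(2) bounded_clinear_onD(1)[OF B] by (intro sum.cong refl rank_one_trace[OF U f,
      symmetric]) auto
  also have "\<dots> = op_trace U (\<lambda>x. \<Sum>h\<in>H. cinner h (R x) *\<^sub>C B h)"
    using H(2) bounded_clinear_onD(1)[OF B] by (intro op_trace_sum[symmetric]
      rank_one_trace_summable[OF U]) (auto simp: f)
  also have "\<dots> = op_trace U (\<lambda>x. B (R x))"
  proof (rule op_trace_cong[OF U])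
    fix x assume x: "x \<in> U"
    have "B (R x) = B (\<Sum>h\<in>H. cinner h (R x) *\<^sub>C h)" by (rule arg_cong[OF H(5)[OF x]])
    also have "\<dots> = (\<Sum>h\<in>H. B (cinner h (R x) *\<^sub>C h))"
      using H(2) by (intro clinear_on_sum[OF bounded_clinear_on_clinear[OF B] sV]) (auto intro:
        cvs.subspace_scale[OF sV])
    also have "\<dots> = (\<Sum>h\<in>H. cinner h (R x) *\<^sub>C B h)"
      using H(2) by (intro sum.cong refl bounded_clinear_onD(3)[OF B]) auto
    finally show "(\<Sum>h\<in>H. cinner h (R x) *\<^sub>C B h) = B (R x)" by simp
  qed
  finally show ?thesis .
qed

section \<open>Approximation by operators of finite rank\<close>

text \<open>Products of \<open>N\<close> operators in the Schatten class of exponent \<open>N\<close> are of trace class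
  because truncating all singular value decompositions at the same level \<open>2^{-i}\<close> approximates a
  product of \<open>k\<close> of them up to \<open>O(2^{-ik})\<close> by operators whose ranks \<open>r_i\<close> satisfy
  \<open>(\<Sum>i. 2^{-iN} r_i) < \<infinity>\<close>.\<close>

definition approx_by ::
    "nat \<Rightarrow> nat \<Rightarrow> 'h::complex_hilbert_space set \<Rightarrow> 'k::complex_hilbert_space set \<Rightarrow> ('h \<Rightarrow> 'k) \<Rightarrow>
     (nat \<Rightarrow> 'h \<Rightarrow> 'k) \<Rightarrow> (nat \<Rightarrow> nat) \<Rightarrow> real \<Rightarrow> bool"
  where "approx_by N k U V T R r K \<longleftrightarrow> 0 \<le> K \<and> (\<forall>i. finite_rank U V (r i) (R i)) \<and>
    (\<forall>i. \<forall>x\<in>U. norm (T x - R i x) \<le> K * (1/2) ^ (i * k) * norm x) \<and>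
    summable (\<lambda>i. (1/2) ^ (i * N) * real (r i))"

text \<open>The exponent \<open>k\<close> adds under composition, so it can serve as a degree; the
  exponent \<open>N\<close> of the rank weights stays fixed.\<close>

definition approximable ::
    "nat \<Rightarrow> nat \<Rightarrow> 'h::complex_hilbert_space set \<Rightarrow> 'k::complex_hilbert_space set \<Rightarrow> ('h \<Rightarrow> 'k) \<Rightarrow> bool"
  where "approximable N k U V T \<longleftrightarrow> bounded_clinear_on U V T \<and> (\<exists>R r K. approx_by N k U V T R r K)"

lemma approximable_bounded: "approximable N k U V T \<Longrightarrow> bounded_clinear_on U V T"
  by (simp add: approximable_def)

lemma approx_byD:
  assumes "approx_by N k U V T R r K"
  shows "0 \<le> K" "finite_rank U V (r i) (R i)"
    "x \<in> U \<Longrightarrow> norm (T x - R i x) \<le> K * (1/2) ^ (i * k) * norm x"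
    "summable (\<lambda>i. (1/2) ^ (i * N) * real (r i))"
  using assms by (auto simp: approx_by_def)

lemma approx_by_mono:
  assumes "approx_by N k U V T R r K" "l \<le> k"
  shows "approx_by N l U V T R r K"
proof -
  have "K * (1/2) ^ (i * k) * norm x \<le> K * (1/2) ^ (i * l) * norm x" for i and x :: 'a
    using assms approx_byD(1)[OF assms(1)]
    by (intro mult_right_mono mult_left_mono power_decreasing) auto
  then show ?thesis
    using assms(1) unfolding approx_by_def by (meson order_trans)
qed

lemma approximable_mono: "\<lbrakk>approximable N k U V T; l \<le> k\<rbrakk> \<Longrightarrow> approximable N l U V T"
  unfolding approximable_def using approx_by_mono by blast

lemma approximable_cong:
  assumes "cvs.subspace U" "\<And>x. x \<in> U \<Longrightarrow> T x = T' x"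
  shows "approximable N k U V T \<longleftrightarrow> approximable N k U V T'"
proof -
  have "bounded_clinear_on U V T = bounded_clinear_on U V T'"
    by (rule bounded_clinear_on_cong[OF assms])
  then show ?thesis unfolding approximable_def approx_by_def using assms(2) by simp
qed

text \<open>At exponent 0 the error need not decay, so the zero operator is an admissible
  approximation at every level. All bounded operators thus fit into degree 0.\<close>

lemma approximable_0:
  assumes V: "cvs.subspace V" and T: "bounded_clinear_on U V T"
  shows "approximable N 0 U V T"
proof -
  obtain K where K: "K \<ge> 0" "\<And>x. x \<in> U \<Longrightarrow> norm (T x) \<le> K * norm x"
    using bounded_clinear_on_bound[OF T] by blast
  have "bounded_clinear_on U V (\<lambda>_. 0)"
    by (rule bounded_clinear_onI[where K=0]) (auto simp: cvs.subspace_0[OF V])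
  then have "finite_rank U V 0 (\<lambda>_. 0)"
    unfolding finite_rank_def by (intro conjI exI[of _ "{}"]) auto
  then have "approx_by N 0 U V T (\<lambda>_ _. 0) (\<lambda>_. 0) K"
    using K by (simp add: approx_by_def)
  then show ?thesis using T by (auto simp: approximable_def)
qed

lemma approximable_add:
  assumes V: "cvs.subspace V" and A: "approximable N k U V A" and B: "approximable N k U V B"
  shows "approximable N k U V (\<lambda>x. A x + B x)"
proof -
  obtain R r K where R: "approx_by N k U V A R r K" using A by (auto simp: approximable_def)
  obtain R' r' K' where R': "approx_by N k U V B R' r' K'" using B by (auto simp: approximable_def)
  have "norm (A x + B x - (R i x + R' i x)) \<le> (K + K') * (1/2) ^ (i * k) * norm x" if "x \<in> U" for i x
  proof -
    have "norm (A x + B x - (R i x + R' i x)) \<le> norm (A x - R i x) + norm (B x - R' i x)"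
      using norm_triangle_ineq[of "A x - R i x" "B x - R' i x"] by (simp add: algebra_simps)
    also have "\<dots> \<le> K * (1/2) ^ (i * k) * norm x + K' * (1/2) ^ (i * k) * norm x"
      by (intro add_mono approx_byD(3)[OF R that] approx_byD(3)[OF R' that])
    finally show ?thesis by (simp add: algebra_simps)
  qed
  moreover have "summable (\<lambda>i. (1/2) ^ (i * N) * real (r i + r' i))"
    using summable_add[OF approx_byD(4)[OF R] approx_byD(4)[OF R']] by (simp add: algebra_simps)
  ultimately have "approx_by N k U V (\<lambda>x. A x + B x) (\<lambda>i x. R i x + R' i x) (\<lambda>i. r i + r' i) (K + K')"
    using approx_byD(1)[OF R] approx_byD(1)[OF R'] finite_rank_add[OF V approx_byD(2)[OF R]
      approx_byD(2)[OF R']]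
    by (simp add: approx_by_def)
  then show ?thesis
    using bounded_clinear_on_add[OF V approximable_bounded[OF A] approximable_bounded[OF B]]
    by (auto simp: approximable_def)
qed

lemma approximable_scale:
  assumes V: "cvs.subspace V" and A: "approximable N k U V A"
  shows "approximable N k U V (\<lambda>x. a *\<^sub>C A x)"
proof -
  obtain R r K where R: "approx_by N k U V A R r K" using A by (auto simp: approximable_def)
  have "norm (a *\<^sub>C A x - a *\<^sub>C R i x) \<le> cmod a * K * (1/2) ^ (i * k) * norm x" if "x \<in> U" for i x
    using mult_left_mono[OF approx_byD(3)[OF R that], of "cmod a" i]
    by (simp add: norm_scaleC mult.assoc flip: cvs.scale_right_diff_distrib)
  then have "approx_by N k U V (\<lambda>x. a *\<^sub>C A x) (\<lambda>i x. a *\<^sub>C R i x) r (cmod a * K)"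
    using approx_byD(1,4)[OF R] finite_rank_scale[OF V approx_byD(2)[OF R]]
    by (simp add: approx_by_def)
  then show ?thesis
    using bounded_clinear_on_scale[OF V approximable_bounded[OF A]] by (auto simp: approximable_def)
qed

text \<open>\<open>A B\<close> is approximated by \<open>A B - (A - A_i) (B - B_i) = A_i B + A B_i - A_i B_i\<close>.\<close>

lemma approx_by_comp:
  assumes U: "cvs.subspace U" and V: "cvs.subspace V" and W: "cvs.subspace W"
    and A: "bounded_clinear_on V W A" "approx_by N k V W A R r K"
    and B: "bounded_clinear_on U V B" "approx_by N l U V B R' r' K'"
  shows "approx_by N (k + l) U W (\<lambda>x. A (B x)) (\<lambda>i x. R i (B x) + A (R' i x) - R i (R' i x)) (\<lambda>i. r
    i + r' i) (K * K')"
proof -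
  note fR = approx_byD(2)[OF A(2)] and fR' = approx_byD(2)[OF B(2)]
  note bR = finite_rank_bounded[OF fR] and bR' = finite_rank_bounded[OF fR']
  \<comment> \<open>Bracketed as A_i (B - B_i) + A B_i, the approximant has rank at most r_i +
    r'_i.\<close>
  have e: "R i (B x) + A (R' i x) - R i (R' i x) = R i (B x - R' i x) + A (R' i x)" if "x \<in> U" for i x
    using bounded_clinear_onD(2)[OF bR, of "B x - R' i x" "R' i x" i]
      bounded_clinear_onD(1)[OF B(1) that] bounded_clinear_onD(1)[OF bR' that] cvs.subspace_diff[OF
        V] by simp
  have "finite_rank U W (r i + r' i) (\<lambda>x. R i (B x - R' i x) + A (R' i x))" for i
    by (intro finite_rank_add[OF W] finite_rank_comp_right[OF fR] finite_rank_comp_left[OF V A(1) fR']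
        bounded_clinear_on_diff[OF V B(1) bR'])
  then have "finite_rank U W (r i + r' i) (\<lambda>x. R i (B x) + A (R' i x) - R i (R' i x))" for i
    unfolding finite_rank_def using bounded_clinear_on_cong[OF U, of _ _ W] e by (metis (no_types,
      lifting))
  moreover have "norm (A (B x) - (R i (B x) + A (R' i x) - R i (R' i x))) \<le> K * K' * (1/2) ^ (i *
    (k + l)) * norm x"
    if x: "x \<in> U" for i x
  proof -
    define y where "y = B x - R' i x"
    have y: "y \<in> V" using bounded_clinear_onD(1)[OF B(1) x] bounded_clinear_onD(1)[OF bR' x]
      cvs.subspace_diff[OF V]
      by (simp add: y_def)
    have "A (B x) = A y + A (R' i x)"
      using bounded_clinear_onD(2)[OF A(1) y bounded_clinear_onD(1)[OF bR' x, of i]] by (simp add: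
        y_def)
    then have "A (B x) - (R i (B x) + A (R' i x) - R i (R' i x)) = A y - R i y"
      using e[OF x, of i] by (simp add: y_def)
    then have "norm (A (B x) - (R i (B x) + A (R' i x) - R i (R' i x))) \<le> K * (1/2) ^ (i * k) * norm y"
      using approx_byD(3)[OF A(2) y] by simp
    also have "\<dots> \<le> K * (1/2) ^ (i * k) * (K' * (1/2) ^ (i * l) * norm x)"
      using approx_byD(1)[OF A(2)] unfolding y_def
      by (intro mult_left_mono approx_byD(3)[OF B(2) x]) simp
    finally show ?thesis by (simp add: algebra_simps power_add)
  qed
  moreover have "summable (\<lambda>i. (1/2) ^ (i * N) * real (r i + r' i))"
    using summable_add[OF approx_byD(4)[OF A(2)] approx_byD(4)[OF B(2)]] by (simp add: algebra_simps)
  ultimately show ?thesis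
    using approx_byD(1)[OF A(2)] approx_byD(1)[OF B(2)] unfolding approx_by_def by simp
qed

lemma approximable_comp:
  assumes "cvs.subspace U" "cvs.subspace V" "cvs.subspace W"
    and A: "approximable N k V W A" and B: "approximable N l U V B"
  shows "approximable N (k + l) U W (\<lambda>x. A (B x))"
proof -
  obtain R r K where R: "approx_by N k V W A R r K" using A by (auto simp: approximable_def)
  obtain R' r' K' where R': "approx_by N l U V B R' r' K'" using B by (auto simp: approximable_def)
  show ?thesis
    using approx_by_comp[OF assms(1-3) approximable_bounded[OF A] R approximable_bounded[OF B] R']
      bounded_clinear_on_comp[OF approximable_bounded[OF A] approximable_bounded[OF B]]
    unfolding approximable_def by blast
qed

text \<open>The trace of \<open>R (i + 1) - R i\<close> is \<open>O(2^{-iN} (r_i + r_{i+1}))\<close>.\<close>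

lemma approx_by_trace:
  assumes U: "onb_space U" and N: "0 < N" and T: "approx_by N N U U T R r K"
  shows "trace_summable U T" and "(\<lambda>i. op_trace U (R i)) \<longlonglongrightarrow> op_trace U T"
proof -
  note s = onb_space_subspace[OF U]
  note fR = approx_byD(2)[OF T] and K = approx_byD(1)[OF T]
  define t where "t i = real (r (Suc i) + r i) * (2 * K * (1/2) ^ (i * N))" for i
  have "summable (\<lambda>i. (1/2::real) ^ (Suc i * N) * real (r (Suc i)))"
    by (subst summable_Suc_iff) (rule approx_byD(4)[OF T])
  then have "summable (\<lambda>i. 2 * K * 2 ^ N * ((1/2) ^ (Suc i * N) * real (r (Suc i))) + 2 * K *
    ((1/2) ^ (i * N) * real (r i)))"
    by (intro summable_add summable_mult approx_byD(4)[OF T])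
  moreover have "2 * K * 2 ^ N * ((1/2) ^ (Suc i * N) * real (r (Suc i))) + 2 * K * ((1/2) ^ (i *
    N) * real (r i)) = t i" for i
    by (simp add: t_def power_add algebra_simps power_one_over add_divide_distrib)
  ultimately have t: "summable t" by simp
  have t0: "0 \<le> t i" for i using K by (simp add: t_def)
  have step: "norm (R (Suc i) x - R i x) \<le> 2 * K * (1/2) ^ (i * N) * norm x" if "x \<in> U" for i x
  proof -
    have "norm (R (Suc i) x - R i x) \<le> norm (T x - R i x) + norm (T x - R (Suc i) x)"
      using norm_triangle_ineq4[of "T x - R i x" "T x - R (Suc i) x"] by simp
    also have "\<dots> \<le> K * (1/2) ^ (i * N) * norm x + K * (1/2) ^ (i * N) * norm x"
    proof (rule add_mono[OF approx_byD(3)[OF T that]])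
      have "K * (1/2) ^ (Suc i * N) * norm x \<le> K * (1/2) ^ (i * N) * norm x"
        using K by (intro mult_right_mono mult_left_mono power_decreasing) auto
      then show "norm (T x - R (Suc i) x) \<le> K * (1/2) ^ (i * N) * norm x"
        using approx_byD(3)[OF T that, of "Suc i"] by simp
    qed
    finally show ?thesis by (simp add: mult_ac)
  qed
  \<comment> \<open>T - R_j is telescoped up to level j + M. On the fixed finite set
    \<open>F\<close> the remainder tends to 0 as M grows, leaving a tail of the series of
    \<open>t\<close> that does not depend on \<open>F\<close>.\<close>
  have fin: "(\<Sum>e\<in>F. cmod (cinner e (T e - R j e))) \<le> suminf t - sum t {..<j}"
    if F: "finite F" "F \<subseteq> onb U" for F j
  proof -
    have FU: "F \<subseteq> U" using F(2) onb_subset[OF U] by auto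
    have on: "orthonormal_on F (\<lambda>e. e)" by (rule orthonormal_on_subset[OF onb_orthonormal[OF U] F(2)])
    have d: "(\<Sum>e\<in>F. cmod (cinner e (R (Suc i) e - R i e))) \<le> t i" for i
      unfolding t_def
      by (rule finite_rank_trace_bound[OF s finite_rank_diff[OF s fR fR] _ _ F(1) FU on])
        (use step K in \<open>auto simp: mult.assoc\<close>)
    have a1: "(\<Sum>e\<in>F. cmod (cinner e (T e - R j e)))
        \<le> (\<Sum>e\<in>F. cmod (cinner e (T e - R (j + M) e))) + sum t {j..<j + M}" for M
    proof (induction M)
      case (Suc M)
      have "(\<Sum>e\<in>F. cmod (cinner e (T e - R (j + M) e)))
          \<le> (\<Sum>e\<in>F. cmod (cinner e (T e - R (j + Suc M) e)) + cmod (cinner e (R (j + Suc M) e - R (j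
            + M) e)))"
        by (intro sum_mono) (metis cinner_add_right diff_add_cancel add_diff_eq norm_triangle_ineq)
      also have "\<dots> \<le> (\<Sum>e\<in>F. cmod (cinner e (T e - R (j + Suc M) e))) + t (j + M)"
        using d[of "j + M"] by (simp add: sum.distrib)
      finally show ?case using Suc by simp
    qed simp
    have a2: "(\<Sum>e\<in>F. cmod (cinner e (T e - R (j + M) e))) \<le> real (card F) * K * ((1/2) ^ N) ^ M" for M
    proof -
      have "cmod (cinner e (T e - R (j + M) e)) \<le> K * ((1/2) ^ N) ^ M" if e: "e \<in> F" for e
      proof -
        have "norm e = 1" by (rule orthonormal_norm[OF on e])
        then have "cmod (cinner e (T e - R (j + M) e)) \<le> norm (T e - R (j + M) e)"
          using cinner_Cauchy_Schwarz[of e "T e - R (j + M) e"] by simp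
        also have "\<dots> \<le> K * (1/2) ^ ((j + M) * N)"
          using approx_byD(3)[OF T, of e "j + M"] e FU \<open>norm e = 1\<close> by auto
        also have "\<dots> \<le> K * (1/2) ^ (N * M)"
          using K by (intro mult_left_mono power_decreasing) (auto simp: algebra_simps)
        finally show ?thesis by (simp add: power_mult)
      qed
      then have "(\<Sum>e\<in>F. cmod (cinner e (T e - R (j + M) e))) \<le> (\<Sum>e\<in>F. K * ((1/2) ^ N) ^ M)"
        by (rule sum_mono)
      then show ?thesis by (simp add: mult.assoc)
    qed
    have a3: "sum t {j..<j + M} \<le> suminf t - sum t {..<j}" for M
    proof -
      have "sum t {..<j} + sum t {j..<j + M} = sum t {..<j + M}"
        using sum.atLeastLessThan_concat[of 0 j "j + M" t] by (simp add: atLeast0LessThan)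
      moreover have "sum t {..<j + M} \<le> suminf t" by (rule sum_le_suminf[OF t]) (auto simp: t0)
      ultimately show ?thesis by simp
    qed
    have le: "(\<Sum>e\<in>F. cmod (cinner e (T e - R j e)))
        \<le> real (card F) * K * ((1/2) ^ N) ^ M + (suminf t - sum t {..<j})" for M
      using a1[of M] a2[of M] a3[of M] by linarith
    have "(\<lambda>M. ((1/2::real) ^ N) ^ M) \<longlonglongrightarrow> 0"
      using N by (intro LIMSEQ_realpow_zero) (auto simp: power_less_one_iff)
    then have "(\<lambda>M. real (card F) * K * ((1/2) ^ N) ^ M + (suminf t - sum t {..<j}))
        \<longlonglongrightarrow> real (card F) * K * 0 + (suminf t - sum t {..<j})"
      by (intro tendsto_add tendsto_mult tendsto_const)
    then show ?thesis
      using le by (intro LIMSEQ_le_const) auto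
  qed
  have b: "trace_summable U (\<lambda>x. T x - R j x)" "cmod (op_trace U (\<lambda>x. T x - R j x)) \<le> suminf t -
    sum t {..<j}" for j
    using trace_summableI_bound[OF fin] by blast+
  have Rs: "trace_summable U (R j)" for j by (rule finite_rank_trace_summable[OF U fR])
  show Ts: "trace_summable U T"
    using trace_summable_add[OF b(1)[of 0] Rs[of 0]] by simp
  have "(\<lambda>j. suminf t - sum t {..<j}) \<longlonglongrightarrow> suminf t - suminf t"
    by (intro tendsto_intros summable_LIMSEQ t)
  then have z: "(\<lambda>j. suminf t - sum t {..<j}) \<longlonglongrightarrow> 0" by simp
  have "(\<lambda>j. op_trace U T - op_trace U (R j)) \<longlonglongrightarrow> 0"
    by (rule Lim_null_comparison[OF _ z]) (use b(2) in \<open>auto simp: op_trace_diff[OF Ts Rs]\<close>)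
  then show "(\<lambda>i. op_trace U (R i)) \<longlonglongrightarrow> op_trace U T"
    by (rule Lim_transform2[OF tendsto_const])
qed

lemma approximable_trace_summable:
  assumes "onb_space U" "0 < N" "approximable N k U U T" "N \<le> k"
  shows "trace_summable U T"
  using approx_by_trace(1)[OF assms(1,2)] approximable_mono[OF assms(3,4)] by (auto simp:
    approximable_def)

text \<open>The approximants of A B and of B A are built from the same finite rank operators, and
  their traces agree by \<open>finite_rank_trace_commute\<close> applied to the three terms. Both
  sequences of traces converge because the decay exponents add up to at least N.\<close>

theorem approximable_trace_commute:
  assumes U: "onb_space U" and V: "onb_space V" and N: "0 < N" "N \<le> k + l"
    and A: "approximable N k V U A" and B: "approximable N l U V B"
  shows "op_trace U (\<lambda>x. A (B x)) = op_trace V (\<lambda>x. B (A x))"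
proof -
  note sU = onb_space_subspace[OF U] and sV = onb_space_subspace[OF V]
  note Ab = approximable_bounded[OF A] and Bb = approximable_bounded[OF B]
  obtain R r K where R: "approx_by N k V U A R r K" using A by (auto simp: approximable_def)
  obtain R' r' K' where R': "approx_by N l U V B R' r' K'" using B by (auto simp: approximable_def)
  note fR = approx_byD(2)[OF R] and fR' = approx_byD(2)[OF R']
  note bR = finite_rank_bounded[OF fR] and bR' = finite_rank_bounded[OF fR']
  define P where "P i x = R i (B x) + A (R' i x) - R i (R' i x)" for i x
  define Q where "Q i x = R' i (A x) + B (R i x) - R' i (R i x)" for i x
  have "approx_by N N U U (\<lambda>x. A (B x)) P (\<lambda>i. r i + r' i) (K * K')"
    unfolding P_def by (rule approx_by_mono[OF approx_by_comp[OF sU sV sU Ab R Bb R'] N(2)])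
  from approx_by_trace(2)[OF U N(1) this]
  have P: "(\<lambda>i. op_trace U (P i)) \<longlonglongrightarrow> op_trace U (\<lambda>x. A (B x))" .
  have "approx_by N N V V (\<lambda>x. B (A x)) Q (\<lambda>i. r' i + r i) (K' * K)"
    unfolding Q_def using N(2)
    by (intro approx_by_mono[OF approx_by_comp[OF sV sU sV Bb R' Ab R]]) simp
  from approx_by_trace(2)[OF V N(1) this]
  have Q: "(\<lambda>i. op_trace V (Q i)) \<longlonglongrightarrow> op_trace V (\<lambda>x. B (A x))" .
  have "op_trace U (P i) = op_trace V (Q i)" for i
  proof -
    have f1: "finite_rank U U (r i) (\<lambda>x. R i (B x))" by (rule finite_rank_comp_right[OF fR Bb])
    have f2: "finite_rank U U (r' i) (\<lambda>x. A (R' i x))" by (rule finite_rank_comp_left[OF sV Ab fR'])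
    have f3: "finite_rank U U (r i) (\<lambda>x. R i (R' i x))" by (rule finite_rank_comp_right[OF fR bR'])
    have g1: "finite_rank V V (r' i) (\<lambda>x. R' i (A x))" by (rule finite_rank_comp_right[OF fR' Ab])
    have g2: "finite_rank V V (r i) (\<lambda>x. B (R i x))" by (rule finite_rank_comp_left[OF sU Bb fR])
    have g3: "finite_rank V V (r' i) (\<lambda>x. R' i (R i x))" by (rule finite_rank_comp_right[OF fR' bR])
    note sm = finite_rank_trace_summable[OF U f1] finite_rank_trace_summable[OF U f2]
      finite_rank_trace_summable[OF U f3] finite_rank_trace_summable[OF V g1]
      finite_rank_trace_summable[OF V g2] finite_rank_trace_summable[OF V g3]
    have "op_trace U (P i) = op_trace U (\<lambda>x. R i (B x)) + op_trace U (\<lambda>x. A (R' i x)) - op_trace U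
      (\<lambda>x. R i (R' i x))"
      unfolding P_def by (simp add: op_trace_diff op_trace_add trace_summable_add sm)
    also have "\<dots> = op_trace V (\<lambda>x. B (R i x)) + op_trace V (\<lambda>x. R' i (A x)) - op_trace V (\<lambda>x. R' i
      (R i x))"
      using finite_rank_trace_commute[OF V U fR Bb] finite_rank_trace_commute[OF U V fR' Ab]
        finite_rank_trace_commute[OF V U fR bR'] by simp
    also have "\<dots> = op_trace V (Q i)"
      unfolding Q_def by (simp add: op_trace_diff op_trace_add trace_summable_add sm)
    finally show ?thesis .
  qed
  with P Q show ?thesis by (simp add: LIMSEQ_unique)
qed

text \<open>The levels with 2^(-i) < s form a tail starting at the least such level k, and the
  series over it is at most twice its first term 2^(-kN). As 2^(-k) \<le> 1 and p \<le> N, that term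
  is at most the p-th power of 2^(-k), hence of s.\<close>

lemma truncated_geometric_sum_le:
  assumes s: "0 < s" and p: "0 < p" "p \<le> real N"
  shows "(\<Sum>i<m. if (1/2) ^ i < s then (1/2) ^ (i * N) else 0) \<le> 2 * s powr p"
proof (cases "\<exists>i<m. (1/2) ^ i < s")
  case False
  then have "(\<Sum>i<m. if (1/2) ^ i < s then (1/2) ^ (i * N) else 0) = (0::real)"
    by (intro sum.neutral) auto
  then show ?thesis by simp
next
  case True
  define k where "k = (LEAST i. (1/2) ^ i < s)"
  have k: "(1/2) ^ k < s" unfolding k_def using True by (metis (mono_tags, lifting) LeastI)
  have N: "1 \<le> N" using p by linarith
  have "(\<Sum>i<m. if (1/2) ^ i < s then (1/2) ^ (i * N) else 0) \<le> (\<Sum>i<m. if k \<le> i then (1/2::real) ^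
    (i * N) else 0)"
    by (intro sum_mono) (auto simp: k_def intro: Least_le)
  also have "\<dots> = (\<Sum>i\<in>{k..<m}. (1/2) ^ (i * N))"
    by (intro sum.mono_neutral_cong_right) auto
  also have "\<dots> \<le> (\<Sum>i\<in>{k..<m}. (1/2) ^ (k * N) * (1/2) ^ (i - k))"
  proof (rule sum_mono)
    fix i assume i: "i \<in> {k..<m}"
    have "k * N + (i - k) \<le> k * N + (i - k) * N" using N by simp
    also have "\<dots> = i * N" using i by (simp flip: distrib_right)
    finally have "(1/2::real) ^ (i * N) \<le> (1/2) ^ (k * N + (i - k))"
      by (intro power_decreasing) auto
    then show "(1/2::real) ^ (i * N) \<le> (1/2) ^ (k * N) * (1/2) ^ (i - k)" by (simp add: power_add)
  qed
  also have "\<dots> = (1/2) ^ (k * N) * (\<Sum>j<m - k. (1/2) ^ j)"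
    unfolding sum_distrib_left
    by (rule sum.reindex_bij_witness[of _ "\<lambda>j. j + k" "\<lambda>i. i - k"]) auto
  also have "(\<Sum>j<m - k. (1/2) ^ j) \<le> (2::real)"
    by (subst sum_gp_strict) auto
  also have "(1/2) ^ (k * N) * 2 = 2 * ((1/2) ^ k) powr real N"
    by (simp add: powr_realpow power_mult)
  also have "((1/2::real) ^ k) powr real N \<le> ((1/2) ^ k) powr p"
    using p by (intro powr_mono') (auto simp: power_le_one)
  also have "((1/2) ^ k) powr p \<le> s powr p"
    using k p by (intro powr_mono2) auto
  finally show ?thesis by simp
qed

text \<open>Level i keeps the singular values above 2^(-i); orthonormality of both families bounds
  the discarded part by 2^(-i). The weighted ranks are summed by exchanging summations: a singular
  value s is counted at the levels with 2^(-i) < s, at a total cost of at most 2 s^p.\<close>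

theorem schatten_approximable:
  assumes T: "schatten p U V T" and p: "0 < p" "p \<le> real N" and V: "cvs.subspace V"
  shows "approximable N 1 U V T"
proof -
  obtain I :: "nat set" and s e f where
    I': "\<forall>n\<in>I. 0 < s n \<and> e n \<in> U \<and> f n \<in> V"
    and e: "orthonormal_on I e" and f: "orthonormal_on I f" and sp: "(\<lambda>n. s n powr p) summable_on I"
    and hs': "\<forall>x\<in>U. ((\<lambda>n. (complex_of_real (s n) * cinner (e n) x) *\<^sub>C f n) has_sum T x) I"
    using T unfolding schatten_def by blast
  note I = I'[rule_format] and hs = hs'[rule_format]
  have Tb: "bounded_clinear_on U V T" using T by (simp add: schatten_def)
  define M where "M = (\<Sum>\<^sub>\<infinity>n\<in>I. s n powr p)"
  have M: "(\<Sum>n\<in>F. s n powr p) \<le> M" if "finite F" "F \<subseteq> I" for F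
    unfolding M_def by (rule finite_sum_le_infsum[OF sp that]) simp
  define J where "J i = {n \<in> I. (1/2) ^ i < s n}" for i :: nat
  have JI: "J i \<subseteq> I" for i by (auto simp: J_def)
  have fin: "finite (J i)" for i
  proof (rule ccontr)
    assume inf: "infinite (J i)"
    define d where "d = ((1/2::real) ^ i) powr p"
    have d: "0 < d" by (simp add: d_def)
    obtain k :: nat where k: "M / d < real k" using reals_Archimedean2 by blast
    obtain F where F: "F \<subseteq> J i" "finite F" "card F = k"
      using infinite_arbitrarily_large[OF inf] by blast
    have "d \<le> s n powr p" if "n \<in> F" for n
      using that F(1) p unfolding d_def by (intro powr_mono2) (auto simp: J_def)
    then have "real k * d \<le> (\<Sum>n\<in>F. s n powr p)" using sum_mono[of F "\<lambda>_. d"] F(3) by simp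
    also have "\<dots> \<le> M" using F JI by (intro M) auto
    finally show False using k d by (simp add: field_simps)
  qed
  define g where "g n x = (complex_of_real (s n) * cinner (e n) x) *\<^sub>C f n" for n x
  define R where "R i x = (\<Sum>n\<in>J i. g n x)" for i x
  have gV: "g n x \<in> V" if "n \<in> I" for n x
    using I[OF that] V by (simp add: g_def cvs.subspace_scale)
  have rank: "finite_rank U V (card (J i)) (R i)" for i
  proof -
    have "norm (R i x) \<le> (\<Sum>n\<in>J i. s n) * norm x" for x
    proof -
      have "norm (g n x) \<le> s n * norm x" if "n \<in> J i" for n
      proof -
        have n: "n \<in> I" "0 < s n" using that JI I by auto
        have "cmod (cinner (e n) x) \<le> norm x"
          using cinner_Cauchy_Schwarz[of "e n" x] orthonormal_norm[OF e n(1)] by simp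
        then show ?thesis
          using n(2) orthonormal_norm[OF f n(1)] by (simp add: g_def norm_scaleC norm_mult)
      qed
      then show ?thesis
        using sum_norm_le[of "J i" "\<lambda>n. g n x" "\<lambda>n. s n * norm x"] by (simp add: R_def
          sum_distrib_right)
    qed
    moreover have "R i x \<in> V" for x
      unfolding R_def using gV JI by (intro cvs.subspace_sum[OF V]) auto
    moreover have "R i (x + y) = R i x + R i y" for x y
      by (simp add: R_def g_def cinner_add_right distrib_left scaleC_add_left sum.distrib)
    moreover have "R i (a *\<^sub>C x) = a *\<^sub>C R i x" for a x
      by (simp add: R_def g_def cinner_scaleC_right scaleC_scaleC cvs.scale_sum_right mult_ac)
    ultimately have "bounded_clinear_on U V (R i)" by (intro bounded_clinear_onI) auto
    moreover have "R i x \<in> cvs.span (f ` J i)" for x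
      unfolding R_def g_def by (intro cvs.span_sum cvs.span_scale cvs.span_base) auto
    moreover have "f ` J i \<subseteq> V" using I JI by auto
    ultimately show ?thesis
      unfolding finite_rank_def by (intro conjI exI[of _ "f ` J i"]) (simp_all add: fin card_image_le)
  qed
  have err: "norm (T x - R i x) \<le> 1 * (1/2) ^ (i * 1) * norm x" if x: "x \<in> U" for i x
  proof -
    have "((\<lambda>n. g n x) has_sum T x) I" using hs[OF x] by (simp add: g_def)
    moreover have "((\<lambda>n. g n x) has_sum R i x) (J i)" unfolding R_def by (rule has_sum_finite[OF fin])
    ultimately have "((\<lambda>n. g n x) has_sum (T x - R i x)) (I - J i)" using JI by (rule has_sum_Diff)
    then have "((\<lambda>F. norm (\<Sum>n\<in>F. g n x)) \<longlongrightarrow> norm (T x - R i x)) (finite_subsets_at_top (I - J i))"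
      unfolding has_sum_def by (rule tendsto_norm)
    moreover have "norm (\<Sum>n\<in>F. g n x) \<le> (1/2) ^ i * norm x" if F: "finite F" "F \<subseteq> I - J i" for F
    proof (rule power2_le_imp_le)
      have FI: "F \<subseteq> I" using F by auto
      have "(norm (\<Sum>n\<in>F. g n x))\<^sup>2 = (\<Sum>n\<in>F. (cmod (complex_of_real (s n) * cinner (e n) x))\<^sup>2)"
        unfolding g_def by (rule norm_orthonormal_sum[OF orthonormal_on_subset[OF f FI] F(1)])
      also have "\<dots> \<le> (\<Sum>n\<in>F. ((1/2) ^ i)\<^sup>2 * (cmod (cinner (e n) x))\<^sup>2)"
      proof (rule sum_mono)
        fix n assume "n \<in> F"
        then have "0 < s n" "s n \<le> (1/2) ^ i" using F(2) I by (auto simp: J_def not_less)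
        then show "(cmod (complex_of_real (s n) * cinner (e n) x))\<^sup>2 \<le> ((1/2) ^ i)\<^sup>2 * (cmod
          (cinner (e n) x))\<^sup>2"
          unfolding norm_mult power_mult_distrib by (intro mult_right_mono power_mono) auto
      qed
      also have "\<dots> \<le> ((1/2) ^ i)\<^sup>2 * (norm x)\<^sup>2"
        unfolding sum_distrib_left[symmetric]
        by (intro mult_left_mono Bessel[OF orthonormal_on_subset[OF e FI] F(1)]) simp
      finally show "(norm (\<Sum>n\<in>F. g n x))\<^sup>2 \<le> ((1/2) ^ i * norm x)\<^sup>2" by (simp only: power_mult_distrib)
    qed simp
    ultimately have "norm (T x - R i x) \<le> (1/2) ^ i * norm x"
      by (intro tendsto_upperbound[where F="finite_subsets_at_top (I - J i)"])
        (auto intro!: eventually_finite_subsets_at_top_weakI)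
    then show ?thesis by simp
  qed
  have "summable (\<lambda>i. (1/2) ^ (i * N) * real (card (J i)))"
  proof (rule summableI_nonneg_bounded)
    fix m
    \<comment> \<open>Every truncation set up to level m lies in the finite set \<open>J m\<close>,
      which makes the inner range independent of i.\<close>
    have "(\<Sum>i<m. (1/2) ^ (i * N) * real (card (J i)))
        = (\<Sum>i<m. \<Sum>n\<in>J m. if (1/2) ^ i < s n then (1/2::real) ^ (i * N) else 0)"
    proof (intro sum.cong refl)
      fix i assume "i \<in> {..<m}"
      then have "(1/2::real) ^ m \<le> (1/2) ^ i" by (intro power_decreasing) auto
      then have "(1/2) ^ m < s n" if "(1/2) ^ i < s n" for n
        using that by (rule order.strict_trans1)
      then have "J i = {n \<in> J m. (1/2) ^ i < s n}" by (auto simp: J_def)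
      then show "(1/2) ^ (i * N) * real (card (J i)) = (\<Sum>n\<in>J m. if (1/2) ^ i < s n then (1/2::real)
        ^ (i * N) else 0)"
        using sum.inter_filter[OF fin[of m], of "\<lambda>_. (1/2::real) ^ (i * N)" "\<lambda>n. (1/2) ^ i < s n"]
          by (simp add: mult.commute)
    qed
    also have "\<dots> = (\<Sum>n\<in>J m. \<Sum>i<m. if (1/2) ^ i < s n then (1/2::real) ^ (i * N) else 0)"
      by (rule sum.swap)
    also have "\<dots> \<le> (\<Sum>n\<in>J m. 2 * s n powr p)"
      using I JI p by (intro sum_mono truncated_geometric_sum_le) auto
    also have "\<dots> \<le> 2 * M"
      using M[OF fin JI] by (simp flip: sum_distrib_left)
    finally show "(\<Sum>i<m. (1/2) ^ (i * N) * real (card (J i))) \<le> 2 * M" .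
  qed simp
  then have "approx_by N 1 U V T R (\<lambda>i. card (J i)) 1"
    unfolding approx_by_def using rank err by simp
  then show ?thesis using Tb by (auto simp: approximable_def)
qed

section \<open>The differential graded category of a Fredholm module\<close>

lemma approximable_zero:
  assumes "cvs.subspace V"
  shows "approximable N k U V (\<lambda>_. 0)"
proof -
  have b: "bounded_clinear_on U V (\<lambda>_. 0)"
    by (rule bounded_clinear_onI[where K=0]) (auto simp: cvs.subspace_0[OF assms])
  then have "finite_rank U V 0 (\<lambda>_. 0)"
    unfolding finite_rank_def by (intro conjI exI[of _ "{}"]) auto
  then have "approx_by N k U V (\<lambda>_. 0) (\<lambda>_ _. 0) (\<lambda>_. 0) 0"
    by (simp add: approx_by_def)
  with b show ?thesis by (auto simp: approximable_def)
qed

context even_fredholm_module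
begin

abbreviation "H \<equiv> Hsp M"
abbreviation "F \<equiv> Fop M"
abbreviation "\<gamma> \<equiv> grading_op M"

lemma Hgr_subset_H: "X \<in> Obj C \<Longrightarrow> Hgr M X i \<subseteq> H X"
proof
  fix x assume X: "X \<in> Obj C" and x: "x \<in> Hgr M X i"
  have "0 \<in> Hgr M X j" for j by (rule cvs.subspace_0[OF Hgr_subspace[OF X]])
  moreover have "i = 0 \<or> i = 1" by (cases i) auto
  ultimately show "x \<in> H X" unfolding Hsp_def using x by (metis (mono_tags, lifting)
    add.left_neutral add.right_neutral mem_Collect_eq)
qed

lemma H_subspace: "X \<in> Obj C \<Longrightarrow> cvs.subspace (H X)"
  using cvs.subspace_sums[OF Hgr_subspace Hgr_subspace] by (simp add: Hsp_def)

lemma H_onb: "X \<in> Obj C \<Longrightarrow> onb_space (H X)"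
  by (rule onb_spaceI[OF H_subspace Hsp_separable])

lemma H_cases:
  assumes "x \<in> H X"
  obtains u v where "u \<in> Hgr M X 0" "v \<in> Hgr M X 1" "x = u + v"
  using assms by (auto simp: Hsp_def)

lemma grading_sum:
  assumes X: "X \<in> Obj C" and u: "u \<in> Hgr M X 0" and v: "v \<in> Hgr M X 1"
  shows "\<gamma> X (u + v) = u - v"
  unfolding grading_op_def
proof (rule the_equality)
  show "\<exists>u'\<in>Hgr M X 0. \<exists>v'\<in>Hgr M X 1. u + v = u' + v' \<and> u - v = u' - v'" using u v by blast
  fix y assume "\<exists>u'\<in>Hgr M X 0. \<exists>v'\<in>Hgr M X 1. u + v = u' + v' \<and> y = u' - v'"
  then obtain u' v' where u': "u' \<in> Hgr M X 0" and v': "v' \<in> Hgr M X 1" and e: "u + v = u' + v'"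
    and y: "y = u' - v'"
    by blast
  have "u - u' = v' - v" using e by (simp add: algebra_simps)
  \<comment> \<open>The vector u - u' = v' - v lies in both graded parts, hence is orthogonal to
    itself.\<close>
  moreover have "cinner (u - u') (v' - v) = 0"
    using u u' v v' by (intro Hgr_orthogonal[OF X] cvs.subspace_diff[OF Hgr_subspace[OF X]])
  ultimately have "u - u' = 0" using cinner_self[of "u - u'"] by simp
  with e y show "y = u - v" by auto
qed

lemma grading_bounded:
  assumes X: "X \<in> Obj C"
  shows "bounded_clinear_on (H X) (H X) (\<gamma> X)"
proof (rule bounded_clinear_onI[where K=1])
  note s0 = Hgr_subspace[OF X, of 0] and s1 = Hgr_subspace[OF X, of 1] and sH = H_subspace[OF X]
  fix x y a assume x: "x \<in> H X"
  obtain u v where x': "u \<in> Hgr M X 0" "v \<in> Hgr M X 1" "x = u + v" using H_cases[OF x] .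
  show "\<gamma> X x \<in> H X"
    using cvs.subspace_diff[OF sH] subsetD[OF Hgr_subset_H[OF X] x'(1)] subsetD[OF Hgr_subset_H[OF
      X] x'(2)]
    unfolding x'(3) grading_sum[OF X x'(1,2)] .
  have "a *\<^sub>C x = a *\<^sub>C u + a *\<^sub>C v" using x' by (simp add: scaleC_add_right)
  then show "\<gamma> X (a *\<^sub>C x) = a *\<^sub>C \<gamma> X x"
    using x' cvs.subspace_scale[OF s0] cvs.subspace_scale[OF s1]
    by (simp add: grading_sum[OF X] cvs.scale_right_diff_distrib)
  have "cinner u v = 0" "cinner v u = 0"
    using Hgr_orthogonal[OF X x'(1,2)] cinner_commute[of v u] by simp_all
  then have "cinner (u - v) (u - v) = cinner (u + v) (u + v)"
    by (simp add: cinner_diff_left cinner_diff_right cinner_add_left cinner_add_right)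
  then show "norm (\<gamma> X x) \<le> 1 * norm x"
    using x' by (simp add: grading_sum[OF X] norm_eq_sqrt_cinner)
  assume y: "y \<in> H X"
  obtain u' v' where y': "u' \<in> Hgr M X 0" "v' \<in> Hgr M X 1" "y = u' + v'" using H_cases[OF y] .
  have xy: "x + y = (u + u') + (v + v')" using x' y' by simp
  have "\<gamma> X (x + y) = (u + u') - (v + v')"
    unfolding xy using x' y' cvs.subspace_add[OF s0] cvs.subspace_add[OF s1] by (intro
      grading_sum[OF X]) auto
  then show "\<gamma> X (x + y) = \<gamma> X x + \<gamma> X y"
    unfolding x'(3) y'(3) grading_sum[OF X x'(1,2)] grading_sum[OF X y'(1,2)] by simp
qed

lemma grading_grading:
  assumes X: "X \<in> Obj C" and x: "x \<in> H X"
  shows "\<gamma> X (\<gamma> X x) = x"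
proof -
  obtain u v where x': "u \<in> Hgr M X 0" "v \<in> Hgr M X 1" "x = u + v" using H_cases[OF x] .
  have "- v \<in> Hgr M X 1" using x' cvs.subspace_neg[OF Hgr_subspace[OF X]] by blast
  then show ?thesis using x' grading_sum[OF X x'(1), of "- v"] by (simp add: grading_sum[OF X])
qed

lemma grading_commute:
  assumes X: "X \<in> Obj C" and Y: "Y \<in> Obj C" and A: "clinear_on (H X) (H Y) A"
    and d: "has_degree M X Y (of_nat n) A" and x: "x \<in> H X"
  shows "\<gamma> Y (A x) = (-1) ^ n *\<^sub>C A (\<gamma> X x)"
proof -
  obtain u v where x': "u \<in> Hgr M X 0" "v \<in> Hgr M X 1" "x = u + v" using H_cases[OF x] .
  have uv: "u \<in> H X" "v \<in> H X" "- v \<in> H X" using x' Hgr_subset_H[OF X] cvs.subspace_neg[OF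
    H_subspace[OF X]] by auto
  have e1: "A x = A u + A v" using clinear_onD(2)[OF A] uv x' by simp
  have "A (- v) = - A v" using clinear_onD(3)[OF A uv(2), of "-1"] by (simp add:
    cvs.scale_minus_left scaleC_one)
  then have e2: "A (\<gamma> X x) = A u - A v"
    using clinear_onD(2)[OF A uv(1,3)] x' by (simp add: grading_sum[OF X])
  have d': "A u \<in> Hgr M Y (of_nat n)" "A v \<in> Hgr M Y (1 + of_nat n)"
    using d x' unfolding has_degree_def by (metis add_0)+
  show ?thesis
  proof (cases "even n")
    case True
    then have "(of_nat n :: bit) = 0" by (metis of_nat_eq_0_iff bit_not_one_iff even_of_nat
      even_iff_mod_2_eq_zero dvd_0_right bit.exhaust odd_one)
    with d' have "\<gamma> Y (A u + A v) = A u - A v" by (intro grading_sum[OF Y]) auto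
    then show ?thesis using True e1 e2 by (simp add: scaleC_one)
  next
    case False
    then have "(of_nat n :: bit) = 1" by (metis bit.exhaust even_of_nat dvd_0_right)
    with d' have "\<gamma> Y (A v + A u) = A v - A u" by (intro grading_sum[OF Y]) auto
    then show ?thesis using False e1 e2 by (simp add: cvs.scale_minus_left scaleC_one add.commute)
  qed
qed

lemma F_H: "\<lbrakk>X \<in> Obj C; x \<in> H X\<rbrakk> \<Longrightarrow> F X x \<in> H X"
  using bounded_clinear_onD(1)[OF Fop_bounded] .

lemma grading_H: "\<lbrakk>X \<in> Obj C; x \<in> H X\<rbrakk> \<Longrightarrow> \<gamma> X x \<in> H X"
  using bounded_clinear_onD(1)[OF grading_bounded] .

lemma grading_F: "\<lbrakk>X \<in> Obj C; x \<in> H X\<rbrakk> \<Longrightarrow> \<gamma> X (F X x) = - F X (\<gamma> X x)"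
  using grading_commute[of X X "F X" 1 x] Fop_degree[of X] bounded_clinear_on_clinear[OF Fop_bounded]
  by (simp add: cvs.scale_minus_left scaleC_one)

text \<open>The graded commutator F A - (-1)^n A F, written without n: for A of degree n,
  conjugation by the grading multiplies A by (-1)^n. A differential of \<open>dg_semicat\<close>
  receives no degree as argument. Values off \<open>H X\<close> are set to 0 so that equality of
  operators is equality of functions.\<close>

definition fr_diff :: "'o \<Rightarrow> 'o \<Rightarrow> ('h \<Rightarrow> 'h) \<Rightarrow> 'h \<Rightarrow> 'h"
  where "fr_diff X Y A = (\<lambda>x. if x \<in> H X then F Y (A x) - \<gamma> Y (A (\<gamma> X (F X x))) else 0)"

definition fr_comp :: "'o \<Rightarrow> 'o \<Rightarrow> 'o \<Rightarrow> ('h \<Rightarrow> 'h) \<Rightarrow> ('h \<Rightarrow> 'h) \<Rightarrow> 'h \<Rightarrow> 'h"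
  where "fr_comp X Y Z B A = (\<lambda>x. if x \<in> H X then B (A x) else 0)"

text \<open>Approximability with exponent n plays the role of the Schatten class of exponent N/n.
  The condition on the commutator is imposed separately, since for a general A it would not follow;
  it makes the spaces stable under the differential.\<close>

definition fr_hom :: "nat \<Rightarrow> nat \<Rightarrow> 'o \<Rightarrow> 'o \<Rightarrow> ('h \<Rightarrow> 'h) set"
  where "fr_hom N n X Y = {A. approximable N n (H X) (H Y) A \<and> (\<forall>x. x \<notin> H X \<longrightarrow> A x = 0) \<and>
    has_degree M X Y (of_nat n) A \<and> approximable N (Suc n) (H X) (H Y) (fr_diff X Y A)}"

definition fr_rho :: "'o \<Rightarrow> 'o \<Rightarrow> 'm \<Rightarrow> 'h \<Rightarrow> 'h"
  where "fr_rho X Y f = (\<lambda>x. if x \<in> H X then Hmap M X Y f x else 0)"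

definition fr_dg :: "nat \<Rightarrow> ('o, 'h \<Rightarrow> 'h) dg_semicat"
  where "fr_dg N = \<lparr>DObj = Obj C, DHom = fr_hom N, DComp = fr_comp, DDiff = fr_diff\<rparr>"

lemma fr_dg_simps [simp]:
  "DObj (fr_dg N) = Obj C" "DHom (fr_dg N) = fr_hom N" "DComp (fr_dg N) = fr_comp" "DDiff (fr_dg N)
    = fr_diff"
  by (simp_all add: fr_dg_def)

lemma fr_homD:
  assumes "A \<in> fr_hom N n X Y"
  shows "approximable N n (H X) (H Y) A" "x \<notin> H X \<Longrightarrow> A x = 0" "has_degree M X Y (of_nat n) A"
    "approximable N (Suc n) (H X) (H Y) (fr_diff X Y A)" "bounded_clinear_on (H X) (H Y) A"
  using assms approximable_bounded by (auto simp: fr_hom_def)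

lemma fr_hom_H: "\<lbrakk>A \<in> fr_hom N n X Y; x \<in> H X\<rbrakk> \<Longrightarrow> A x \<in> H Y"
  using bounded_clinear_onD(1)[OF fr_homD(5)] .

lemma fr_hom_grading:
  "\<lbrakk>X \<in> Obj C; Y \<in> Obj C; A \<in> fr_hom N n X Y; x \<in> H X\<rbrakk> \<Longrightarrow> \<gamma> Y (A x) = (-1) ^ n *\<^sub>C A (\<gamma> X x)"
  using grading_commute bounded_clinear_on_clinear fr_homD(3,5) by metis

lemma fr_diff_eq:
  assumes X: "X \<in> Obj C" and Y: "Y \<in> Obj C" and A: "A \<in> fr_hom N n X Y" and x: "x \<in> H X"
  shows "fr_diff X Y A x = F Y (A x) - (-1) ^ n *\<^sub>C A (F X x)"
  using fr_hom_grading[OF X Y A grading_H[OF X F_H[OF X x]]] x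
  by (simp add: fr_diff_def grading_grading[OF X F_H[OF X x]])

lemma fr_diff_linear:
  assumes X: "X \<in> Obj C" and Y: "Y \<in> Obj C"
    and A: "\<And>x. x \<in> H X \<Longrightarrow> A x \<in> H Y" and B: "\<And>x. x \<in> H X \<Longrightarrow> B x \<in> H Y"
  shows "fr_diff X Y (\<lambda>x. A x + B x) = (\<lambda>x. fr_diff X Y A x + fr_diff X Y B x)"
    and "fr_diff X Y (\<lambda>x. a *\<^sub>C A x) = (\<lambda>x. a *\<^sub>C fr_diff X Y A x)"
  using A B bounded_clinear_onD(2,3)[OF grading_bounded[OF Y]] bounded_clinear_onD(2,3)[OF
    Fop_bounded[OF Y]]
    F_H[OF X] grading_H[OF X]
  by (auto simp: fr_diff_def fun_eq_iff algebra_simps cvs.scale_right_diff_distrib)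

lemma fr_hom_subspace:
  assumes X: "X \<in> Obj C" and Y: "Y \<in> Obj C"
  shows "cvs.subspace (fr_hom N n X Y)"
proof -
  note sY = H_subspace[OF Y]
  have "fr_diff X Y (\<lambda>_. 0) = (\<lambda>_. 0)"
    using fr_diff_linear(2)[OF X Y, of "\<lambda>_. 0" "\<lambda>_. 0" 0] cvs.subspace_0[OF sY] by simp
  then have "(\<lambda>_. 0) \<in> fr_hom N n X Y"
    using approximable_zero[OF sY, where U="H X"] cvs.subspace_0[OF Hgr_subspace[OF Y]] by (simp
      add: fr_hom_def has_degree_def)
  moreover have "(\<lambda>x. A x + B x) \<in> fr_hom N n X Y" if A: "A \<in> fr_hom N n X Y" and B: "B \<in> fr_hom N
    n X Y" for A B
    using fr_homD(2,3)[OF A] fr_homD(2,3)[OF B] cvs.subspace_add[OF Hgr_subspace[OF Y]]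
      approximable_add[OF sY fr_homD(1)[OF A] fr_homD(1)[OF B]]
      approximable_add[OF sY fr_homD(4)[OF A] fr_homD(4)[OF B]]
    by (simp add: fr_hom_def has_degree_def fr_diff_linear(1)[OF X Y fr_hom_H[OF A] fr_hom_H[OF B]])
  moreover have "(\<lambda>x. a *\<^sub>C A x) \<in> fr_hom N n X Y" if A: "A \<in> fr_hom N n X Y" for a A
    using fr_homD(2,3)[OF A] cvs.subspace_scale[OF Hgr_subspace[OF Y]]
      approximable_scale[OF sY fr_homD(1)[OF A]] approximable_scale[OF sY fr_homD(4)[OF A]]
    by (simp add: fr_hom_def has_degree_def fr_diff_linear(2)[OF X Y fr_hom_H[OF A] fr_hom_H[OF A]])
  ultimately show ?thesis
    unfolding cvs.subspace_def zero_fun_def plus_fun_def scaleC_fun_def by blast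
qed

text \<open>From F^2 = 1, \<gamma>^2 = 1 and \<gamma> F = - F \<gamma>, the four terms of the double
  commutator cancel in pairs.\<close>

lemma fr_diff_fr_diff:
  assumes X: "X \<in> Obj C" and Y: "Y \<in> Obj C" and A: "A \<in> fr_hom N n X Y"
  shows "fr_diff X Y (fr_diff X Y A) = (\<lambda>_. 0)"
proof
  fix x
  show "fr_diff X Y (fr_diff X Y A) x = 0"
  proof (cases "x \<in> H X")
    case x: True
    note Fl = bounded_clinear_onD[OF Fop_bounded[OF Y]] and gl = bounded_clinear_onD[OF
      grading_bounded[OF Y]]
    note FX = F_H[OF X x] and sY = H_subspace[OF Y]
    have m: "F Y (- z) = - F Y z" "\<gamma> Y (- z) = - \<gamma> Y z" if "z \<in> H Y" for z
      using Fl(3)[OF that, of "-1"] gl(3)[OF that, of "-1"] by (simp_all add: cvs.scale_minus_left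
        scaleC_one)
    define a where "a = A x"
    define b where "b = A (\<gamma> X (F X x))"
    have a: "a \<in> H Y" and b: "b \<in> H Y"
      unfolding a_def b_def using fr_hom_H[OF A] x grading_H[OF X FX] by auto
    have d1: "fr_diff X Y A x = F Y a - \<gamma> Y b" using x by (simp add: fr_diff_def a_def b_def)
    have "A (- x) = - A x"
      using bounded_clinear_onD(3)[OF fr_homD(5)[OF A] x, of "-1"] by (simp add:
        cvs.scale_minus_left scaleC_one)
    moreover have "\<gamma> X (F X (\<gamma> X (F X x))) = - x"
      using grading_F[OF X grading_H[OF X FX]] grading_grading[OF X FX] Fop_Fop[OF X x] by simp
    ultimately have d2: "fr_diff X Y A (\<gamma> X (F X x)) = F Y b + \<gamma> Y a"
      using grading_H[OF X FX] m(2)[OF a] by (simp add: fr_diff_def a_def b_def)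
    have "F Y (F Y a - \<gamma> Y b) = a + \<gamma> Y (F Y b)"
      using Fl(2)[of "F Y a" "- \<gamma> Y b"] m(1)[OF grading_H[OF Y b]] a b grading_F[OF Y b] Fop_Fop[OF Y a]
        cvs.subspace_neg[OF sY grading_H[OF Y b]] F_H[OF Y a] by simp
    moreover have "\<gamma> Y (F Y b + \<gamma> Y a) = \<gamma> Y (F Y b) + a"
      using gl(2)[OF F_H[OF Y b] grading_H[OF Y a]] grading_grading[OF Y a] by simp
    ultimately show ?thesis
      using x d1 d2 by (simp add: fr_diff_def[of X Y "fr_diff X Y A"])
  qed (simp add: fr_diff_def)
qed

lemma fr_diff_hom:
  assumes X: "X \<in> Obj C" and Y: "Y \<in> Obj C" and A: "A \<in> fr_hom N n X Y"
  shows "fr_diff X Y A \<in> fr_hom N (Suc n) X Y"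
proof -
  have "fr_diff X Y A x \<in> Hgr M Y (i + of_nat (Suc n))" if x: "x \<in> Hgr M X i" for i x
  proof -
    have xH: "x \<in> H X" using x Hgr_subset_H[OF X] by auto
    have "F Y (A x) \<in> Hgr M Y (i + of_nat n + 1)"
      using Fop_degree[OF Y] fr_homD(3)[OF A] x unfolding has_degree_def by blast
    moreover have "A (F X x) \<in> Hgr M Y (i + 1 + of_nat n)"
      using Fop_degree[OF X] fr_homD(3)[OF A] x unfolding has_degree_def by blast
    moreover have "i + of_nat n + 1 = i + of_nat (Suc n)" "i + 1 + of_nat n = i + of_nat (Suc n)"
      by (simp_all only: of_nat_Suc ac_simps)
    ultimately show ?thesis
      unfolding fr_diff_eq[OF X Y A xH]
      by (metis cvs.subspace_diff[OF Hgr_subspace[OF Y]] cvs.subspace_scale[OF Hgr_subspace[OF Y]])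
  qed
  then show ?thesis
    using fr_homD(4)[OF A] approximable_zero[OF H_subspace[OF Y], where U="H X"]
    by (simp add: fr_hom_def has_degree_def fr_diff_fr_diff[OF X Y A]) (simp add: fr_diff_def)
qed

lemma fr_Leibniz:
  assumes X: "X \<in> Obj C" and Y: "Y \<in> Obj C" and Z: "Z \<in> Obj C"
    and A: "A \<in> fr_hom N i X Y" and B: "B \<in> fr_hom N j Y Z"
  shows "fr_diff X Z (fr_comp X Y Z B A) =
    (\<lambda>x. fr_comp X Y Z (fr_diff Y Z B) A x + (-1) ^ j *\<^sub>C fr_comp X Y Z B (fr_diff X Y A) x)"
proof
  fix x
  show "fr_diff X Z (fr_comp X Y Z B A) x =
    fr_comp X Y Z (fr_diff Y Z B) A x + (-1) ^ j *\<^sub>C fr_comp X Y Z B (fr_diff X Y A) x"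
  proof (cases "x \<in> H X")
    case x: True
    note Bl = bounded_clinear_onD[OF fr_homD(5)[OF B]]
    define u where "u = F Y (A x)"
    define v where "v = A (F X x)"
    have Ax: "A x \<in> H Y" and u: "u \<in> H Y" and v: "v \<in> H Y"
      using fr_hom_H[OF A] F_H[OF Y] F_H[OF X] x by (auto simp: u_def v_def)
    have sv: "(-1) ^ i *\<^sub>C v \<in> H Y" using v cvs.subspace_scale[OF H_subspace[OF Y]] by simp
    have "B (u - (-1) ^ i *\<^sub>C v) = B u - (-1) ^ i *\<^sub>C B v"
      using Bl(2)[of "u - (-1) ^ i *\<^sub>C v" "(-1) ^ i *\<^sub>C v"] Bl(3)[OF v] u sv cvs.subspace_diff[OF
        H_subspace[OF Y]]
      by simp
    then have 1: "fr_comp X Y Z B (fr_diff X Y A) x = B u - (-1) ^ i *\<^sub>C B v"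
      using x by (simp add: fr_comp_def fr_diff_eq[OF X Y A x] u_def v_def)
    have 2: "fr_comp X Y Z (fr_diff Y Z B) A x = F Z (B (A x)) - (-1) ^ j *\<^sub>C B u"
      using x by (simp add: fr_comp_def fr_diff_eq[OF Y Z B Ax] u_def)
    have g: "\<gamma> X (F X x) \<in> H X" by (intro grading_H F_H X x)
    have "\<gamma> Z (B (A (\<gamma> X (F X x)))) = (-1) ^ j *\<^sub>C (-1) ^ i *\<^sub>C B v"
    proof -
      have "\<gamma> Z (B (A (\<gamma> X (F X x)))) = (-1) ^ j *\<^sub>C B (\<gamma> Y (A (\<gamma> X (F X x))))"
        by (rule fr_hom_grading[OF Y Z B fr_hom_H[OF A g]])
      also have "\<gamma> Y (A (\<gamma> X (F X x))) = (-1) ^ i *\<^sub>C v"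
        using fr_hom_grading[OF X Y A g] grading_grading[OF X F_H[OF X x]] by (simp add: v_def)
      finally show ?thesis using Bl(3)[OF v] by simp
    qed
    then have "fr_diff X Z (fr_comp X Y Z B A) x = F Z (B (A x)) - (-1) ^ j *\<^sub>C (-1) ^ i *\<^sub>C B v"
      using x g by (simp add: fr_diff_def fr_comp_def)
    then show ?thesis unfolding 1 2 by (simp add: cvs.scale_right_diff_distrib)
  qed (simp add: fr_diff_def fr_comp_def)
qed

text \<open>Decay exponents add under composition. For the condition on the commutator, the Leibniz
  rule gives two products, each with one extra unit of decay.\<close>

lemma fr_comp_hom:
  assumes X: "X \<in> Obj C" and Y: "Y \<in> Obj C" and Z: "Z \<in> Obj C"
    and A: "A \<in> fr_hom N i X Y" and B: "B \<in> fr_hom N j Y Z"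
  shows "fr_comp X Y Z B A \<in> fr_hom N (j + i) X Z"
proof -
  note s = H_subspace[OF X] H_subspace[OF Y] H_subspace[OF Z]
  have c: "approximable N (l + k) (H X) (H Z) (fr_comp X Y Z B' A')"
    if "approximable N l (H Y) (H Z) B'" "approximable N k (H X) (H Y) A'" for B' A' l k
    using approximable_comp[OF s that] approximable_cong[OF s(1), of "fr_comp X Y Z B' A'" "\<lambda>x. B'
      (A' x)" N "l + k" "H Z"]
    by (simp add: fr_comp_def)
  have "approximable N (Suc j + i) (H X) (H Z) (fr_comp X Y Z (fr_diff Y Z B) A)"
    by (rule c[OF fr_homD(4)[OF B] fr_homD(1)[OF A]])
  moreover have "approximable N (j + Suc i) (H X) (H Z) (fr_comp X Y Z B (fr_diff X Y A))"
    by (rule c[OF fr_homD(1)[OF B] fr_homD(4)[OF A]])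
  ultimately have "approximable N (Suc (j + i)) (H X) (H Z) (fr_diff X Z (fr_comp X Y Z B A))"
    unfolding fr_Leibniz[OF X Y Z A B]
    by (intro approximable_add[OF s(3)] approximable_scale[OF s(3)]) simp_all
  moreover have "has_degree M X Z (of_nat (j + i)) (fr_comp X Y Z B A)"
    unfolding has_degree_def
  proof (intro allI ballI)
    fix d x assume x: "x \<in> Hgr M X d"
    then have "B (A x) \<in> Hgr M Z (d + of_nat i + of_nat j)"
      using fr_homD(3)[OF A] fr_homD(3)[OF B] unfolding has_degree_def by blast
    moreover have "d + of_nat i + of_nat j = d + of_nat (j + i)" by (simp only: of_nat_add ac_simps)
    moreover have "x \<in> H X" using x Hgr_subset_H[OF X] by auto
    ultimately show "fr_comp X Y Z B A x \<in> Hgr M Z (d + of_nat (j + i))" by (simp add: fr_comp_def)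
  qed
  ultimately show ?thesis
    using c[OF fr_homD(1)[OF B] fr_homD(1)[OF A]] by (simp add: fr_hom_def) (simp add: fr_comp_def)
qed

lemma fr_comp_linear_left:
  assumes "X \<in> Obj C" "Y \<in> Obj C" "Z \<in> Obj C" "A \<in> fr_hom N i X Y"
  shows "clinear_on (fr_hom N j Y Z) (fr_hom N (j + i) X Z) (\<lambda>B. fr_comp X Y Z B A)"
  using fr_comp_hom[OF assms]
  by (auto simp: clinear_on_def fr_comp_def plus_fun_def scaleC_fun_def fun_eq_iff)

lemma fr_comp_linear_right:
  assumes "X \<in> Obj C" "Y \<in> Obj C" "Z \<in> Obj C" "B \<in> fr_hom N j Y Z"
  shows "clinear_on (fr_hom N i X Y) (fr_hom N (j + i) X Z) (\<lambda>A. fr_comp X Y Z B A)"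
  unfolding clinear_on_def
proof (intro conjI ballI allI)
  note Bl = bounded_clinear_onD[OF fr_homD(5)[OF assms(4)]]
  fix A assume A: "A \<in> fr_hom N i X Y"
  show "fr_comp X Y Z B A \<in> fr_hom N (j + i) X Z" by (rule fr_comp_hom[OF assms(1-3) A assms(4)])
  show "fr_comp X Y Z B (a *\<^sub>C A) = a *\<^sub>C fr_comp X Y Z B A" for a
    using Bl(3)[OF fr_hom_H[OF A]] by (auto simp: fr_comp_def scaleC_fun_def fun_eq_iff)
  fix A' assume A': "A' \<in> fr_hom N i X Y"
  show "fr_comp X Y Z B (A + A') = fr_comp X Y Z B A + fr_comp X Y Z B A'"
    using Bl(2)[OF fr_hom_H[OF A] fr_hom_H[OF A']] by (auto simp: fr_comp_def fun_eq_iff)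
qed

lemma fr_dg_semicategory: "dg_semicategory (fr_dg N)"
proof (unfold_locales, goal_cases)
  case (1 X Y n) then show ?case by (simp add: fr_hom_subspace)
next
  case (2 X Y Z f i j) then show ?case by (simp add: fr_comp_linear_left)
next
  case (3 X Y Z g j i) then show ?case by (simp add: fr_comp_linear_right)
next
  case (4 W X Y Z f i g j h k)
  then show ?case using fr_hom_H by (auto simp: fr_comp_def fun_eq_iff)
next
  case (5 X Y n)
  then show ?case
    using fr_diff_hom[of X Y] fr_diff_linear[of X Y, OF _ _ fr_hom_H fr_hom_H]
    by (auto simp: clinear_on_def plus_fun_def scaleC_fun_def)
next
  case (6 X Y f n) then show ?case by (simp add: fr_diff_fr_diff zero_fun_def)
next
  case (7 X Y Z f i g j) then show ?case by (simp add: fr_Leibniz plus_fun_def scaleC_fun_def)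
qed

end

text \<open>The dyadic weights 2^(-iN) call for an integral exponent, so p is replaced by an integer
  \<open>N\<close> above it. The final theorem takes N = 2m + 1.\<close>

locale summable_fredholm_module = even_fredholm_module C p M
  for C :: "('o, 'm::complex_vector) lin_cat"
    and p :: real
    and M :: "('o, 'm, 'h::complex_hilbert_space) fredholm_module" +
  fixes N :: nat
  assumes p_pos: "0 < p" and p_le: "p \<le> real N"
begin

lemma N_pos: "0 < N"
  using p_pos p_le by linarith

lemma F_comm_approximable:
  "\<lbrakk>X \<in> Obj C; Y \<in> Obj C; f \<in> Hom C X Y\<rbrakk> \<Longrightarrow> approximable N 1 (H X) (H Y) (F_comm M X Y f)"
  by (rule schatten_approximable[OF F_comm_schatten p_pos p_le H_subspace])

lemma fr_diff_fr_rho: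
  assumes X: "X \<in> Obj C" and Y: "Y \<in> Obj C" and f: "f \<in> Hom C X Y" and x: "x \<in> H X"
  shows "fr_diff X Y (fr_rho X Y f) x = F_comm M X Y f x"
proof -
  note g = grading_H[OF X F_H[OF X x]]
  have "\<gamma> Y (Hmap M X Y f (\<gamma> X (F X x))) = Hmap M X Y f (F X x)"
    using grading_commute[OF X Y bounded_clinear_on_clinear[OF Hmap_bounded[OF X Y f]], of 0 "\<gamma> X
      (F X x)"]
      Hmap_degree[OF X Y f] g grading_grading[OF X F_H[OF X x]] by (simp add: scaleC_one)
  then show ?thesis using x g by (simp add: fr_diff_def fr_rho_def F_comm_def)
qed

lemma fr_rho_hom:
  assumes X: "X \<in> Obj C" and Y: "Y \<in> Obj C" and f: "f \<in> Hom C X Y"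
  shows "fr_rho X Y f \<in> fr_hom N 0 X Y"
proof -
  have "approximable N 0 (H X) (H Y) (fr_rho X Y f)"
    using approximable_0[OF H_subspace[OF Y] Hmap_bounded[OF X Y f]]
      approximable_cong[OF H_subspace[OF X], of "fr_rho X Y f" "Hmap M X Y f"] by (simp add: fr_rho_def)
  moreover have "approximable N 1 (H X) (H Y) (fr_diff X Y (fr_rho X Y f))"
    using F_comm_approximable[OF X Y f]
      approximable_cong[OF H_subspace[OF X], of "fr_diff X Y (fr_rho X Y f)" "F_comm M X Y f"]
    by (simp add: fr_diff_fr_rho[OF X Y f])
  moreover have "has_degree M X Y 0 (fr_rho X Y f)"
    using Hmap_degree[OF X Y f] Hgr_subset_H[OF X] by (auto simp: has_degree_def fr_rho_def)
  ultimately show ?thesis by (simp add: fr_hom_def) (simp add: fr_rho_def)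
qed

lemma fr_dg_over: "dg_over C (fr_dg N) (\<lambda>X. X) fr_rho"
proof (intro dg_over.intro dg_over_axioms.intro linear_category_axioms fr_dg_semicategory)
  show "clinear_on (Hom C X Y) (DHom (fr_dg N) 0 X Y) (fr_rho X Y)" if "X \<in> Obj C" "Y \<in> Obj C" for X Y
    using that fr_rho_hom Hmap_linear[OF that]
    by (auto simp: clinear_on_def fr_rho_def plus_fun_def scaleC_fun_def fun_eq_iff)
  show "fr_rho X Z (Comp C X Y Z g f) = DComp (fr_dg N) X Y Z (fr_rho Y Z g) (fr_rho X Y f)"
    if "X \<in> Obj C" "Y \<in> Obj C" "Z \<in> Obj C" "f \<in> Hom C X Y" "g \<in> Hom C Y Z" for X Y Z f g
    using Hmap_Comp[OF that] bounded_clinear_onD(1)[OF Hmap_bounded[OF that(1,2,4)]]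
    by (auto simp: fr_rho_def fr_comp_def fun_eq_iff)
qed simp

sublocale dg: dg_over C "fr_dg N" "\<lambda>X. X" fr_rho
  by (rule fr_dg_over)

end

section \<open>Differentials of words and wrap-around of indices\<close>

context dg_over
begin

lemma DDiff_word_closed:
  assumes c: "chain C n c"
  shows "DDiff S (Yc c (a + k + 1)) (Yc c a) (word c {} a k) = 0"
proof (induction k arbitrary: a)
  case 0
  then show ?case
    using DDiff_DDiff[OF Yc_DObj[OF c] Yc_DObj[OF c] Rc_DHom[OF c]] by (simp add: word_def
      letter_def Dc_def)
next
  case (Suc k)
  let ?w = "word c {} (Suc a) k"
  note Y = Yc_DObj[OF c]
  have w: "?w \<in> DHom S (card ({Suc a..Suc a + k} - {})) (Yc c (Suc a + k + 1)) (Yc c (Suc a))"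
    by (rule word_DHom[OF c])
  have d: "Dc c a \<in> DHom S 1 (Yc c (Suc a)) (Yc c a)" by (rule Dc_DHom[OF c])
  have "DDiff S (Yc c (Suc a)) (Yc c a) (Dc c a) = 0"
    using DDiff_DDiff[OF Y Y Rc_DHom[OF c]] by (simp add: Dc_def)
  moreover have "DDiff S (Yc c (Suc a + k + 1)) (Yc c (Suc a)) ?w = 0" by (rule Suc.IH)
  moreover have "word c {} a (Suc k) = DComp S (Yc c (Suc a + k + 1)) (Yc c (Suc a)) (Yc c a) (Dc c
    a) ?w"
    by (simp add: word_def letter_def)
  ultimately show ?case
    using DDiff_Leibniz[OF Y Y Y w d] DComp_0(1)[OF Y Y Y w] DComp_0(2)[OF Y Y Y d, of "Suc a + k + 1"]
    by simp
qed

lemma DDiff_word: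
  assumes c: "chain C n c"
  shows "DDiff S (Yc c (Suc k)) (Yc c 0) (word c {0} 0 k) = word c {} 0 k"
proof (cases k)
  case 0
  then show ?thesis by (simp add: word_def letter_def Dc_def)
next
  case (Suc l)
  let ?w = "word c {} 1 l"
  note Y = Yc_DObj[OF c]
  have w: "?w \<in> DHom S (card ({1..1 + l} - {})) (Yc c (1 + l + 1)) (Yc c 1)" by (rule word_DHom[OF c])
  have r: "Rc c 0 \<in> DHom S 0 (Yc c 1) (Yc c 0)" using Rc_DHom[OF c, of 0] by simp
  have 1: "word c {0} 1 l = ?w" by (rule word_cong) auto
  have 2: "word c {0} 0 k = DComp S (Yc c (1 + l + 1)) (Yc c 1) (Yc c 0) (Rc c 0) ?w"
    using 1 Suc by (simp add: word_def letter_def)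
  have 3: "word c {} 0 k = DComp S (Yc c (1 + l + 1)) (Yc c 1) (Yc c 0) (DDiff S (Yc c 1) (Yc c 0)
    (Rc c 0)) ?w"
    using Suc by (simp add: word_def letter_def Dc_def)
  have "DDiff S (Yc c (1 + l + 1)) (Yc c 1) ?w = 0" by (rule DDiff_word_closed[OF c])
  then show ?thesis
    using DDiff_Leibniz[OF Y Y Y w r] DComp_0(2)[OF Y Y Y r, of "1 + l + 1"] Suc unfolding 2 3 by simp
qed

lemma word_wrap: "c \<noteq> [] \<Longrightarrow> word c ((\<lambda>i. i + length c) ` K) (a + length c) k = word c K a k"
  using word_rotate[of c "length c" K a k] rotate_id[of "length c" c] by simp

lemma Dc_wrap: "c \<noteq> [] \<Longrightarrow> Dc c (i + length c) = Dc c i"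
  using word_wrap[of c "{}" i 0] by (simp add: word_def letter_def)

end

section \<open>The supertrace as a closed graded trace\<close>

context summable_fredholm_module
begin

definition SG :: "'o \<Rightarrow> ('h \<Rightarrow> 'h) \<Rightarrow> complex"
  where "SG X A = op_trace (H X) (\<lambda>x. \<gamma> X (F X (A x)))"

text \<open>The supertrace in the form that needs only the commutator of A to be trace class; it is
  thus available from degree N - 1 on, one below the degree where \<open>SG\<close> is.\<close>

definition fr_trace :: "'o \<Rightarrow> ('h \<Rightarrow> 'h) \<Rightarrow> complex"
  where "fr_trace X A = 1/2 * SG X (fr_diff X X A)"

lemma approximable_bounded_comp:
  assumes "X \<in> Obj C" "Y \<in> Obj C" "Z \<in> Obj C"
    and "bounded_clinear_on (H Y) (H Z) B" "approximable N k (H X) (H Y) A"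
  shows "approximable N k (H X) (H Z) (\<lambda>x. B (A x))"
  using approximable_comp[OF H_subspace[OF assms(1)] H_subspace[OF assms(2)] H_subspace[OF assms(3)]
      approximable_0[OF H_subspace[OF assms(3)] assms(4)] assms(5)] by simp

lemma approximable_grading_F:
  assumes X: "X \<in> Obj C" and Y: "Y \<in> Obj C" and A: "approximable N k (H Y) (H X) A"
  shows "approximable N k (H Y) (H X) (\<lambda>x. \<gamma> X (F X (A x)))"
  by (rule approximable_bounded_comp[OF Y X X grading_bounded[OF X]
        approximable_bounded_comp[OF Y X X Fop_bounded[OF X] A]])

lemma SG_summable:
  assumes X: "X \<in> Obj C" and A: "A \<in> fr_hom N k X X" and k: "N \<le> k"
  shows "trace_summable (H X) (\<lambda>x. \<gamma> X (F X (A x)))"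
  by (rule approximable_trace_summable[OF H_onb[OF X] N_pos approximable_grading_F[OF X X
    fr_homD(1)[OF A]] k])

lemma SG_linear:
  assumes X: "X \<in> Obj C" and k: "N \<le> k"
  shows "clinear_on (fr_hom N k X X) UNIV (SG X)"
  unfolding clinear_on_def
proof (intro conjI ballI allI)
  note gl = bounded_clinear_onD[OF grading_bounded[OF X]] and Fl = bounded_clinear_onD[OF
    Fop_bounded[OF X]]
  fix A assume A: "A \<in> fr_hom N k X X"
  show "SG X (a *\<^sub>C A) = a *\<^sub>C SG X A" for a
  proof -
    have "SG X (a *\<^sub>C A) = op_trace (H X) (\<lambda>x. a *\<^sub>C \<gamma> X (F X (A x)))"
      unfolding SG_def
      by (rule op_trace_cong[OF H_onb[OF X]]) (simp add: scaleC_fun_def Fl fr_hom_H[OF A] gl)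
    then show ?thesis by (simp add: op_trace_scale SG_def scaleC_complex_def)
  qed
  fix B assume B: "B \<in> fr_hom N k X X"
  have "SG X (A + B) = op_trace (H X) (\<lambda>x. \<gamma> X (F X (A x)) + \<gamma> X (F X (B x)))"
    unfolding SG_def
    by (rule op_trace_cong[OF H_onb[OF X]]) (simp add: Fl fr_hom_H[OF A] fr_hom_H[OF B] gl)
  then show "SG X (A + B) = SG X A + SG X B"
    by (simp add: SG_def op_trace_add[OF SG_summable[OF X A k] SG_summable[OF X B k]])
qed simp

lemma fr_trace_linear:
  assumes X: "X \<in> Obj C" and k: "N \<le> Suc k"
  shows "clinear_on (fr_hom N k X X) UNIV (fr_trace X)"
proof -
  have d: "clinear_on (fr_hom N k X X) (fr_hom N (Suc k) X X) (fr_diff X X)"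
    using dg.DDiff_linear[of X X k] X by simp
  show ?thesis
    using clinear_onD[OF d] clinear_onD[OF SG_linear[OF X k]]
    by (simp add: clinear_on_def fr_trace_def scaleC_complex_def distrib_left)
qed

text \<open>The operator \<open>\<gamma> F\<close> commutes with every closed morphism.\<close>

lemma SG_commute:
  assumes X: "X \<in> Obj C" and Y: "Y \<in> Obj C"
    and P: "P \<in> fr_hom N k X Y" "fr_diff X Y P = 0"
    and B: "B \<in> fr_hom N l Y X" and kl: "N \<le> k + l"
  shows "SG Y (fr_comp Y X Y P B) = SG X (fr_comp X Y X B P)"
proof -
  note Pl = bounded_clinear_onD[OF fr_homD(5)[OF P(1)]] and gl = bounded_clinear_onD[OF
    grading_bounded[OF Y]]
  have FP: "F Y (P x) = (-1) ^ k *\<^sub>C P (F X x)" if x: "x \<in> H X" for x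
    using fr_diff_eq[OF X Y P(1) x] P(2) by simp
  have GFP: "\<gamma> Y (F Y (P x)) = P (\<gamma> X (F X x))" if x: "x \<in> H X" for x
  proof -
    have Fx: "F X x \<in> H X" by (rule F_H[OF X x])
    have "\<gamma> Y (F Y (P x)) = (-1) ^ k *\<^sub>C \<gamma> Y (P (F X x))"
      using FP[OF x] gl(3)[OF Pl(1)[OF Fx]] by simp
    also have "\<dots> = P (\<gamma> X (F X x))"
      using fr_hom_grading[OF X Y P(1) Fx] by (simp add: scaleC_scaleC scaleC_one flip: power_add)
    finally show ?thesis .
  qed
  have A: "approximable N l (H Y) (H X) (\<lambda>x. \<gamma> X (F X (B x)))"
    by (rule approximable_grading_F[OF X Y fr_homD(1)[OF B]])
  have "SG Y (fr_comp Y X Y P B) = op_trace (H Y) (\<lambda>x. P (\<gamma> X (F X (B x))))"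
    unfolding SG_def
    by (rule op_trace_cong[OF H_onb[OF Y]]) (simp add: fr_comp_def GFP[OF fr_hom_H[OF B]])
  also have "\<dots> = op_trace (H X) (\<lambda>x. \<gamma> X (F X (B (P x))))"
    by (rule approximable_trace_commute[OF H_onb[OF Y] H_onb[OF X] N_pos kl fr_homD(1)[OF P(1)] A])
  also have "\<dots> = SG X (fr_comp X Y X B P)"
    unfolding SG_def by (rule op_trace_cong[OF H_onb[OF X]]) (simp add: fr_comp_def)
  finally show ?thesis .
qed

text \<open>By the Leibniz rule the trace of g g' is half of \<open>SG\<close> applied to dg g' +
  (-1)^i g dg'. The factors dg and dg' are closed and can be moved around by
  \<open>SG_commute\<close>. As n is even, i and j have equal parity, and the signs match.\<close>

lemma fr_closed_graded_trace:
  assumes n: "even n" "N \<le> Suc n"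
  shows "closed_graded_trace (fr_dg N) n fr_trace"
  unfolding closed_graded_trace_def
proof (intro conjI ballI allI impI)
  fix X assume X: "X \<in> DObj (fr_dg N)"
  then show "clinear_on (DHom (fr_dg N) n X X) UNIV (fr_trace X)" using fr_trace_linear n by simp
  have z: "SG X (\<lambda>_. 0) = 0"
    using clinear_onD(3)[OF SG_linear[of X N], of "\<lambda>_. 0" 0] cvs.subspace_0[OF fr_hom_subspace, of
      X X N N] X
    by (simp add: zero_fun_def)
  show "fr_trace X (DDiff (fr_dg N) X X g) = 0" if "Suc k = n" "g \<in> DHom (fr_dg N) k X X" for k g
    using that X fr_diff_fr_diff[of X X g N k] z by (simp add: fr_trace_def)
next
  fix X Y i j g g'
  assume XY: "X \<in> DObj (fr_dg N)" "Y \<in> DObj (fr_dg N)" and ij: "i + j = n"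
    and g: "g \<in> DHom (fr_dg N) i Y X" and g': "g' \<in> DHom (fr_dg N) j X Y"
  have X: "X \<in> Obj C" and Y: "Y \<in> Obj C" and g: "g \<in> fr_hom N i Y X" and g': "g' \<in> fr_hom N j X Y"
    using XY g g' by auto
  have e: "(-1) ^ i = ((-1) ^ j :: complex)" "(-1) ^ (i * j) = ((-1) ^ j :: complex)"
    using n ij by (auto simp: minus_one_power_iff)
  define a where "a = SG X (fr_comp X Y X (fr_diff Y X g) g')"
  define b where "b = SG X (fr_comp X Y X g (fr_diff X Y g'))"
  note dg = fr_diff_hom[OF Y X g] and dg' = fr_diff_hom[OF X Y g']
  have a': "a = SG Y (fr_comp Y X Y g' (fr_diff Y X g))"
    unfolding a_def using n ij fr_diff_fr_diff[OF Y X g]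
    by (intro SG_commute[OF Y X dg _ g']) (auto simp: zero_fun_def)
  have b': "b = SG Y (fr_comp Y X Y (fr_diff X Y g') g)"
    unfolding b_def using n ij fr_diff_fr_diff[OF X Y g']
    by (intro SG_commute[OF X Y dg' _ g, symmetric]) (auto simp: zero_fun_def)
  have lin: "SG Z (\<lambda>x. A x + (-1) ^ q *\<^sub>C B x) = SG Z A + (-1) ^ q * SG Z B"
    if "Z \<in> Obj C" "A \<in> fr_hom N (Suc n) Z Z" "B \<in> fr_hom N (Suc n) Z Z" for Z A B and q :: nat
    using clinear_onD(2)[OF SG_linear[OF that(1) n(2)] that(2), of "(-1) ^ q *\<^sub>C B"]
      clinear_onD(3)[OF SG_linear[OF that(1) n(2)] that(3)] cvs.subspace_scale[OF
        fr_hom_subspace[OF that(1,1)] that(3)]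
    by (simp add: plus_fun_def scaleC_fun_def scaleC_complex_def)
  have "fr_trace X (fr_comp X Y X g g') = 1/2 * (a + (-1) ^ i * b)"
    unfolding fr_trace_def fr_Leibniz[OF X Y X g' g] a_def b_def
    using fr_comp_hom[OF X Y X g' dg] fr_comp_hom[OF X Y X dg' g] ij by (subst lin[OF X]) auto
  moreover have "fr_trace Y (fr_comp Y X Y g' g) = 1/2 * (b + (-1) ^ j * a)"
    unfolding fr_trace_def fr_Leibniz[OF Y X Y g g'] a' b'
    using fr_comp_hom[OF Y X Y g dg'] fr_comp_hom[OF Y X Y dg g'] ij by (subst lin[OF Y]) (auto
      simp: add.commute)
  moreover have "1/2 * (a + (-1) ^ i * b) = (-1) ^ (i * j) * (1/2 * (b + (-1) ^ j * a))"
    unfolding e by (cases "even j") (simp_all add: field_simps)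
  ultimately show "fr_trace X (DComp (fr_dg N) X Y X g g') = (-1) ^ (i * j) * fr_trace Y (DComp
    (fr_dg N) Y X Y g' g)"
    by (simp only: fr_dg_simps)
qed

text \<open>When A itself has enough decay, the defining trace splits into Tr(\<gamma> A) and
  -Tr(\<gamma> F A F). Moving the last F around and using F \<gamma> F = -\<gamma> turns the second
  term into another Tr(\<gamma> A), which cancels the factor 1/2.\<close>

lemma fr_trace_eq:
  assumes X: "X \<in> Obj C" and A: "A \<in> fr_hom N k X X" and k: "even k" "N \<le> k"
  shows "fr_trace X A = op_trace (H X) (\<lambda>x. \<gamma> X (A x))"
proof -
  note s = H_onb[OF X] and gl = bounded_clinear_onD[OF grading_bounded[OF X]] and Fl =
    bounded_clinear_onD[OF Fop_bounded[OF X]]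
  have ap: "approximable N k (H X) (H X) (\<lambda>x. \<gamma> X (A x))"
    by (rule approximable_bounded_comp[OF X X X grading_bounded[OF X] fr_homD(1)[OF A]])
  have ap2: "approximable N k (H X) (H X) (\<lambda>x. \<gamma> X (F X (A x)))"
    by (rule approximable_grading_F[OF X X fr_homD(1)[OF A]])
  have ap3: "approximable N (k + 0) (H X) (H X) (\<lambda>x. \<gamma> X (F X (A (F X x))))"
    using approximable_comp[OF H_subspace[OF X] H_subspace[OF X] H_subspace[OF X] ap2
        approximable_0[OF H_subspace[OF X] Fop_bounded[OF X]]] .
  have sm: "trace_summable (H X) (\<lambda>x. \<gamma> X (A x))" "trace_summable (H X) (\<lambda>x. \<gamma> X (F X (A (F X x))))"
    using approximable_trace_summable[OF s N_pos ap k(2)] approximable_trace_summable[OF s N_pos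
      ap3] k by simp_all
  have "SG X (fr_diff X X A) = op_trace (H X) (\<lambda>x. \<gamma> X (A x) - \<gamma> X (F X (A (F X x))))"
    unfolding SG_def
  proof (rule op_trace_cong[OF s])
    fix x assume x: "x \<in> H X"
    define u where "u = A x"
    define v where "v = A (F X x)"
    have u: "u \<in> H X" and v: "v \<in> H X" using fr_hom_H[OF A] x F_H[OF X] by (auto simp: u_def v_def)
    have "F X (F X u - v) = u - F X v"
      using Fl(2)[of "F X u - v" v] F_H[OF X u] v cvs.subspace_diff[OF H_subspace[OF X]] Fop_Fop[OF
        X u] by (simp add: eq_diff_eq)
    moreover have "\<gamma> X (u - F X v) = \<gamma> X u - \<gamma> X (F X v)"
      using gl(2)[of "u - F X v" "F X v"] F_H[OF X v] u cvs.subspace_diff[OF H_subspace[OF X]] by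
        (simp add: eq_diff_eq)
    ultimately show "\<gamma> X (F X (fr_diff X X A x)) = \<gamma> X (A x) - \<gamma> X (F X (A (F X x)))"
      using k by (simp add: fr_diff_eq[OF X X A x] scaleC_one u_def v_def)
  qed
  also have "\<dots> = op_trace (H X) (\<lambda>x. \<gamma> X (A x)) - op_trace (H X) (\<lambda>x. \<gamma> X (F X (A (F X x))))"
    by (rule op_trace_diff[OF sm])
  also have "op_trace (H X) (\<lambda>x. \<gamma> X (F X (A (F X x)))) = op_trace (H X) (\<lambda>x. F X (\<gamma> X (F X (A x))))"
    using approximable_trace_commute[OF s s N_pos _ ap2 approximable_0[OF H_subspace[OF X]
      Fop_bounded[OF X]]] k by simp
  also have "\<dots> = op_trace (H X) (\<lambda>x. (-1) *\<^sub>C \<gamma> X (A x))"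
  proof (rule op_trace_cong[OF s])
    fix x assume "x \<in> H X"
    then have u: "A x \<in> H X" by (rule fr_hom_H[OF A])
    have "F X (\<gamma> X (F X (A x))) = - \<gamma> X (F X (F X (A x)))"
      using grading_F[OF X F_H[OF X u]] by simp
    then show "F X (\<gamma> X (F X (A x))) = (-1) *\<^sub>C \<gamma> X (A x)"
      by (simp add: Fop_Fop[OF X u] cvs.scale_minus_left scaleC_one)
  qed
  finally show ?thesis unfolding op_trace_scale by (simp add: fr_trace_def)
qed

lemma fr_Yc: "dg.Yc c i = ob c i"
  by (simp add: dg.Yc_def)

lemma foldr_F_comm:
  assumes c: "chain C n c" and x: "x \<in> H (ob c (a + k + 1))"
  shows "foldr (\<circ>) (map (\<lambda>i. F_comm M (ob c (Suc i)) (ob c i) (mor c i)) [a..<a + k + 1]) id x =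
    dg.word c {} a k x"
  using x
proof (induction k arbitrary: a)
  case 0
  then show ?case
    using fr_diff_fr_rho[OF chain_ob[OF c] chain_ob[OF c] chain_mor[OF c], of _ a]
    by (simp add: dg.word_def dg.letter_def dg.Dc_def dg.Rc_def fr_Yc)
next
  case (Suc k)
  have u: "[a..<a + Suc k + 1] = a # [Suc a..<Suc a + k + 1]" by (simp add: upt_conv_Cons del: upt_Suc)
  have x: "x \<in> H (ob c (Suc a + k + 1))" using Suc.prems by simp
  have "dg.word c {} (Suc a) k \<in> fr_hom N (card ({Suc a..Suc a + k} - {})) (ob c (Suc a + k + 1))
    (ob c (Suc a))"
    using dg.word_DHom[OF c, of "{}" "Suc a" k] by (simp add: fr_Yc)
  from fr_hom_H[OF this x] have y: "dg.word c {} (Suc a) k x \<in> H (ob c (Suc a))" .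
  have "dg.word c {} a (Suc k) x = fr_diff (ob c (Suc a)) (ob c a) (fr_rho (ob c (Suc a)) (ob c a)
    (mor c a)) (dg.word c {} (Suc a) k x)"
    using x by (simp add: dg.word_def dg.letter_def dg.Dc_def dg.Rc_def fr_Yc fr_comp_def)
  also have "\<dots> = F_comm M (ob c (Suc a)) (ob c a) (mor c a) (dg.word c {} (Suc a) k x)"
    by (rule fr_diff_fr_rho[OF chain_ob[OF c] chain_ob[OF c] chain_mor[OF c] y])
  finally show ?case unfolding u using Suc.IH[OF x] by simp
qed

lemma fredholm_character_eq:
  assumes n: "even n"
  shows "fredholm_character C M n = dg.word_cochain n fr_trace"
proof
  fix c
  show "fredholm_character C M n c = dg.word_cochain n fr_trace c"
  proof (cases "chain C n c")
    case c: True
    let ?X = "ob c 0"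
    let ?W = "Hmap M (ob c 1) (ob c 0) (mor c 0) \<circ>
          foldr (\<circ>) (map (\<lambda>i. F_comm M (ob c (Suc i)) (ob c i) (mor c i)) [1..<Suc n]) id"
    let ?A = "dg.word c {0} 0 n"
    have X: "?X \<in> Obj C" by (rule chain_ob[OF c])
    have A: "?A \<in> fr_hom N n ?X ?X" using dg.word_0_DHom[OF c] by (simp add: fr_Yc)
    have W: "?W x = ?A x" if x: "x \<in> H ?X" for x
    proof (cases n)
      case 0
      then have "x \<in> H (ob c 1)" using x dg.Yc_Suc[OF c] by (simp add: fr_Yc)
      then show ?thesis using 0 by (simp add: dg.word_def dg.letter_def dg.Rc_def fr_rho_def)
    next
      case (Suc l)
      have x': "x \<in> H (ob c (1 + l + 1))" using x dg.Yc_Suc[OF c] Suc by (simp add: fr_Yc)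
      have "dg.word c {} 1 l \<in> fr_hom N (card ({1..1 + l} - {})) (ob c (1 + l + 1)) (ob c 1)"
        using dg.word_DHom[OF c, of "{}" 1 l] by (simp add: fr_Yc)
      from fr_hom_H[OF this x'] have y: "dg.word c {} 1 l x \<in> H (ob c 1)" .
      have "dg.word c {0} 1 l = dg.word c {} 1 l" by (rule dg.word_cong) auto
      then have "?A x = Hmap M (ob c 1) (ob c 0) (mor c 0) (dg.word c {} 1 l x)"
        using x' y Suc by (simp add: dg.word_def dg.letter_def dg.Rc_def fr_Yc fr_comp_def fr_rho_def)
      then show ?thesis using foldr_F_comm[OF c x'] Suc by (simp del: upt_Suc)
    qed
    have z: "(of_nat n :: bit) = 0" using n by (metis bit.exhaust even_of_nat odd_one)
    have dA: "has_degree M ?X ?X 0 ?A" using fr_homD(3)[OF A] unfolding z .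
    \<comment> \<open>The sign in \<open>F_graded_comm\<close> is decided by a degree test on the
      operator exactly as written, so the test has to be settled for \<open>?W\<close> and not only
      for the word that agrees with it on the Hilbert space.\<close>
    have d: "has_degree M ?X ?X 0 ?W"
      unfolding has_degree_def
    proof (intro allI ballI)
      fix i x assume x: "x \<in> Hgr M ?X i"
      then have "?W x = ?A x" using Hgr_subset_H[OF X] by (intro W) auto
      moreover have "?A x \<in> Hgr M ?X (i + 0)" using dA x unfolding has_degree_def by blast
      ultimately show "?W x \<in> Hgr M ?X (i + 0)" by (simp only:)
    qed
    have "supertrace M ?X ?W = 1/2 * op_trace (H ?X) (\<lambda>x. \<gamma> ?X (F ?X (fr_diff ?X ?X ?A x)))"
      unfolding supertrace_def
    proof (intro arg_cong2[where f="(*)"] refl op_trace_cong[OF H_onb[OF X]])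
      fix x assume x: "x \<in> H ?X"
      show "(\<gamma> ?X \<circ> F ?X \<circ> F_graded_comm M ?X ?W) x = \<gamma> ?X (F ?X (fr_diff ?X ?X ?A x))"
        using d n W[OF x] W[OF F_H[OF X x]] by (simp add: F_graded_comm_def fr_diff_eq[OF X X A x])
    qed
    then show ?thesis
      using c by (simp add: fredholm_character_def dg.word_cochain_def fr_trace_def SG_def fr_Yc)
  qed (simp add: fredholm_character_def dg.word_cochain_def)
qed

end

section \<open>The characters of a Fredholm module are cyclic cocycles\<close>

context summable_fredholm_module
begin

abbreviation "\<phi> n \<equiv> dg.word_cochain n fr_trace"
abbreviation "\<theta>\<^sub>0 n \<equiv> dg.word_cochain n SG"

lemma word_hom:
  assumes "chain C n c"
  shows "dg.word c K a k \<in> fr_hom N (card ({a..a + k} - K)) (ob c (a + k + 1)) (ob c a)"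
  using dg.word_DHom[OF assms, of K a k] by (simp add: fr_Yc)

lemma ob_Suc_chain: "chain C n c \<Longrightarrow> ob c (Suc n) = ob c 0"
  using dg.Yc_Suc[of n c] by (simp add: fr_Yc)

text \<open>The commutator of f_0 df_1 ... df_n is df_0 df_1 ... df_n. In this form all letters play
  the same part, and cyclicity becomes visible.\<close>

lemma \<phi>_eq:
  assumes c: "chain C n c"
  shows "\<phi> n c = 1/2 * SG (ob c 0) (dg.word c {} 0 n)"
  using dg.DDiff_word[OF c, of n] ob_Suc_chain[OF c] c
  by (simp add: dg.word_cochain_def fr_trace_def fr_Yc)

lemma Dc_closed:
  assumes "chain C n c"
  shows "fr_diff (ob c (Suc i)) (ob c i) (dg.Dc c i) = 0"
  using dg.DDiff_word_closed[OF assms, of i 0] by (simp add: fr_Yc dg.word_def dg.letter_def)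

text \<open>The first letter is a closed morphism of degree 1, so \<open>SG_commute\<close> carries
  it to the end, and no sign appears. The remaining letters supply the other N - 1 units of
  decay.\<close>

lemma SG_move_first:
  assumes c: "chain C n c" and K: "0 \<notin> K" "N \<le> Suc (card ({1..n} - K))" and n: "0 < n"
  shows "SG (ob c 0) (dg.word c K 0 n)
    = SG (ob c 1) (fr_comp (ob c 1) (ob c 0) (ob c 1) (dg.word c K 1 (n - 1)) (dg.Dc c 0))"
proof -
  obtain l where l: "n = Suc l" using n by (cases n) auto
  have D: "dg.Dc c 0 \<in> fr_hom N 1 (ob c 1) (ob c 0)" using dg.Dc_DHom[OF c, of 0] by (simp add: fr_Yc)
  have w: "dg.word c K 1 l \<in> fr_hom N (card ({1..n} - K)) (ob c 0) (ob c 1)"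
    using word_hom[OF c, of K 1 l] ob_Suc_chain[OF c] by (simp add: l)
  have "dg.word c K 0 n = fr_comp (ob c 0) (ob c 1) (ob c 0) (dg.Dc c 0) (dg.word c K 1 l)"
    using K(1) l ob_Suc_chain[OF c] by (simp add: dg.word_def dg.letter_def fr_Yc)
  then show ?thesis
    using SG_commute[OF chain_ob[OF c] chain_ob[OF c] D _ w] Dc_closed[OF c, of 0] K(2) l by simp
qed

lemma word_snoc_D:
  assumes c: "chain C n c" and n: "0 < n" and K: "Suc n \<notin> K"
  shows "fr_comp (ob c 1) (ob c 0) (ob c 1) (dg.word c K 1 (n - 1)) (dg.Dc c 0) = dg.word c K 1 n"
proof -
  obtain l where l: "n = Suc l" using n by (cases n) auto
  have "dg.Dc c (Suc n) = dg.Dc c 0"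
    using dg.Dc_wrap[OF chain_nonempty[OF c], of 0] chain_length[OF c] by simp
  moreover have "ob c (Suc (Suc n)) = ob c 1"
    using ob_add_length(1)[of c 1] chain_length[OF c] by simp
  ultimately show ?thesis
    using dg.word_append[OF c, of K 1 l 0] K ob_Suc_chain[OF c] l
    by (simp add: fr_Yc dg.word_def[of c K "Suc (Suc l)"] dg.letter_def)
qed

lemma \<phi>_rotate1:
  assumes c: "chain C n c" and N: "N \<le> Suc n"
  shows "\<phi> n (rotate1 c) = \<phi> n c"
proof (cases "n = 0")
  case True
  then have "rotate1 c = c" using chain_length[OF c] by (cases c) auto
  then show ?thesis by simp
next
  case False
  then have n: "0 < n" by simp
  have "SG (ob c 0) (dg.word c {} 0 n) = SG (ob c 1) (dg.word c {} 1 n)"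
    using SG_move_first[OF c _ _ n, of "{}"] word_snoc_D[OF c n, of "{}"] N by simp
  also have "dg.word c {} 1 n = dg.word (rotate1 c) {} 0 n"
    using dg.word_rotate[OF chain_nonempty[OF c], of 1 "{}" 0 n] by simp
  finally show ?thesis
    unfolding \<phi>_eq[OF c] \<phi>_eq[OF chain_rotate1[OF c]] ob_rotate1[OF chain_nonempty[OF c]] by simp
qed

lemma \<phi>_C_lambda:
  assumes n: "even n" and N: "N \<le> Suc n"
  shows "\<phi> n \<in> C_lambda C n"
proof (rule C_lambdaI)
  show "\<phi> n \<in> CN C n" by (rule dg.word_cochain_CN) (use fr_trace_linear N in simp)
  show "\<phi> n (rotate1 c) = (-1) ^ n * \<phi> n c" if "chain C n c" for c
    using \<phi>_rotate1[OF that N] n by simp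
qed

text \<open>With d(f_0 f_1) = f_0 df_1 + df_0 f_1 the value splits into two terms. The first is
  \<open>\<theta>\<^sub>0\<close> of the chain; in the second, df_0 is carried to the end, which
  leaves \<open>\<theta>\<^sub>0\<close> of the rotated chain.\<close>

lemma \<phi>_first_face:
  assumes c: "chain C (Suc n) c" and N: "N \<le> Suc n"
  shows "\<phi> n (face C 0 c) = 1/2 * (\<theta>\<^sub>0 (Suc n) c + \<theta>\<^sub>0 (Suc n) (rotate1 c))"
proof -
  note X = chain_ob[OF c, of 0]
  have f: "chain C n (face C 0 c)" using chain_face[OF c] by simp
  have o: "ob (face C 0 c) 0 = ob c 0" using chain_length[OF c] by (simp add: ob_face)
  have w0: "dg.word c {0} 0 (Suc n) \<in> fr_hom N (Suc n) (ob c 0) (ob c 0)"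
    using dg.word_0_DHom[OF c] by (simp add: fr_Yc)
  have "{0..Suc n} - {1} = insert 0 {2..Suc n}" by auto
  then have w1: "dg.word c {1} 0 (Suc n) \<in> fr_hom N (Suc n) (ob c 0) (ob c 0)"
    using word_hom[OF c, of "{1}" 0 "Suc n"] ob_Suc_chain[OF c] by simp
  have "dg.word (face C 0 c) {} 0 n = dg.word c {0} 0 (Suc n) + dg.word c {1} 0 (Suc n)"
    using dg.word_face[OF c, of 0 "{}"] by simp
  then have "SG (ob c 0) (dg.word (face C 0 c) {} 0 n) = SG (ob c 0) (dg.word c {0} 0 (Suc n)) + SG
    (ob c 0) (dg.word c {1} 0 (Suc n))"
    using clinear_onD(2)[OF SG_linear[OF X N] w0 w1] by simp
  also have "SG (ob c 0) (dg.word c {1} 0 (Suc n)) = SG (ob c 1) (dg.word c {1} 1 (Suc n))"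
  proof -
    have "{1..Suc n} - {1} = {2..Suc n}" by auto
    then show ?thesis
      using SG_move_first[OF c, of "{1}"] word_snoc_D[OF c, of "{1}"] N by simp
  qed
  also have "dg.word c {1} 1 (Suc n) = dg.word (rotate1 c) {0} 0 (Suc n)"
    using dg.word_rotate[OF chain_nonempty[OF c], of 1 "{0}" 0 "Suc n"] by simp
  finally show ?thesis
    using c chain_rotate1[OF c] \<phi>_eq[OF f] ob_rotate1[OF chain_nonempty[OF c], of 0] o
    by (simp add: dg.word_cochain_def fr_Yc)
qed

lemma \<phi>_cyc_face:
  assumes n: "even n" and c: "chain C (Suc n) c" and N: "N \<le> Suc n" and k: "k \<le> Suc n"
  shows "\<phi> n (cyc_face C n k c) = 1/2 * (\<theta>\<^sub>0 (Suc n) (rotate k c) + \<theta>\<^sub>0 (Suc n) (rotate (Suc k) c))"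
  using C_lambda_cyc_face[OF \<phi>_C_lambda[OF n N] c k] \<phi>_first_face[OF chain_rotate[OF c, of k] N] n
  by simp

text \<open>The coboundary is an alternating sum of neighbouring averages of the rotations of
  \<open>\<theta>\<^sub>0\<close> and telescopes. There are n + 2 faces, an even number, so the two
  ends carry opposite signs, and a full rotation identifies them.\<close>

lemma \<phi>_Z_lambda:
  assumes n: "even n" and N: "N \<le> Suc n"
  shows "\<phi> n \<in> Z_lambda C n"
proof -
  have "hochschild_b C n (\<phi> n) c = 0" for c
  proof (cases "chain C (Suc n) c")
    case c: True
    define \<psi> where "\<psi> k = \<theta>\<^sub>0 (Suc n) (rotate k c)" for k
    have "\<psi> (Suc (Suc n)) = \<psi> 0"
      using rotate_id[of "Suc (Suc n)" c] chain_length[OF c] by (simp add: \<psi>_def del: rotate_Suc)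
    have t: "(\<Sum>i\<le>k. (-1) ^ i * (1/2 * (\<psi> i + \<psi> (Suc i)))) = 1/2 * (\<psi> 0 + (-1) ^ k * \<psi> (Suc k))" for k
      by (induction k) (simp_all add: algebra_simps)
    have "hochschild_b C n (\<phi> n) c = (\<Sum>i\<le>Suc n. (-1) ^ i * (1/2 * (\<psi> i + \<psi> (Suc i))))"
      unfolding hochschild_b_cyc_face[OF c] \<psi>_def
      by (intro sum.cong refl) (simp add: \<phi>_cyc_face[OF n c N] del: rotate_Suc)
    also have "\<dots> = 0" unfolding t using n \<open>\<psi> (Suc (Suc n)) = \<psi> 0\<close> by simp
    finally show ?thesis .
  qed (simp add: hochschild_b_def)
  then show ?thesis using \<phi>_C_lambda[OF n N] by (simp add: Z_lambda_def fun_eq_iff)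
qed

lemma \<theta>\<^sub>0_CN: "N \<le> n \<Longrightarrow> \<theta>\<^sub>0 n \<in> CN C n"
  by (rule dg.word_cochain_CN) (use SG_linear in simp)

text \<open>Let Q = f_0 df_1 ... df_n and R = f_{n+1}. The inner faces telescope to -Tr(\<gamma> F Q
  R) and the last face gives Tr(\<gamma> F R Q). Since R commutes with \<gamma>, moving it around
  the first trace turns the difference into Tr(\<gamma> dR Q). Moving Q to the front and past
  \<gamma>, with which it anticommutes because n is odd, gives -Tr(\<gamma> Q dR), minus the
  character.\<close>

lemma hochschild_b_\<theta>\<^sub>0:
  assumes n: "odd n" "N \<le> n" and c: "chain C (Suc n) c"
  shows "hochschild_b C n (\<theta>\<^sub>0 n) c = - \<phi> (Suc n) c"
proof -
  define X where "X = ob c 0"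
  define Y where "Y = ob c (Suc n)"
  have X: "X \<in> Obj C" and Y: "Y \<in> Obj C" using chain_ob[OF c] by (simp_all add: X_def Y_def)
  define Q where "Q = dg.word c {0} 0 n"
  define R where "R = dg.Rc c (Suc n)"
  have oL: "ob c (Suc (Suc n)) = X" using ob_Suc_chain[OF c] by (simp add: X_def)
  have "{0..n} - {0} = {1..n}" by auto
  then have Q: "Q \<in> fr_hom N n Y X" using word_hom[OF c, of "{0}" 0 n] by (simp add: Q_def X_def Y_def)
  have R: "R \<in> fr_hom N 0 X Y" using dg.Rc_DHom[OF c, of "Suc n"] oL by (simp add: R_def Y_def fr_Yc)
  have DR: "fr_diff X Y R = dg.Dc c (Suc n)" using oL by (simp add: dg.Dc_def R_def fr_Yc Y_def)
  note lin = clinear_on_sum[OF SG_linear[OF X n(2)] fr_hom_subspace[OF X X]]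
  have fX: "ob (face C i c) 0 = X" "chain C n (face C i c)" if "i \<le> n" for i
    using that chain_length[OF c] chain_face[OF c that] by (simp_all add: ob_face X_def)
  have wf: "dg.word (face C i c) {0} 0 n \<in> fr_hom N n X X" if "i \<le> n" for i
    using dg.word_0_DHom[OF fX(2)[OF that]] fX[OF that] by (simp add: fr_Yc)
  have QR: "dg.word c {0, Suc n} 0 (Suc n) = fr_comp X Y X Q R"
    using dg.word_append[OF c, of "{0, Suc n}" 0 n 0] oL dg.word_cong[of 0 n "{0, Suc n}" "{0}" c]
    by (simp add: Q_def R_def X_def Y_def fr_Yc dg.word_def[of c _ "Suc n"] dg.letter_def)
  have 1: "(\<Sum>i\<le>n. (-1) ^ i * \<theta>\<^sub>0 n (face C i c)) = - SG X (fr_comp X Y X Q R)"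
  proof -
    have "SG X (fr_comp X Y X Q R) = SG X (\<Sum>j\<le>n. (-1) ^ (n - j) *\<^sub>C dg.word (face C j c) {0} 0 n)"
      using dg.word_two_undifferentiated[OF c, of n] QR by simp
    also have "\<dots> = (\<Sum>j\<le>n. SG X ((-1) ^ (n - j) *\<^sub>C dg.word (face C j c) {0} 0 n))"
      using wf cvs.subspace_scale[OF fr_hom_subspace[OF X X]] by (intro lin) auto
    also have "\<dots> = (\<Sum>j\<le>n. - ((-1) ^ j * \<theta>\<^sub>0 n (face C j c)))"
    proof (intro sum.cong refl)
      fix j assume "j \<in> {..n}"
      then have j: "j \<le> n" by simp
      have "(-1) ^ (n - j) = (- ((-1) ^ j) :: complex)"
        using n(1) j by (cases "even j") (auto simp: minus_one_power_iff)
      moreover have "SG X ((-1) ^ (n - j) *\<^sub>C dg.word (face C j c) {0} 0 n) = (-1) ^ (n - j) * SG X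
        (dg.word (face C j c) {0} 0 n)"
        using clinear_onD(3)[OF SG_linear[OF X n(2)] wf[OF j]] by (simp only: scaleC_complex_def)
      ultimately show "SG X ((-1) ^ (n - j) *\<^sub>C dg.word (face C j c) {0} 0 n) = - ((-1) ^ j * \<theta>\<^sub>0 n
        (face C j c))"
        using fX[OF j] by (simp add: dg.word_cochain_def fr_Yc)
    qed
    finally show ?thesis by (simp add: sum_negf)
  qed
  have 2: "\<theta>\<^sub>0 n (face C 0 (rotate (Suc n) c)) = SG Y (fr_comp Y X Y R Q)"
  proof -
    define c' where "c' = rotate (Suc n) c"
    have c': "chain C (Suc n) c'" unfolding c'_def by (rule chain_rotate[OF c])
    have ne: "c \<noteq> []" by (rule chain_nonempty[OF c])
    have o: "ob c' i = ob c (i + Suc n)" for i unfolding c'_def by (rule ob_rotate[OF ne])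
    have o0: "ob c' 0 = Y" "ob c' 1 = X" "ob c' (Suc (Suc n)) = Y"
      using o[of 0] o[of 1] ob_Suc_chain[OF c'] oL by (simp_all add: Y_def)
    have f: "chain C n (face C 0 c')" "ob (face C 0 c') 0 = Y"
      using chain_face[OF c'] chain_length[OF c'] o0 by (simp_all add: ob_face)
    have "dg.word c' {0} 0 0 = dg.word c {Suc n} (Suc n) 0"
      unfolding c'_def dg.word_rotate[OF ne] by simp
    then have "dg.Rc c' 0 = R" by (simp add: dg.word_def dg.letter_def R_def)
    moreover have "dg.word c' {0, 1} 1 n = Q"
    proof -
      have "dg.word c' {0, 1} 1 n = dg.word c' {1} 1 n" by (rule dg.word_cong) auto
      also have "\<dots> = dg.word c {length c} (length c) n"
        unfolding c'_def dg.word_rotate[OF ne] using chain_length[OF c] by simp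
      also have "\<dots> = Q" using dg.word_wrap[OF ne, of "{0}" 0 n] by (simp add: Q_def)
      finally show ?thesis .
    qed
    ultimately have "dg.word c' {0, 1} 0 (Suc n) = fr_comp Y X Y R Q"
      using o0 by (simp add: dg.word_def dg.letter_def fr_Yc)
    then show ?thesis
      using f dg.word_first_face[OF c'] by (simp add: dg.word_cochain_def fr_Yc c'_def)
  qed
  have "hochschild_b C n (\<theta>\<^sub>0 n) c = (\<Sum>i\<le>n. (-1) ^ i * \<theta>\<^sub>0 n (face C i c)) + \<theta>\<^sub>0 n (face C 0
    (rotate (Suc n) c))"
    using c n(1) chain_length[OF c] by (simp add: hochschild_b_def last_face_eq del: rotate_Suc)
  also have "\<dots> = SG Y (fr_comp Y X Y R Q) - SG X (fr_comp X Y X Q R)"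
    unfolding 1 2 by simp
  also have "\<dots> = - op_trace (H X) (\<lambda>x. \<gamma> X (Q (fr_diff X Y R x)))"
  proof -
    note sX = H_onb[OF X] and sY = H_onb[OF Y]
    have apQ: "approximable N n (H Y) (H X) (\<lambda>x. \<gamma> X (F X (Q x)))"
      by (rule approximable_grading_F[OF X Y fr_homD(1)[OF Q]])
    have apR: "approximable N (0 + n) (H Y) (H Y) (\<lambda>x. R (\<gamma> X (F X (Q x))))"
      by (rule approximable_comp[OF H_subspace[OF Y] H_subspace[OF X] H_subspace[OF Y]
        fr_homD(1)[OF R] apQ])
    \<comment> \<open>All the required decay sits in \<open>Q\<close>, which has n \<ge> N
      differentials; the merely bounded \<open>R\<close> may therefore be moved around the
      trace.\<close>
    have "SG X (fr_comp X Y X Q R) = op_trace (H X) (\<lambda>x. \<gamma> X (F X (Q (R x))))"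
      unfolding SG_def by (rule op_trace_cong[OF sX]) (simp add: fr_comp_def)
    also have "\<dots> = op_trace (H Y) (\<lambda>x. R (\<gamma> X (F X (Q x))))"
      using approximable_trace_commute[OF sX sY N_pos _ apQ fr_homD(1)[OF R]] n by simp
    finally have s1: "SG X (fr_comp X Y X Q R) = op_trace (H Y) (\<lambda>x. R (\<gamma> X (F X (Q x))))" .
    have RQ: "fr_comp Y X Y R Q \<in> fr_hom N n Y Y" using fr_comp_hom[OF Y X Y Q R] by simp
    have "SG Y (fr_comp Y X Y R Q) - SG X (fr_comp X Y X Q R)
        = op_trace (H Y) (\<lambda>x. \<gamma> Y (F Y (fr_comp Y X Y R Q x)) - R (\<gamma> X (F X (Q x))))"
      unfolding s1 unfolding SG_def using approximable_trace_summable[OF sY N_pos apR] n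
      by (intro op_trace_diff[symmetric] SG_summable[OF Y RQ n(2)]) auto
    also have "\<dots> = op_trace (H Y) (\<lambda>x. \<gamma> Y (fr_diff X Y R (Q x)))"
    proof (rule op_trace_cong[OF sY])
      fix x assume x: "x \<in> H Y"
      have q: "Q x \<in> H X" by (rule fr_hom_H[OF Q x])
      note gl = bounded_clinear_onD[OF grading_bounded[OF Y]]
      have a: "F Y (R (Q x)) \<in> H Y" and b: "R (F X (Q x)) \<in> H Y"
        using q F_H[OF Y fr_hom_H[OF R]] fr_hom_H[OF R F_H[OF X]] by auto
      have "\<gamma> Y (F Y (R (Q x)) - R (F X (Q x))) = \<gamma> Y (F Y (R (Q x))) - \<gamma> Y (R (F X (Q x)))"
        using gl(2)[of "F Y (R (Q x)) - R (F X (Q x))" "R (F X (Q x))"] a b cvs.subspace_diff[OF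
          H_subspace[OF Y]]
        by (simp add: eq_diff_eq)
      then show "\<gamma> Y (F Y (fr_comp Y X Y R Q x)) - R (\<gamma> X (F X (Q x))) = \<gamma> Y (fr_diff X Y R (Q x))"
        using x fr_hom_grading[OF X Y R F_H[OF X q]] by (simp add: fr_comp_def fr_diff_eq[OF X Y R
          q] scaleC_one)
    qed
    also have "\<dots> = op_trace (H X) (\<lambda>x. Q (\<gamma> Y (fr_diff X Y R x)))"
      using n by (intro approximable_trace_commute[OF sY sX N_pos _ _ fr_homD(1)[OF Q],
          OF _ approximable_bounded_comp[OF X Y Y grading_bounded[OF Y] fr_homD(4)[OF R]]]) simp
    also have "\<dots> = op_trace (H X) (\<lambda>x. (-1) *\<^sub>C \<gamma> X (Q (fr_diff X Y R x)))"
    proof (rule op_trace_cong[OF sX])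
      fix x assume "x \<in> H X"
      then have "fr_diff X Y R x \<in> H Y" by (rule fr_hom_H[OF fr_diff_hom[OF X Y R]])
      then show "Q (\<gamma> Y (fr_diff X Y R x)) = (-1) *\<^sub>C \<gamma> X (Q (fr_diff X Y R x))"
        using fr_hom_grading[OF Y X Q] n(1) by (simp add: cvs.scale_minus_left scaleC_one)
    qed
    finally show ?thesis unfolding op_trace_scale by simp
  qed
  also have "op_trace (H X) (\<lambda>x. \<gamma> X (Q (fr_diff X Y R x))) = fr_trace X (fr_comp X Y X Q (fr_diff
    X Y R))"
    using fr_comp_hom[OF X Y X fr_diff_hom[OF X Y R] Q] n
    by (subst fr_trace_eq[OF X, of _ "Suc n"])
      (auto intro!: op_trace_cong[OF H_onb[OF X]] simp: fr_comp_def)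
  also have "fr_comp X Y X Q (fr_diff X Y R) = dg.word c {0} 0 (Suc n)"
    using dg.word_append[OF c, of "{0}" 0 n 0] oL
    by (simp add: Q_def X_def Y_def fr_Yc dg.word_def[of c _ "Suc n"] dg.letter_def DR[unfolded
      X_def Y_def])
  finally show ?thesis using c by (simp add: dg.word_cochain_def fr_Yc X_def)
qed

text \<open>By the formula for the faces of \<open>\<phi>\<close>, the weighted sum of faces in
  \<open>S_cochain_eq_hochschild_b\<close> is \<open>\<theta> n\<close> plus \<open>(n + 1) / 2\<close> times \<open>\<theta>\<^sub>0 n\<close>.\<close>

definition \<theta> :: "nat \<Rightarrow> ('o, 'm) cochain"
  where "\<theta> n = (\<lambda>c. - 1/2 * (\<Sum>k\<le>n. (-1) ^ k * \<theta>\<^sub>0 n (rotate k c)))"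

text \<open>A rotation of the chain shifts the alternating sum by one index and reverses its sign.
  For odd n this is the sign (-1)^n of a cyclic cochain, and the n + 1 terms close up
  consistently.\<close>

lemma \<theta>_C_lambda:
  assumes n: "odd n" "N \<le> n"
  shows "\<theta> n \<in> C_lambda C n"
proof (rule C_lambdaI)
  have "(\<lambda>c. \<Sum>k\<le>n. (- 1/2 * (-1) ^ k) * \<theta>\<^sub>0 n (rotate k c)) \<in> CN C n"
    by (intro CN_sum CN_rotate \<theta>\<^sub>0_CN n)
  then show "\<theta> n \<in> CN C n" by (simp add: \<theta>_def sum_distrib_left sum_negf mult.assoc)
  fix c assume c: "chain C n c"
  define g where "g k = (-1) ^ k * \<theta>\<^sub>0 n (rotate k c)" for k
  have "rotate (Suc n) c = c" using chain_length[OF c] by (intro rotate_id) simp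
  then have g: "g (Suc n) = g 0" using n by (simp add: g_def del: rotate_Suc)
  have "(\<Sum>k\<le>n. (-1) ^ k * \<theta>\<^sub>0 n (rotate k (rotate1 c))) = (\<Sum>k\<le>n. - g (Suc k))"
    by (intro sum.cong refl) (simp add: g_def rotate1_rotate_swap)
  also have "\<dots> = - (\<Sum>k\<le>n. g k)"
    using sum.atMost_Suc_shift[of g n] g by (simp add: sum_negf)
  finally show "\<theta> n (rotate1 c) = (-1) ^ n * \<theta> n c"
    using n by (simp add: \<theta>_def g_def)
qed

theorem S_cochain_fredholm:
  assumes r: "even r" "N \<le> Suc r"
  shows "S_cochain C r (\<phi> r) = hochschild_b C (Suc r) (\<theta> (Suc r)) - of_nat (r div 2 + 1) *\<^sub>C \<phi> (Suc
    (Suc r))"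
proof -
  let ?n = "Suc r"
  have n: "odd ?n" using r by simp
  define \<eta> where "\<eta> = \<theta> ?n + of_nat (r div 2 + 1) *\<^sub>C \<theta>\<^sub>0 ?n"
  have "S_cochain C r (\<phi> r) = hochschild_b C (Suc r) \<eta>"
  proof (rule S_cochain_eq_hochschild_b)
    show "hochschild_b C r (\<phi> r) = 0" using \<phi>_Z_lambda[OF r] by (simp add: Z_lambda_def)
    fix c assume c: "chain C (Suc r) c"
    define \<psi> where "\<psi> k = \<theta>\<^sub>0 ?n (rotate k c)" for k
    have "(\<Sum>j\<le>r. of_nat (r + 1 - j) * (-1) ^ j * \<phi> r (face C j c))
        = (\<Sum>j\<le>r. of_nat (r + 1 - j) * (-1) ^ j * (1/2 * (\<psi> j + \<psi> (Suc j))))"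
    proof (intro sum.cong refl)
      fix j assume "j \<in> {..r}"
      then have "\<phi> r (face C j c) = 1/2 * (\<psi> j + \<psi> (Suc j))"
        using \<phi>_cyc_face[OF r(1) c r(2), of j] by (simp add: cyc_face_def \<psi>_def del: rotate_Suc)
      then show "of_nat (r + 1 - j) * (-1) ^ j * \<phi> r (face C j c)
          = of_nat (r + 1 - j) * (-1) ^ j * (1/2 * (\<psi> j + \<psi> (Suc j)))" by (simp only:)
    qed
    also have "\<dots> = 1/2 * (of_nat (r + 2) * \<psi> 0 - (\<Sum>k\<le>Suc r. (-1) ^ k * \<psi> k))"
    proof -
      \<comment> \<open>Summation by parts: neighbouring weights differ by 1, so each
        \<open>\<psi> k\<close> is left with coefficient -1/2 up to the alternating sign, and
        \<open>\<psi> 0\<close> has the excess (r + 2)/2. The boundary term vanishes at l = r +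
        1.\<close>
      have "(\<Sum>j<l. of_nat (r + 1 - j) * (-1) ^ j * (1/2 * (\<psi> j + \<psi> (Suc j))))
          = 1/2 * (of_nat (r + 2) * \<psi> 0 - (\<Sum>k\<le>l. (-1) ^ k * \<psi> k) - of_nat (r + 1 - l) * (-1) ^ l * \<psi> l)"
        if "l \<le> r + 1" for l
        using that
      proof (induction l)
        case 0
        then show ?case by (simp add: algebra_simps)
      next
        case (Suc l)
        then have "of_nat (r + 1 - l) = (of_nat (r + 1 - Suc l) + 1 :: complex)"
          by (simp add: of_nat_diff)
        with Suc show ?case by (simp add: algebra_simps)
      qed
      from this[of "r + 1"] show ?thesis by (simp add: lessThan_Suc_atMost)
    qed
    also have "\<dots> = \<eta> c"
    proof -
      obtain q where q: "r = 2 * q" using r(1) by (elim evenE)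
      have e: "of_nat (r + 2) = (2 * of_nat (r div 2 + 1) :: complex)" by (simp add: q)
      have \<psi>0: "\<psi> 0 = \<theta>\<^sub>0 ?n c" by (simp add: \<psi>_def)
      have \<theta>: "\<theta> ?n c = - 1/2 * (\<Sum>k\<le>Suc r. (-1) ^ k * \<psi> k)" by (simp only: \<theta>_def \<psi>_def)
      have "\<eta> c = \<theta> ?n c + of_nat (r div 2 + 1) * \<theta>\<^sub>0 ?n c"
        by (simp add: \<eta>_def scaleC_fun_def scaleC_complex_def)
      then show ?thesis unfolding e \<psi>0 \<theta> by (simp add: field_simps del: sum.atMost_Suc)
    qed
    finally show "\<eta> c = (\<Sum>j\<le>r. of_nat (r + 1 - j) * (-1) ^ j * \<phi> r (face C j c))" by simp
  qed
  also have "\<dots> = hochschild_b C ?n (\<theta> ?n) + of_nat (r div 2 + 1) *\<^sub>C hochschild_b C ?n (\<theta>\<^sub>0 ?n)"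
    by (simp add: \<eta>_def hochschild_b_add hochschild_b_scale)
  also have "hochschild_b C ?n (\<theta>\<^sub>0 ?n) = - \<phi> (Suc ?n)"
  proof
    fix c show "hochschild_b C ?n (\<theta>\<^sub>0 ?n) c = (- \<phi> (Suc ?n)) c"
      using hochschild_b_\<theta>\<^sub>0[OF n r(2), of c]
      by (cases "chain C (Suc ?n) c") (simp_all add: hochschild_b_def dg.word_cochain_def)
  qed
  finally show ?thesis by (simp only: cvs.scale_minus_right add_uminus_conv_diff)
qed

end

section \<open>Cycles inside the universal vector space\<close>

text \<open>The letters \<open>\<rho>(f)\<close> and \<open>d\<rho>(f)\<close> generate a differential graded subcategory, which is spanned
  by words. A basis consisting of words can be coded by lists of objects and morphisms, hence
  coordinates embed it linearly into the type of the universal cycle.\<close>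

locale unital_cycle = dg_over C S "\<lambda>X. X" rho
  for C :: "('o, 'm::complex_vector) lin_cat"
    and S :: "('o, 's::complex_vector) dg_semicat"
    and rho :: "'o \<Rightarrow> 'o \<Rightarrow> 'm \<Rightarrow> 's" +
  fixes r :: nat
    and T :: "'o \<Rightarrow> 's \<Rightarrow> complex"
  assumes DObj_eq: "DObj S = Obj C"
    and trace: "closed_graded_trace S r T"
    and unit: "\<lbrakk>X \<in> Obj C; Y \<in> Obj C; h \<in> DHom S 0 X Y\<rbrakk>
      \<Longrightarrow> DComp S X Y Y (rho Y Y (Ident C Y)) h = h \<and> DComp S X X Y h (rho X X (Ident C X)) = h"
begin

definition gen :: "bool \<Rightarrow> 'o \<Rightarrow> 'o \<Rightarrow> 'm \<Rightarrow> 's"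
  where "gen b X Y f = (if b then DDiff S X Y (rho X Y f) else rho X Y f)"

inductive is_word :: "nat \<Rightarrow> 'o \<Rightarrow> 'o \<Rightarrow> 's \<Rightarrow> bool"
  where
    single: "\<lbrakk>X \<in> Obj C; Y \<in> Obj C; f \<in> Hom C X Y\<rbrakk> \<Longrightarrow> is_word (of_bool b) X Y (gen b X Y f)"
  | snoc: "\<lbrakk>is_word n Y Z w; X \<in> Obj C; f \<in> Hom C X Y\<rbrakk>
      \<Longrightarrow> is_word (n + of_bool b) X Z (DComp S X Y Z w (gen b X Y f))"

text \<open>The head of the list is the rightmost letter, since words grow on the right. The object
  Z is the target of the whole word, which composition takes as an argument.\<close>

fun decode :: "(bool \<times> 'o \<times> 'o \<times> 'o \<times> 'm) list \<Rightarrow> 's"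
  where
    "decode [] = 0"
  | "decode ((b, X, Y, Z, f) # l) = (if l = [] then gen b X Y f else DComp S X Y Z (decode l) (gen
    b X Y f))"

text \<open>A letter carries a bit, three objects and a morphism, while entries of the target lists
  are pairs of an object and an optional morphism. Three entries hold the objects, and the bit
  becomes the choice between \<open>None\<close> and \<open>Some\<close>; only injectivity is
  used.\<close>

fun encode :: "(bool \<times> 'o \<times> 'o \<times> 'o \<times> 'm) list \<Rightarrow> ('o \<times> 'm option) list"
  where
    "encode [] = []"
  | "encode ((b, X, Y, Z, f) # l) = (X, Some f) # (Y, if b then None else Some 0) # (Z, None) #
    encode l"

definition spanned :: "nat \<Rightarrow> 'o \<Rightarrow> 'o \<Rightarrow> 's set"
  where "spanned n X Y = cvs.span {w. is_word n X Y w}"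

lemma gen_DHom:
  "\<lbrakk>X \<in> Obj C; Y \<in> Obj C; f \<in> Hom C X Y\<rbrakk> \<Longrightarrow> gen b X Y f \<in> DHom S (of_bool b) X Y"
  using clinear_onD(1)[OF rho_linear] DDiff_DHom[of X Y] DObj_eq by (simp add: gen_def)

lemma word_objects: "is_word n X Y w \<Longrightarrow> X \<in> Obj C \<and> Y \<in> Obj C \<and> w \<in> DHom S n X Y"
proof (induction rule: is_word.induct)
  case (snoc n Y Z w X f b)
  then show ?case
    using DComp_DHom[of X Y Z "gen b X Y f" "of_bool b" w n] gen_DHom[of X Y f b] DObj_eq by simp
qed (simp add: gen_DHom)

lemma word_decode: "is_word n X Y w \<Longrightarrow> \<exists>l. l \<noteq> [] \<and> decode l = w"
proof (induction rule: is_word.induct)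
  case (single X Y f b)
  show ?case by (rule exI[of _ "[(b, X, Y, Y, f)]"]) simp
next
  case (snoc n Y Z w X f b)
  then obtain l where "l \<noteq> []" "decode l = w" by blast
  then show ?case by (intro exI[of _ "(b, X, Y, Z, f) # l"]) simp
qed

lemma encode_inj: "encode l = encode l' \<Longrightarrow> l = l'"
proof (induction l arbitrary: l')
  case Nil
  then show ?case by (cases l' rule: encode.cases) auto
next
  case (Cons x l)
  then show ?case by (cases x; cases l' rule: encode.cases) (auto split: if_splits)
qed

lemma spanned_subspace: "cvs.subspace (spanned n X Y)"
  by (simp add: spanned_def)

lemma spanned_DHom: "\<lbrakk>X \<in> Obj C; Y \<in> Obj C\<rbrakk> \<Longrightarrow> spanned n X Y \<subseteq> DHom S n X Y"
  unfolding spanned_def using word_objects DHom_subspace DObj_eq by (intro cvs.span_minimal) auto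

lemma spanned_gen:
  "\<lbrakk>X \<in> Obj C; Y \<in> Obj C; f \<in> Hom C X Y\<rbrakk> \<Longrightarrow> gen b X Y f \<in> spanned (of_bool b) X Y"
  unfolding spanned_def by (intro cvs.span_base) (simp add: single)

lemma is_word_comp:
  assumes "is_word i X Y v" and "is_word j Y Z w"
  shows "is_word (j + i) X Z (DComp S X Y Z w v)"
  using assms
proof (induction arbitrary: j Z w rule: is_word.induct)
  case (single X Y f b)
  then show ?case using is_word.snoc by blast
next
  case (snoc n Y' Y v X f b)
  have Y': "Y' \<in> Obj C" "Y \<in> Obj C" "v \<in> DHom S n Y' Y" using word_objects[OF snoc.hyps(1)] by auto
  have w: "Z \<in> Obj C" "w \<in> DHom S j Y Z" using word_objects[OF snoc.prems] by auto
  have "DComp S X Y Z w (DComp S X Y' Y v (gen b X Y' f)) = DComp S X Y' Z (DComp S Y' Y Z w v)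
    (gen b X Y' f)"
    using DComp_assoc[of X Y' Y Z "gen b X Y' f" "of_bool b" v n w j] Y' w snoc.hyps gen_DHom[of X
      Y' f b] DObj_eq
    by simp
  moreover have "is_word (j + n + of_bool b) X Z (DComp S X Y' Z (DComp S Y' Y Z w v) (gen b X Y' f))"
    by (rule is_word.snoc[OF snoc.IH[OF snoc.prems] snoc.hyps(2,3)])
  ultimately show ?case by (simp add: add.assoc)
qed

text \<open>Bilinear extension of \<open>is_word_comp\<close>, one factor at a time: the elements
  with the desired property form a subspace containing the words.\<close>

lemma spanned_comp:
  assumes O: "X \<in> Obj C" "Y \<in> Obj C" "Z \<in> Obj C"
    and f: "f \<in> spanned i X Y" and g: "g \<in> spanned j Y Z"
  shows "DComp S X Y Z g f \<in> spanned (j + i) X Z"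
proof -
  note O' = O[folded DObj_eq]
  have w: "DComp S X Y Z w f \<in> spanned (j + i) X Z" if "is_word j Y Z w" for w
  proof -
    have wD: "w \<in> DHom S j Y Z" using word_objects[OF that] by simp
    note lin = clinear_onD[OF DComp_linear_right[OF O' wD]]
    note s = DHom_subspace[OF O'(1,2)]
    have "cvs.subspace {f \<in> DHom S i X Y. DComp S X Y Z w f \<in> spanned (j + i) X Z}"
      unfolding cvs.subspace_def
      using lin(2,3) DComp_0(2)[OF O' wD] s spanned_subspace[of "j + i" X Z]
      by (auto simp: cvs.subspace_def)
    moreover have "{v. is_word i X Y v} \<subseteq> {f \<in> DHom S i X Y. DComp S X Y Z w f \<in> spanned (j + i) X Z}"
      using word_objects is_word_comp[OF _ that] by (auto simp: spanned_def intro: cvs.span_base)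
    ultimately have "spanned i X Y \<subseteq> {f \<in> DHom S i X Y. DComp S X Y Z w f \<in> spanned (j + i) X Z}"
      unfolding spanned_def[of i] by (intro cvs.span_minimal)
    then show ?thesis using f by auto
  qed
  have fD: "f \<in> DHom S i X Y" using f spanned_DHom[OF O(1,2)] by auto
  note lin = clinear_onD[OF DComp_linear_left[OF O' fD]]
  have "cvs.subspace {g \<in> DHom S j Y Z. DComp S X Y Z g f \<in> spanned (j + i) X Z}"
    unfolding cvs.subspace_def
    using lin(2,3) DComp_0(1)[OF O' fD] DHom_subspace[OF O'(2,3)] spanned_subspace[of "j + i" X Z]
    by (auto simp: cvs.subspace_def)
  moreover have "{v. is_word j Y Z v} \<subseteq> {g \<in> DHom S j Y Z. DComp S X Y Z g f \<in> spanned (j + i) X Z}"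
    using word_objects w by auto
  ultimately have "spanned j Y Z \<subseteq> {g \<in> DHom S j Y Z. DComp S X Y Z g f \<in> spanned (j + i) X Z}"
    unfolding spanned_def[of j] by (intro cvs.span_minimal)
  then show ?thesis using g by auto
qed

lemma spanned_diff_gen:
  assumes O: "X \<in> Obj C" "Y \<in> Obj C" and f: "f \<in> Hom C X Y"
  shows "DDiff S X Y (gen b X Y f) \<in> spanned (Suc (of_bool b)) X Y"
proof (cases b)
  case True
  have "rho X Y f \<in> DHom S 0 X Y" using gen_DHom[OF O f, of False] by (simp add: gen_def)
  then have "DDiff S X Y (gen b X Y f) = 0" using True DDiff_DDiff[of X Y] O DObj_eq by (simp add:
    gen_def)
  then show ?thesis using cvs.subspace_0[OF spanned_subspace] by simp
next
  case False
  then show ?thesis using spanned_gen[OF O f, of True] by (simp add: gen_def)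
qed

lemma is_word_diff: "is_word n X Y w \<Longrightarrow> DDiff S X Y w \<in> spanned (Suc n) X Y"
proof (induction rule: is_word.induct)
  case (single X Y f b)
  then show ?case by (rule spanned_diff_gen)
next
  case (snoc n Y Z w X f b)
  have w: "Y \<in> Obj C" "Z \<in> Obj C" "w \<in> DHom S n Y Z" using word_objects[OF snoc.hyps(1)] by auto
  have "w \<in> spanned n Y Z" unfolding spanned_def using snoc.hyps by (simp add: cvs.span_base)
  then have "DComp S X Y Z w (DDiff S X Y (gen b X Y f)) \<in> spanned (n + Suc (of_bool b)) X Z"
    using spanned_comp snoc.hyps w spanned_diff_gen by metis
  moreover have "DComp S X Y Z (DDiff S Y Z w) (gen b X Y f) \<in> spanned (Suc n + of_bool b) X Z"
    using spanned_comp snoc.hyps snoc.IH w spanned_gen by metis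
  ultimately show ?case
    using DDiff_Leibniz[of X Y Z "gen b X Y f" "of_bool b" w n] snoc.hyps w gen_DHom[of X Y f b] DObj_eq
      cvs.subspace_add[OF spanned_subspace] cvs.subspace_scale[OF spanned_subspace] by simp
qed

lemma spanned_diff:
  assumes O: "X \<in> Obj C" "Y \<in> Obj C" and f: "f \<in> spanned n X Y"
  shows "DDiff S X Y f \<in> spanned (Suc n) X Y"
proof -
  note O' = O[folded DObj_eq]
  note lin = clinear_onD[OF DDiff_linear[OF O']]
  have "cvs.subspace {g \<in> DHom S n X Y. DDiff S X Y g \<in> spanned (Suc n) X Y}"
    unfolding cvs.subspace_def
    using lin(2,3) clinear_on_0[OF DDiff_linear[OF O'] DHom_subspace[OF O']] DHom_subspace[OF O', of n]
      spanned_subspace[of "Suc n" X Y]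
    by (auto simp: cvs.subspace_def)
  moreover have "{v. is_word n X Y v} \<subseteq> {g \<in> DHom S n X Y. DDiff S X Y g \<in> spanned (Suc n) X Y}"
    using word_objects is_word_diff by auto
  ultimately have "spanned n X Y \<subseteq> {g \<in> DHom S n X Y. DDiff S X Y g \<in> spanned (Suc n) X Y}"
    unfolding spanned_def[of n] by (intro cvs.span_minimal)
  then show ?thesis using f by auto
qed

text \<open>The point mass at \<open>encode l\<close> stands for the list \<open>l\<close>. Other
  arguments are decoded arbitrarily, which is harmless because the value of \<open>J v\<close> at
  any fixed argument is linear in v.\<close>

definition code :: "(('o \<times> 'm option) list \<Rightarrow> complex) \<Rightarrow> 's"
  where "code L = decode (inv (\<lambda>l x. of_bool (x = encode l)) L)"

lemma code_decode: "code (\<lambda>x. of_bool (x = encode l)) = decode l"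
proof -
  have "inj (\<lambda>l x. of_bool (x = encode l) :: complex)"
  proof (rule injI)
    fix l l' assume "(\<lambda>x. of_bool (x = encode l) :: complex) = (\<lambda>x. of_bool (x = encode l'))"
    from fun_cong[OF this, of "encode l"] have "encode l = encode l'" by (simp split: if_splits)
    then show "l = l'" by (rule encode_inj)
  qed
  from inv_f_f[OF this, of l] show ?thesis unfolding code_def by simp
qed

text \<open>One basis is taken for words of all degrees and objects together. Morphism spaces may
  overlap inside the ambient space, and a common basis makes \<open>J\<close> a single map that
  depends on neither degree nor objects.\<close>

definition word_basis :: "'s set"
  where "word_basis = (SOME B. B \<subseteq> {w. \<exists>n X Y. is_word n X Y w} \<and> cvs.independent B \<and> {w. \<exists>n X Y.
    is_word n X Y w} \<subseteq> cvs.span B)"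

lemma word_basis:
  shows "word_basis \<subseteq> {w. \<exists>n X Y. is_word n X Y w}" "cvs.independent word_basis"
    "{w. \<exists>n X Y. is_word n X Y w} \<subseteq> cvs.span word_basis"
proof -
  define W where "W = {w. \<exists>n X Y. is_word n X Y w}"
  have "\<exists>B. B \<subseteq> W \<and> cvs.independent B \<and> W \<subseteq> cvs.span B"
    by (rule cvs.maximal_independent_subset[of W]) (intro exI conjI)
  then have "word_basis \<subseteq> W \<and> cvs.independent word_basis \<and> W \<subseteq> cvs.span word_basis"
    unfolding word_basis_def W_def[symmetric] by (rule someI_ex)
  then show "word_basis \<subseteq> {w. \<exists>n X Y. is_word n X Y w}" "cvs.independent word_basis"
    "{w. \<exists>n X Y. is_word n X Y w} \<subseteq> cvs.span word_basis"
    unfolding W_def by simp_all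
qed

definition total :: "'s set"
  where "total = cvs.span word_basis"

lemma spanned_total: "spanned n X Y \<subseteq> total"
  unfolding spanned_def total_def using word_basis(3) by (intro cvs.span_minimal) auto

definition J :: "'s \<Rightarrow> ('o, 'm) universal"
  where "J v = (\<lambda>L. cvs.representation word_basis v (code L))"

lemma J_linear:
  "\<lbrakk>v \<in> total; w \<in> total\<rbrakk> \<Longrightarrow> J (v + w) = J v + J w"
  "v \<in> total \<Longrightarrow> J (a *\<^sub>C v) = a *\<^sub>C J v"
  using cvs.representation_add[OF word_basis(2)] cvs.representation_scale[OF word_basis(2)]
  by (simp_all add: J_def total_def fun_eq_iff scaleC_fun_def scaleC_complex_def)

text \<open>Every basis vector is a word and so has a code; evaluation at the corresponding point
  mass recovers its coordinate.\<close>

lemma J_inj: "inj_on J total"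
proof (rule inj_onI)
  fix v w assume v: "v \<in> total" and w: "w \<in> total" and e: "J v = J w"
  have "cvs.representation word_basis v b = cvs.representation word_basis w b" for b
  proof (cases "b \<in> word_basis")
    case True
    then obtain l where "decode l = b" using word_basis(1) word_decode by blast
    then have "code (\<lambda>x. of_bool (x = encode l)) = b" by (simp add: code_decode)
    with fun_cong[OF e, of "\<lambda>x. of_bool (x = encode l)"] show ?thesis by (simp add: J_def)
  next
    case False
    then show ?thesis using cvs.representation_ne_zero by metis
  qed
  then have e': "cvs.representation word_basis v = cvs.representation word_basis w" by (rule ext)
  define g where "g f = (\<Sum>b | f b \<noteq> 0. f b *\<^sub>C b)" for f :: "'s \<Rightarrow> complex"
  have g: "g (cvs.representation word_basis u) = u" if "u \<in> total" for u
    unfolding g_def using that by (intro cvs.sum_nonzero_representation_eq[OF word_basis(2)]) (simp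
      add: total_def)
  show "v = w" using g[OF v] g[OF w] unfolding e' by simp
qed

definition J' :: "('o, 'm) universal \<Rightarrow> 's"
  where "J' = inv_into total J"

lemma J'_J: "v \<in> spanned n X Y \<Longrightarrow> J' (J v) = v"
  unfolding J'_def using spanned_total[of n X Y] by (intro inv_into_f_f[OF J_inj]) auto

lemma J_spanned:
  "\<lbrakk>v \<in> spanned n X Y; w \<in> spanned n X Y\<rbrakk> \<Longrightarrow> J (v + w) = J v + J w"
  "v \<in> spanned n X Y \<Longrightarrow> J (a *\<^sub>C v) = a *\<^sub>C J v"
  using J_linear spanned_total[of n X Y] by blast+

definition S' :: "('o, ('o, 'm) universal) dg_semicat"
  where "S' = \<lparr>DObj = Obj C, DHom = (\<lambda>n X Y. J ` spanned n X Y),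
    DComp = (\<lambda>X Y Z g f. J (DComp S X Y Z (J' g) (J' f))), DDiff = (\<lambda>X Y f. J (DDiff S X Y (J' f)))\<rparr>"

definition T' :: "'o \<Rightarrow> ('o, 'm) universal \<Rightarrow> complex"
  where "T' X g = T X (J' g)"

definition rho' :: "'o \<Rightarrow> 'o \<Rightarrow> 'm \<Rightarrow> ('o, 'm) universal"
  where "rho' X Y f = J (rho X Y f)"

lemma S'_simps [simp]:
  "DObj S' = Obj C" "DHom S' n X Y = J ` spanned n X Y"
  "DComp S' X Y Z g f = J (DComp S X Y Z (J' g) (J' f))" "DDiff S' X Y f' = J (DDiff S X Y (J' f'))"
  by (simp_all add: S'_def)

lemma clinear_on_J:
  assumes L: "clinear_on (DHom S i X Y) V L" and O: "X \<in> Obj C" "Y \<in> Obj C"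
    and m: "\<And>v. v \<in> spanned i X Y \<Longrightarrow> L v \<in> spanned j X' Y'"
  shows "clinear_on (J ` spanned i X Y) (J ` spanned j X' Y') (\<lambda>g. J (L (J' g)))"
proof -
  have s: "v \<in> DHom S i X Y" if "v \<in> spanned i X Y" for v using spanned_DHom[OF O] that by auto
  have "J (L (J' (J v + J w))) = J (L (J' (J v))) + J (L (J' (J w)))"
    if "v \<in> spanned i X Y" "w \<in> spanned i X Y" for v w
    using that cvs.subspace_add[OF spanned_subspace that]
    by (simp add: J'_J J_spanned(1)[OF m m] clinear_onD(2)[OF L s s] flip: J_spanned(1)[OF that])
  moreover have "J (L (J' (a *\<^sub>C J v))) = a *\<^sub>C J (L (J' (J v)))" if "v \<in> spanned i X Y" for v a
    using that cvs.subspace_scale[OF spanned_subspace that, of a]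
    by (simp add: J'_J J_spanned(2)[OF m] clinear_onD(3)[OF L s] flip: J_spanned(2)[OF that])
  ultimately show ?thesis
    using m by (auto simp: clinear_on_def J'_J)
qed

lemma S'_dg_semicategory: "dg_semicategory S'"
proof (unfold_locales, goal_cases)
  case (1 X Y n)
  show ?case
    unfolding cvs.subspace_def S'_simps
  proof (intro conjI ballI allI)
    have "J 0 = 0"
      using J_spanned(2)[OF cvs.subspace_0[OF spanned_subspace], of 0] by simp
    then show "0 \<in> J ` spanned n X Y" using cvs.subspace_0[OF spanned_subspace] by (metis image_eqI)
    show "x + y \<in> J ` spanned n X Y" if "x \<in> J ` spanned n X Y" "y \<in> J ` spanned n X Y" for x y
      using that cvs.subspace_add[OF spanned_subspace] by (auto simp flip: J_spanned(1))
    show "a *\<^sub>C x \<in> J ` spanned n X Y" if "x \<in> J ` spanned n X Y" for x a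
      using that cvs.subspace_scale[OF spanned_subspace] by (auto simp flip: J_spanned(2))
  qed
next
  case (2 X Y Z f i j)
  then obtain v where v: "v \<in> spanned i X Y" "f = J v" by auto
  have O: "X \<in> Obj C" "Y \<in> Obj C" "Z \<in> Obj C" using 2 by auto
  have vD: "v \<in> DHom S i X Y" using v spanned_DHom[OF O(1,2)] by auto
  show ?case
    unfolding S'_simps v(2) J'_J[OF v(1)]
    by (rule clinear_on_J[OF DComp_linear_left[OF O[folded DObj_eq] vD] O(2,3)])
      (rule spanned_comp[OF O v(1)])
next
  case (3 X Y Z g j i)
  then obtain v where v: "v \<in> spanned j Y Z" "g = J v" by auto
  have O: "X \<in> Obj C" "Y \<in> Obj C" "Z \<in> Obj C" using 3 by auto
  have vD: "v \<in> DHom S j Y Z" using v spanned_DHom[OF O(2,3)] by auto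
  show ?case
    unfolding S'_simps v(2) J'_J[OF v(1)]
    by (rule clinear_on_J[OF DComp_linear_right[OF O[folded DObj_eq] vD] O(1,2)])
      (rule spanned_comp[OF O _ v(1)])
next
  case (4 W X Y Z f i g j h k)
  then have O: "W \<in> Obj C" "X \<in> Obj C" "Y \<in> Obj C" "Z \<in> Obj C" by auto
  obtain u v w where u: "u \<in> spanned i W X" "f = J u" and v: "v \<in> spanned j X Y" "g = J v"
    and w: "w \<in> spanned k Y Z" "h = J w" using 4 by auto
  have "u \<in> DHom S i W X" "v \<in> DHom S j X Y" "w \<in> DHom S k Y Z"
    using u v w spanned_DHom O by blast+
  from DComp_assoc[OF O[folded DObj_eq] this] show ?case
    by (simp add: u(2) v(2) w(2) J'_J[OF u(1)] J'_J[OF v(1)] J'_J[OF w(1)]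
        J'_J[OF spanned_comp[OF O(1,2,3) u(1) v(1)]] J'_J[OF spanned_comp[OF O(2,3,4) v(1) w(1)]])
next
  case (5 X Y n)
  then have O: "X \<in> Obj C" "Y \<in> Obj C" by auto
  show ?case
    unfolding S'_simps
    by (rule clinear_on_J[OF DDiff_linear[OF O[folded DObj_eq]] O spanned_diff[OF O]])
next
  case (6 X Y f n)
  then have O: "X \<in> Obj C" "Y \<in> Obj C" by auto
  obtain v where v: "v \<in> spanned n X Y" "f = J v" using 6 by auto
  have "v \<in> DHom S n X Y" using v spanned_DHom[OF O] by auto
  then have "DDiff S X Y (DDiff S X Y v) = 0" using DDiff_DDiff O DObj_eq by metis
  moreover have "J 0 = 0"
    using J_spanned(2)[OF cvs.subspace_0[OF spanned_subspace], of 0] by simp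
  ultimately show ?case by (simp add: v(2) J'_J[OF v(1)] J'_J[OF spanned_diff[OF O v(1)]])
next
  case (7 X Y Z f i g j)
  then have O: "X \<in> Obj C" "Y \<in> Obj C" "Z \<in> Obj C" by auto
  obtain u v where u: "u \<in> spanned i X Y" "f = J u" and v: "v \<in> spanned j Y Z" "g = J v"
    using 7 by auto
  have D: "u \<in> DHom S i X Y" "v \<in> DHom S j Y Z" using u v spanned_DHom O by blast+
  have a: "DComp S X Y Z (DDiff S Y Z v) u \<in> spanned (Suc (j + i)) X Z"
    using spanned_comp[OF O u(1) spanned_diff[OF O(2,3) v(1)]] by simp
  have b: "DComp S X Y Z v (DDiff S X Y u) \<in> spanned (Suc (j + i)) X Z"
    using spanned_comp[OF O spanned_diff[OF O(1,2) u(1)] v(1)] by simp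
  have "J (DDiff S X Z (DComp S X Y Z v u))
      = J (DComp S X Y Z (DDiff S Y Z v) u) + (-1) ^ j *\<^sub>C J (DComp S X Y Z v (DDiff S X Y u))"
    unfolding DDiff_Leibniz[OF O[folded DObj_eq] D]
      J_spanned(1)[OF a cvs.subspace_scale[OF spanned_subspace b]] J_spanned(2)[OF b] ..
  then show ?case
    by (simp add: u(2) v(2) J'_J[OF u(1)] J'_J[OF v(1)] J'_J[OF spanned_comp[OF O u(1) v(1)]]
        J'_J[OF spanned_diff[OF O(1,2) u(1)]] J'_J[OF spanned_diff[OF O(2,3) v(1)]])
qed

lemma rho_spanned: "\<lbrakk>X \<in> Obj C; Y \<in> Obj C; f \<in> Hom C X Y\<rbrakk> \<Longrightarrow> rho X Y f \<in> spanned 0 X Y"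
  using spanned_gen[of X Y f False] by (simp add: gen_def)

lemma S'_dg_over: "dg_over C S' (\<lambda>X. X) rho'"
proof (intro dg_over.intro dg_over_axioms.intro linear_category_axioms S'_dg_semicategory)
  show "clinear_on (Hom C X Y) (DHom S' 0 X Y) (rho' X Y)" if O: "X \<in> Obj C" "Y \<in> Obj C" for X Y
    using clinear_onD[OF rho_linear[OF O]] rho_spanned[OF O] J_spanned[of _ 0 X Y]
    by (auto simp: clinear_on_def rho'_def)
  show "rho' X Z (Comp C X Y Z g f) = DComp S' X Y Z (rho' Y Z g) (rho' X Y f)"
    if O: "X \<in> Obj C" "Y \<in> Obj C" "Z \<in> Obj C" "f \<in> Hom C X Y" "g \<in> Hom C Y Z" for X Y Z f g
    using rho_Comp[OF O]
    by (simp add: rho'_def J'_J[OF rho_spanned[OF O(1,2,4)]] J'_J[OF rho_spanned[OF O(2,3,5)]])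
qed simp

lemma S'_closed_graded_trace: "closed_graded_trace S' r T'"
  unfolding closed_graded_trace_def
proof (intro conjI ballI allI impI)
  fix X assume "X \<in> DObj S'"
  then have X: "X \<in> Obj C" by simp
  have TX: "clinear_on (DHom S r X X) UNIV (T X)"
    using trace X DObj_eq by (simp add: closed_graded_trace_def)
  have s: "v \<in> DHom S r X X" if "v \<in> spanned r X X" for v using spanned_DHom[OF X X] that by auto
  have "T' X (J v + J w) = T' X (J v) + T' X (J w)" if "v \<in> spanned r X X" "w \<in> spanned r X X" for v w
    using that cvs.subspace_add[OF spanned_subspace that]
    by (simp add: T'_def J'_J clinear_onD(2)[OF TX s s] flip: J_spanned(1)[OF that])
  moreover have "T' X (a *\<^sub>C J v) = a *\<^sub>C T' X (J v)" if "v \<in> spanned r X X" for v a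
    using that cvs.subspace_scale[OF spanned_subspace that, of a]
    by (simp add: T'_def J'_J clinear_onD(3)[OF TX s] flip: J_spanned(2)[OF that])
  ultimately show "clinear_on (DHom S' r X X) UNIV (T' X)"
    by (auto simp: clinear_on_def)
  fix k g assume k: "Suc k = r" and "g \<in> DHom S' k X X"
  then obtain v where v: "v \<in> spanned k X X" "g = J v" by auto
  have "v \<in> DHom S k X X" using v spanned_DHom[OF X X] by auto
  then have "T X (DDiff S X X v) = 0" using trace X k DObj_eq by (simp add: closed_graded_trace_def)
  then show "T' X (DDiff S' X X g) = 0"
    by (simp add: T'_def v(2) J'_J[OF v(1)] J'_J[OF spanned_diff[OF X X v(1)]])
next
  fix X Y i j g g' assume "X \<in> DObj S'" "Y \<in> DObj S'" and ij: "i + j = r"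
    and g: "g \<in> DHom S' i Y X" and g': "g' \<in> DHom S' j X Y"
  then have X: "X \<in> Obj C" and Y: "Y \<in> Obj C" by auto
  obtain u v where u: "u \<in> spanned i Y X" "g = J u" and v: "v \<in> spanned j X Y" "g' = J v"
    using g g' by auto
  have "u \<in> DHom S i Y X" "v \<in> DHom S j X Y" using u v spanned_DHom X Y by blast+
  then have "T X (DComp S X Y X u v) = (-1) ^ (i * j) * T Y (DComp S Y X Y v u)"
    using trace X Y ij DObj_eq unfolding closed_graded_trace_def by blast
  then show "T' X (DComp S' X Y X g g') = (-1) ^ (i * j) * T' Y (DComp S' Y X Y g' g)"
    by (simp add: T'_def u(2) v(2) J'_J[OF u(1)] J'_J[OF v(1)] J'_J[OF spanned_comp[OF X Y X v(1) u(1)]]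
        J'_J[OF spanned_comp[OF Y X Y u(1) v(1)]])
qed

text \<open>The units of degree 0 are images of identities of C, hence words, and so survive the
  restriction to spans of words. This is why \<open>unital_cycle\<close> asks for units of that
  form.\<close>

lemma S'_cycle: "cycle_over C r S' T' (\<lambda>X. X) rho'"
proof -
  interpret S': dg_over C S' "\<lambda>X. X" rho' by (rule S'_dg_over)
  show ?thesis
  proof (unfold_locales, goal_cases)
    case (1 U)
    then have U: "U \<in> Obj C" by simp
    have e: "rho U U (Ident C U) \<in> spanned 0 U U" by (rule rho_spanned[OF U U Ident_in_Hom[OF U]])
    have "DComp S' V U U (rho' U U (Ident C U)) h = h" if V: "V \<in> Obj C" and h: "h \<in> DHom S' 0 V U"
      for V h
    proof -
      obtain v where v: "v \<in> spanned 0 V U" "h = J v" using h by auto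
      have "v \<in> DHom S 0 V U" using v spanned_DHom[OF V U] by auto
      then show ?thesis using unit[OF V U] by (simp add: v(2) rho'_def J'_J[OF e] J'_J[OF v(1)])
    qed
    moreover have "DComp S' U U V h (rho' U U (Ident C U)) = h" if V: "V \<in> Obj C" and h: "h \<in> DHom
      S' 0 U V" for V h
    proof -
      obtain v where v: "v \<in> spanned 0 U V" "h = J v" using h by auto
      have "v \<in> DHom S 0 U V" using v spanned_DHom[OF U V] by auto
      then show ?thesis using unit[OF U V] by (simp add: v(2) rho'_def J'_J[OF e] J'_J[OF v(1)])
    qed
    moreover have "rho' U U (Ident C U) \<in> DHom S' 0 U U" using e by (simp add: rho'_def)
    ultimately show ?case by (intro bexI[of _ "rho' U U (Ident C U)"]) auto
  next
    case 2 show ?case by (rule S'_closed_graded_trace)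
  next
    case (3 X) then show ?case by simp
  next
    case (4 X Y) then show ?case by (rule S'.rho_linear)
  next
    case (5 X Y Z f g) then show ?case by (rule S'.rho_Comp)
  qed
qed

lemma S'_character: "cycle_character C r S' T' (\<lambda>X. X) rho' = word_cochain r T"
proof -
  interpret S': dg_over C S' "\<lambda>X. X" rho' by (rule S'_dg_over)
  have z: "word c K a 0 \<in> spanned (if a \<in> K then 0 else 1) (ob c (Suc a)) (ob c a)"
    "S'.word c K a 0 = J (word c K a 0)" if c: "chain C n c" for n c K a
  proof -
    note O = chain_ob[OF c, of "Suc a"] chain_ob[OF c, of a]
    have R: "Rc c a \<in> spanned 0 (ob c (Suc a)) (ob c a)"
      unfolding Rc_def by (rule rho_spanned[OF O chain_mor[OF c]])
    have R': "S'.Rc c a = J (Rc c a)" by (simp add: S'.Rc_def Rc_def rho'_def)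
    have "Dc c a \<in> spanned 1 (ob c (Suc a)) (ob c a)"
      using spanned_diff[OF O R] by (simp add: Dc_def Yc_def)
    with R show "word c K a 0 \<in> spanned (if a \<in> K then 0 else 1) (ob c (Suc a)) (ob c a)"
      by (simp add: word_def letter_def)
    have "S'.Dc c a = J (Dc c a)"
      by (simp add: S'.Dc_def Dc_def R' J'_J[OF R])
    with R' show "S'.word c K a 0 = J (word c K a 0)"
      by (simp add: word_def S'.word_def letter_def S'.letter_def del: S'_simps)
  qed
  have w: "word c K a k \<in> spanned (\<Sum>i=a..a + k. if i \<in> K then 0 else 1) (ob c (a + k + 1)) (ob c a) \<and>
    S'.word c K a k = J (word c K a k)" if c: "chain C n c" for n c K a k
  proof (induction k arbitrary: a)
    case 0
    then show ?case using z[OF c, of K a] by simp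
  next
    case (Suc k)
    note z = z[OF c, of K a]
    have IH: "word c K (Suc a) k \<in> spanned (\<Sum>i=Suc a..Suc a + k. if i \<in> K then 0 else 1) (ob c (a +
      k + 2)) (ob c (Suc a))"
      "S'.word c K (Suc a) k = J (word c K (Suc a) k)" using Suc.IH[of "Suc a"] by auto
    have e: "word c K a (Suc k) = DComp S (ob c (a + k + 2)) (ob c (Suc a)) (ob c a) (word c K a 0)
      (word c K (Suc a) k)"
      by (simp add: word_def Yc_def)
    have e': "S'.word c K a (Suc k) = DComp S' (ob c (a + k + 2)) (ob c (Suc a)) (ob c a) (S'.word
      c K a 0) (S'.word c K (Suc a) k)"
      by (simp add: S'.word_def S'.Yc_def del: S'_simps)
    have n: "(\<Sum>i=a..a + Suc k. if i \<in> K then 0 else 1) = (if a \<in> K then 0 else 1) + (\<Sum>i=Suc a..Suc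
      a + k. if i \<in> K then 0 else 1::nat)"
      by (subst sum.atLeast_Suc_atMost) auto
    have "word c K a (Suc k) \<in> spanned (\<Sum>i=a..a + Suc k. if i \<in> K then 0 else 1) (ob c (a + k + 2))
      (ob c a)"
      unfolding n e by (rule spanned_comp[OF chain_ob[OF c] chain_ob[OF c] chain_ob[OF c] IH(1) z(1)])
    moreover have "S'.word c K a (Suc k) = J (word c K a (Suc k))"
      unfolding e e' z(2) IH(2) by (simp add: J'_J[OF z(1)] J'_J[OF IH(1)])
    moreover have "a + k + 2 = a + Suc k + 1" by simp
    ultimately show ?case by (simp only:)
  qed
  have "S'.word_cochain r T' = word_cochain r T"
  proof
    fix c show "S'.word_cochain r T' c = word_cochain r T c"
    proof (cases "chain C r c")
      case True
      have "J' (J (word c {0} 0 r)) = word c {0} 0 r"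
        using w[OF True, of "{0}" 0 r] J'_J by blast
      then show ?thesis
        using w[OF True, of "{0}" 0 r] True by (simp add: S'.word_cochain_def word_cochain_def T'_def)
    qed (simp add: S'.word_cochain_def word_cochain_def)
  qed
  then show ?thesis by (simp add: S'.cycle_character_eq_word_cochain)
qed

end

section \<open>Periodicity for the characters of a Fredholm module\<close>

lemma cycle_over_dg_over:
  assumes "cycle_over C r S T rho_ob rho"
  shows "dg_over C S rho_ob rho"
proof -
  interpret cycle_over C r S T rho_ob rho by (rule assms)
  show ?thesis by unfold_locales (simp_all add: rho_ob_Obj rho_linear rho_Comp)
qed

lemma cup_psi0_eq:
  assumes "cycle_over C r S T rho_ob rho"
  shows "cup_psi0 C r S T rho_ob rho = S_cochain C r (cycle_character C r S T rho_ob rho)"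
proof -
  interpret cycle_over C r S T rho_ob rho by (rule assms)
  interpret D: dg_over C S rho_ob rho by (rule cycle_over_dg_over[OF assms])
  have "clinear_on (DHom S r X X) UNIV (T X)" if "X \<in> DObj S" for X
    using closed_graded_trace that by (simp add: closed_graded_trace_def)
  then show ?thesis by (simp add: D.cup_psi0_eq_S_cochain D.cycle_character_eq_word_cochain)
qed

context summable_fredholm_module
begin

lemma fr_unital_cycle:
  assumes "even r" "N \<le> Suc r"
  shows "unital_cycle C (fr_dg N) fr_rho r fr_trace"
proof (intro unital_cycle.intro unital_cycle_axioms.intro fr_dg_over fr_closed_graded_trace[OF assms])
  fix X Y h assume X: "X \<in> Obj C" and Y: "Y \<in> Obj C" and h: "h \<in> DHom (fr_dg N) 0 X Y"
  then have h: "h \<in> fr_hom N 0 X Y" by simp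
  show "DComp (fr_dg N) X Y Y (fr_rho Y Y (Ident C Y)) h = h \<and> DComp (fr_dg N) X X Y h (fr_rho X X
    (Ident C X)) = h"
    using Hmap_Ident[OF X] Hmap_Ident[OF Y] fr_hom_H[OF h] fr_homD(2)[OF h]
    by (auto simp: fr_comp_def fr_rho_def fun_eq_iff)
qed simp

text \<open>The transported operator cycle shows that the choice in \<open>periodicity_op\<close>
  has a witness. Whichever cycle is chosen, \<open>cup_psi0_eq\<close> computes the product from the
  character alone.\<close>

theorem periodicity_op_fredholm:
  assumes "even r" "N \<le> Suc r"
  shows "periodicity_op C r (fredholm_character C M r) = S_cochain C r (fredholm_character C M r)"
proof -
  interpret U: unital_cycle C "fr_dg N" fr_rho r fr_trace by (rule fr_unital_cycle[OF assms])
  define P where "P \<psi> \<longleftrightarrow> (\<exists>(S :: ('o, ('o, 'm) universal) dg_semicat) T rho_ob rho.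
       cycle_over C r S T rho_ob rho \<and>
       cycle_character C r S T rho_ob rho = fredholm_character C M r \<and>
       \<psi> = cup_psi0 C r S T rho_ob rho)" for \<psi>
  have "cycle_character C r U.S' U.T' (\<lambda>X. X) U.rho' = fredholm_character C M r"
    unfolding U.S'_character fredholm_character_eq[OF assms(1)] ..
  then have "P (cup_psi0 C r U.S' U.T' (\<lambda>X. X) U.rho')"
    unfolding P_def using U.S'_cycle by blast
  then have "P (SOME \<psi>. P \<psi>)" by (rule someI[of P])
  also have "(SOME \<psi>. P \<psi>) = periodicity_op C r (fredholm_character C M r)"
    unfolding P_def periodicity_op_def ..
  finally obtain S :: "('o, ('o, 'm) universal) dg_semicat" and T rho_ob rho
    where c: "cycle_over C r S T rho_ob rho" "cycle_character C r S T rho_ob rho =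
      fredholm_character C M r"
      and e: "periodicity_op C r (fredholm_character C M r) = cup_psi0 C r S T rho_ob rho"
    unfolding P_def by blast
  show ?thesis unfolding e cup_psi0_eq[OF c(1)] c(2) ..
qed

end

theorem proposition3p3:
  fixes C :: "('o, 'm::complex_vector) lin_cat"
    and M :: "('o, 'm, 'h::complex_hilbert_space) fredholm_module"
    and p :: real
    and m :: nat
  assumes "linear_category C"
    and "1 \<le> p"
    and "even_fredholm_module C p M"
    and "p - 1 \<le> real (2 * m)"
  shows "cohomology_class C (2 * m + 2)
            (periodicity_op C (2 * m) (fredholm_character C M (2 * m)))
          = cohomology_class C (2 * m + 2)
            ((- of_nat (m + 1)) *\<^sub>C fredholm_character C M (2 * m + 2)) \<and>
         cohomology_class C (2 * m + 2)
            (periodicity_op C (2 * m) (fredholm_character C M (2 * m)))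
          \<in> H_lambda C (2 * m + 2)"
proof -
  interpret even_fredholm_module C p M by (rule assms(3))
  \<comment> \<open>The hypothesis p - 1 \<le> 2m says that N = 2m + 1 is an admissible integer
    exponent.\<close>
  interpret summable_fredholm_module C p M "Suc (2 * m)"
    using assms(2,4) by unfold_locales auto
  let ?n = "Suc (2 * m)"
  have ch: "fredholm_character C M (2 * m) = \<phi> (2 * m)" "fredholm_character C M (2 * m + 2) = \<phi>
    (Suc ?n)"
    by (simp_all add: fredholm_character_eq)
  have S: "periodicity_op C (2 * m) (\<phi> (2 * m)) = hochschild_b C ?n (\<theta> ?n) + (- of_nat (m + 1)) *\<^sub>C
    \<phi> (Suc ?n)"
    using periodicity_op_fredholm[of "2 * m"] S_cochain_fredholm[of "2 * m"]
    by (simp only: ch even_mult_iff dvd_refl simp_thms order_refl cvs.scale_minus_left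
      add_uminus_conv_diff)
      (simp del: of_nat_add of_nat_Suc)
  have \<theta>: "\<theta> ?n \<in> C_lambda C ?n" by (rule \<theta>_C_lambda) auto
  have Z: "(- of_nat (m + 1)) *\<^sub>C \<phi> (Suc ?n) \<in> Z_lambda C (Suc ?n)"
    by (intro Z_lambda_scale \<phi>_Z_lambda) auto
  have "hochschild_b C ?n (\<theta> ?n) \<in> Z_lambda C (Suc ?n)"
    using C_lambda_hochschild_b[OF \<theta>] hochschild_b_hochschild_b by (simp add: Z_lambda_def)
  then have "periodicity_op C (2 * m) (\<phi> (2 * m)) \<in> Z_lambda C (Suc ?n)"
    unfolding S by (rule Z_lambda_add[OF _ Z])
  from cohomology_class_eqI[OF this Z \<theta>] show ?thesis
    unfolding ch S by simp
qed

end
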